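(* Let $\Gamma$ be a finitely generated group, $S\subseteq\Gamma$ a finite symmetric generating set containing the identity element, and $\Theta\geq 1$ a constant. Let $\rho\colon\Gamma\curvearrowright(X,\nu)$ be a measure-class-preserving action on a probability space such that $1/\Theta\leq r(s,x)\leq\Theta$ for every $s\in S$ and $x\in X$. Then $\rho$ is expanding in measure if and only if $0$ is a simple isolated point in the spectrum of the Laplacian $\Delta\in\mathfrak{B}(L^2(X,\tilde\nu))$ (i.e. $0$ is an isolated point of the spectrum with multiplicity one).
   Context: Actions are measurable; an action is measure-class-preserving if it sends measure-zero sets to measure-zero sets. For $\gamma\in\Gamma$, $x\in X$, $r(\gamma,x):=\frac{d\gamma^{-1}_*\nu}{d\nu}(x)$ denotes the Radon--Nikodym derivative. The measure $\tilde\nu$ on $X$ is defined by $d\tilde\nu(x):=\sum_{s\in S}r(s,x)^{1/2}\,d\nu(x)$, and the Markov kernel $\Pi$ on $X$ by $$\Pi(x,\cdot):=\frac{1}{\sum_{s\in S}r(s,x)^{1/2}}\sum_{s\in S}r(s,x)^{1/2}\,\delta_{s\cdot x},$$ where $\delta_y$ is the Dirac measure at $y$. The associated Markov operator is $\mathfrak{P}f(x):=\int_X f(y)\,\Pi(x,dy)$, which is a bounded self-adjoint operator on $L^2(X,\tilde\nu)$, and the Laplacian is $\Delta:=1-\mathfrak{P}\in\mathfrak{B}(L^2(X,\tilde\nu))$. Here $\mathfrak{B}(H)$ denotes the bounded operators on $H$; $L^2$-spaces are complex. The action $\rho$ is expanding in measure if there are a constant $c>0$ and a finite subset $S'\subseteq\Gamma$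 such that every measurable $A\subseteq X$ with $0<\nu(A)\leq\frac12$ satisfies $\nu\big((S'\cdot A)\setminus A\big)>c\,\nu(A)$, where $S'\cdot A:=\bigcup_{s\in S'}s\cdot A$. *)

theory Defs
  imports
    "HOL-Probability.Probability"
    "HOL-Analysis.Isolated"
    "HOL-Algebra.Generated_Groups"
    "HOL-Algebra.Group_Action"
begin

section \<open>Bounded operators on complex \<open>L\<^sup>2\<close>\<close>

text \<open>
  Elements of \<open>L\<^sup>2(M)\<close> are represented by square-integrable functions, with equality in \<open>L\<^sup>2(M)\<close>
  being equality almost everywhere.  Accordingly a bounded operator on \<open>L\<^sup>2(M)\<close> is represented by a
  map on functions that descends to a bounded linear map of almost-everywhere classes; every
  bounded operator on the quotient arises in this way (choose representatives).  Identities
  between elements of \<open>L\<^sup>2(M)\<close> are therefore always stated almost everywhere.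
\<close>

definition l2_space :: "'a measure \<Rightarrow> ('a \<Rightarrow> complex) set" where
  "l2_space M = {f \<in> borel_measurable M. integrable M (\<lambda>x. (cmod (f x))\<^sup>2)}"

definition l2_norm :: "'a measure \<Rightarrow> ('a \<Rightarrow> complex) \<Rightarrow> real" where
  "l2_norm M f = sqrt (LINT x|M. (cmod (f x))\<^sup>2)"

definition l2_bounded_operator ::
    "'a measure \<Rightarrow> (('a \<Rightarrow> complex) \<Rightarrow> ('a \<Rightarrow> complex)) \<Rightarrow> bool" where
  "l2_bounded_operator M T \<longleftrightarrow>
     (\<forall>f\<in>l2_space M. T f \<in> l2_space M) \<and>
     (\<forall>f\<in>l2_space M. \<forall>g\<in>l2_space M. (AE x in M. f x = g x) \<longrightarrow> (AE x in M. T f x = T g x)) \<and>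
     (\<forall>f\<in>l2_space M. \<forall>g\<in>l2_space M. AE x in M. T (\<lambda>y. f y + g y) x = T f x + T g x) \<and>
     (\<forall>f\<in>l2_space M. \<forall>c. AE x in M. T (\<lambda>y. c * f y) x = c * T f x) \<and>
     (\<exists>K. \<forall>f\<in>l2_space M. l2_norm M (T f) \<le> K * l2_norm M f)"

text \<open>The complex numbers \<open>z\<close> such that \<open>z - T\<close> has no inverse among the bounded operators.\<close>

definition l2_spectrum ::
    "'a measure \<Rightarrow> (('a \<Rightarrow> complex) \<Rightarrow> ('a \<Rightarrow> complex)) \<Rightarrow> complex set" where
  "l2_spectrum M T = {z. \<not> (\<exists>R. l2_bounded_operator M R \<and>
     (\<forall>f\<in>l2_space M.
        (AE x in M. R (\<lambda>y. z * f y - T f y) x = f x) \<and>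
        (AE x in M. z * R f x - T (R f) x = f x)))}"

definition l2_eigenspace ::
    "'a measure \<Rightarrow> (('a \<Rightarrow> complex) \<Rightarrow> ('a \<Rightarrow> complex)) \<Rightarrow> complex \<Rightarrow> ('a \<Rightarrow> complex) set" where
  "l2_eigenspace M T z = {f \<in> l2_space M. AE x in M. T f x = z * f x}"

text \<open>The eigenspace, as a subspace of \<open>L\<^sup>2(M)\<close>, has a basis \<open>e 0, \<dots>, e (n - 1)\<close>.\<close>

definition l2_has_multiplicity ::
    "'a measure \<Rightarrow> (('a \<Rightarrow> complex) \<Rightarrow> ('a \<Rightarrow> complex)) \<Rightarrow> complex \<Rightarrow> nat \<Rightarrow> bool" where
  "l2_has_multiplicity M T z n \<longleftrightarrow> (\<exists>e.
     (\<forall>i<n. e i \<in> l2_eigenspace M T z) \<and>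
     (\<forall>c :: nat \<Rightarrow> complex. (AE x in M. (\<Sum>i<n. c i * e i x) = 0) \<longrightarrow> (\<forall>i<n. c i = 0)) \<and>
     (\<forall>f\<in>l2_eigenspace M T z. \<exists>c. AE x in M. f x = (\<Sum>i<n. c i * e i x)))"


section \<open>Measure-class-preserving actions\<close>

definition measure_class_preserving_action ::
    "('g, 'b) monoid_scheme \<Rightarrow> 'x measure \<Rightarrow> ('g \<Rightarrow> 'x \<Rightarrow> 'x) \<Rightarrow> bool" where
  "measure_class_preserving_action G M \<phi> \<longleftrightarrow>
     group_action G (space M) \<phi> \<and>
     (\<forall>g\<in>carrier G. \<phi> g \<in> measurable M M) \<and>
     (\<forall>g\<in>carrier G. \<forall>A\<in>null_sets M. \<phi> g ` A \<in> null_sets M)"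

text \<open>
  \<open>r g\<close> is a (real-valued, everywhere nonnegative) version of the Radon--Nikodym derivative of the
  push-forward of \<open>M\<close> under \<open>g\<^sup>-\<^sup>1\<close> with respect to \<open>M\<close>.  Versions are only unique almost
  everywhere, so pointwise conditions on the derivative refer to a chosen version.
\<close>

definition rn_version ::
    "('g, 'b) monoid_scheme \<Rightarrow> 'x measure \<Rightarrow> ('g \<Rightarrow> 'x \<Rightarrow> 'x) \<Rightarrow> ('g \<Rightarrow> 'x \<Rightarrow> real) \<Rightarrow> bool" where
  "rn_version G M \<phi> r \<longleftrightarrow> (\<forall>g\<in>carrier G.
     r g \<in> borel_measurable M \<and>
     (\<forall>x\<in>space M. 0 \<le> r g x) \<and>
     (AE x in M. ennreal (r g x) = RN_deriv M (distr M M (\<phi> (inv\<^bsub>G\<^esub> g))) x))"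

definition expanding_in_measure ::
    "('g, 'b) monoid_scheme \<Rightarrow> 'x measure \<Rightarrow> ('g \<Rightarrow> 'x \<Rightarrow> 'x) \<Rightarrow> bool" where
  "expanding_in_measure G M \<phi> \<longleftrightarrow> (\<exists>c>0. \<exists>S'. finite S' \<and> S' \<subseteq> carrier G \<and>
     (\<forall>A\<in>sets M. 0 < measure M A \<and> measure M A \<le> 1 / 2 \<longrightarrow>
        measure M ((\<Union>s\<in>S'. \<phi> s ` A) - A) > c * measure M A))"


section \<open>The Markov kernel and the Laplacian\<close>

definition weighted_measure :: "'x measure \<Rightarrow> 'g set \<Rightarrow> ('g \<Rightarrow> 'x \<Rightarrow> real) \<Rightarrow> 'x measure" where
  "weighted_measure M S r = density M (\<lambda>x. ennreal (\<Sum>s\<in>S. sqrt (r s x)))"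

text \<open>
  The weighted sum of Dirac measures at the points \<open>\<phi> s x\<close> is the image under \<open>\<lambda>s. \<phi> s x\<close> of the
  weighted counting measure on \<open>S\<close>; see \<open>emeasure_markov_kernel\<close> below.
\<close>

definition markov_kernel ::
    "'x measure \<Rightarrow> ('g \<Rightarrow> 'x \<Rightarrow> 'x) \<Rightarrow> 'g set \<Rightarrow> ('g \<Rightarrow> 'x \<Rightarrow> real) \<Rightarrow> 'x \<Rightarrow> 'x measure" where
  "markov_kernel M \<phi> S r x =
     distr (point_measure S (\<lambda>s. ennreal (sqrt (r s x) / (\<Sum>t\<in>S. sqrt (r t x))))) M (\<lambda>s. \<phi> s x)"

definition markov_operator ::
    "'x measure \<Rightarrow> ('g \<Rightarrow> 'x \<Rightarrow> 'x) \<Rightarrow> 'g set \<Rightarrow> ('g \<Rightarrow> 'x \<Rightarrow> real)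
      \<Rightarrow> ('x \<Rightarrow> complex) \<Rightarrow> 'x \<Rightarrow> complex" where
  "markov_operator M \<phi> S r f x = (LINT y|markov_kernel M \<phi> S r x. f y)"

definition laplacian ::
    "'x measure \<Rightarrow> ('g \<Rightarrow> 'x \<Rightarrow> 'x) \<Rightarrow> 'g set \<Rightarrow> ('g \<Rightarrow> 'x \<Rightarrow> real)
      \<Rightarrow> ('x \<Rightarrow> complex) \<Rightarrow> 'x \<Rightarrow> complex" where
  "laplacian M \<phi> S r f x = f x - markov_operator M \<phi> S r f x"

lemma emeasure_markov_kernel:
  assumes "finite S" "\<And>s. s \<in> S \<Longrightarrow> \<phi> s x \<in> space M" "\<And>s. s \<in> S \<Longrightarrow> 0 \<le> r s x" "A \<in> sets M"
  shows "emeasure (markov_kernel M \<phi> S r x) A =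
    (\<Sum>s\<in>S. ennreal (sqrt (r s x) / (\<Sum>t\<in>S. sqrt (r t x))) * emeasure (return M (\<phi> s x)) A)"
proof -
  let ?w = "\<lambda>s. ennreal (sqrt (r s x) / (\<Sum>t\<in>S. sqrt (r t x)))"
  let ?B = "(\<lambda>s. \<phi> s x) -` A \<inter> S"
  have "emeasure (markov_kernel M \<phi> S r x) A = emeasure (point_measure S ?w) ?B"
    unfolding markov_kernel_def
    by (subst emeasure_distr) (use assms in \<open>auto simp: space_point_measure\<close>)
  also have "\<dots> = (\<Sum>s\<in>?B. ?w s)"
    using assms(1) by (intro emeasure_point_measure_finite) auto
  also have "\<dots> = (\<Sum>s\<in>S. if \<phi> s x \<in> A then ?w s else 0)"
    using assms(1) by (intro sum.mono_neutral_cong_left) auto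
  also have "\<dots> = (\<Sum>s\<in>S. ?w s * emeasure (return M (\<phi> s x)) A)"
    using assms(4) by (intro sum.cong) (auto simp: indicator_def)
  finally show ?thesis .
qed

lemma markov_operator_eq:
  assumes "finite S" "\<And>s. s \<in> S \<Longrightarrow> \<phi> s x \<in> space M" "\<And>s. s \<in> S \<Longrightarrow> 0 \<le> r s x"
    and "f \<in> borel_measurable M"
  shows "markov_operator M \<phi> S r f x =
    (\<Sum>s\<in>S. complex_of_real (sqrt (r s x)) * f (\<phi> s x)) / complex_of_real (\<Sum>t\<in>S. sqrt (r t x))"
proof -
  have nn: "0 \<le> sqrt (r s x) / (\<Sum>t\<in>S. sqrt (r t x))" if "s \<in> S" for s
    using that assms(3) by (intro divide_nonneg_nonneg sum_nonneg) auto
  have "markov_operator M \<phi> S r f x =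
      (LINT s|point_measure S (\<lambda>s. ennreal (sqrt (r s x) / (\<Sum>t\<in>S. sqrt (r t x)))). f (\<phi> s x))"
    unfolding markov_operator_def markov_kernel_def
    by (subst integral_distr) (use assms in auto)
  also have "\<dots> = (\<Sum>s\<in>S. (sqrt (r s x) / (\<Sum>t\<in>S. sqrt (r t x))) *\<^sub>R f (\<phi> s x))"
    using assms(1) nn by (rule lebesgue_integral_point_measure_finite)
  finally show ?thesis
    by (simp add: scaleR_conv_of_real sum_divide_distrib)
qed

end

theory Submission
  imports Defs
begin

text \<open>
  Two facts are combined: a statement about positive operators, and Cheeger's inequality with its
  converse.

  \<^emph>\<open>Spectral part.\<close> For a bounded positive operator \<open>T\<close> on \<open>L\<^sup>2\<close> with a nonzero kernel vector \<open>e\<close>, the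
  point \<open>0\<close> is isolated in the spectrum with multiplicity one iff there is a \<^emph>\<open>spectral gap\<close>
  \<open>\<langle>T f, f\<rangle> \<ge> \<kappa> \<parallel>f\<parallel>\<^sup>2\<close> for some \<open>\<kappa> > 0\<close> and all \<open>f\<close> orthogonal to \<open>e\<close> (\<open>isolated_simple_iff_gap\<close>). With the
  functional calculus this is immediate; here it is obtained by elementary means. Given a gap,
  \<open>z u - T u = f\<close> is solved for \<open>|z| < \<kappa>\<close> and \<open>f\<close> orthogonal to \<open>e\<close> by a contraction (\<open>gap_solve\<close>); on
  multiples of \<open>e\<close> one divides by \<open>z\<close>, which gives the resolvent for \<open>z \<noteq> 0\<close> (\<open>gap_resolvent\<close>). Conversely, if the spectrum avoids an interval \<open>(0, a)\<close>, then
  \<open>\<parallel>T f\<parallel>\<^sup>2 \<ge> a \<langle>T f, f\<rangle>\<close> for all \<open>f\<close> (\<open>interval_gap_form\<close>). So \<open>T\<close> is at least \<open>a\<close> on its range, and iterating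
  \<open>1 - T/K\<close> transports this to the orthogonal complement of the kernel
  (\<open>interval_gap_bounded_below\<close>); by simplicity this is the orthogonal complement of \<open>e\<close>. All spaces
  consist of functions, with equality almost everywhere, so the completeness of \<open>L\<^sup>2\<close> is established
  in the form that the iterations need (\<open>l2_complete_geometric\<close>).

  \<^emph>\<open>Geometric part.\<close> The weights \<open>sqrt (r s x)\<close> make the Markov kernel reversible
  (\<open>integral_sqrt_r_swap\<close>), so the Laplacian is positive with Dirichlet form
  \<open>\<langle>\<Delta> f, f\<rangle> = 1/2 \<Sum>\<^sub>s \<integral> sqrt (r s x) |f x - f (s x)|\<^sup>2\<close> (\<open>laplacian_inner\<close>). It vanishes on constants,
  and up to constants the weights may be omitted, as the densities are bounded. A spectral gap,
  applied to indicator functions minus their means, gives expansion by \<open>S\<close>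
  (\<open>expanding_of_gap\<close>). Conversely, expansion by any finite set implies expansion by \<open>S\<close>, because \<open>S\<close>
  generates the group and each generator distorts the measure by a bounded factor
  (\<open>expanding_by_generators\<close>). Expansion of all superlevel sets integrates to an \<open>L\<^sup>1\<close> inequality
  (\<open>coarea_expansion\<close>), which for squares becomes the \<open>L\<^sup>2\<close> inequality of Cheeger
  (\<open>cheeger_small_support\<close>). Splitting at a median extends it to all functions (\<open>poincare\<close>), and this is
  the spectral gap (\<open>gap_of_expanding\<close>).
\<close>

section \<open>The geometry of \<open>L\<^sup>2\<close>\<close>

definition l2_inner :: "'a measure \<Rightarrow> ('a \<Rightarrow> complex) \<Rightarrow> ('a \<Rightarrow> complex) \<Rightarrow> complex" where
  "l2_inner N f g = (LINT x|N. f x * cnj (g x))"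

lemma borel_measurable_cnj [measurable (raw)]:
  "f \<in> borel_measurable N \<Longrightarrow> (\<lambda>x. cnj (f x)) \<in> borel_measurable N"
  by (rule borel_measurable_continuous_on[OF continuous_on_cnj[OF continuous_on_id]])

lemma l2_space_measurable [measurable_dest]: "f \<in> l2_space N \<Longrightarrow> f \<in> borel_measurable N"
  by (simp add: l2_space_def)

lemma l2_space_scale [intro]:
  assumes "f \<in> l2_space N"
  shows "(\<lambda>x. c * f x) \<in> l2_space N"
  using assms by (auto simp: l2_space_def norm_mult power_mult_distrib)

lemma l2_space_add [intro]:
  assumes "f \<in> l2_space N" "g \<in> l2_space N"
  shows "(\<lambda>x. f x + g x) \<in> l2_space N"
proof -
  have [measurable]: "f \<in> borel_measurable N" "g \<in> borel_measurable N"
    using assms by (auto simp: l2_space_def)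
  have "integrable N (\<lambda>x. 2 * (cmod (f x))\<^sup>2 + 2 * (cmod (g x))\<^sup>2)"
    using assms by (auto simp: l2_space_def)
  then have "integrable N (\<lambda>x. (cmod (f x + g x))\<^sup>2)"
  proof (rule Bochner_Integration.integrable_bound)
    show "AE x in N. norm ((cmod (f x + g x))\<^sup>2) \<le> norm (2 * (cmod (f x))\<^sup>2 + 2 * (cmod (g x))\<^sup>2)"
    proof (rule AE_I2)
      fix x
      have "(cmod (f x + g x))\<^sup>2 \<le> (cmod (f x) + cmod (g x))\<^sup>2"
        by (intro power_mono norm_triangle_ineq) auto
      also have "\<dots> \<le> 2 * (cmod (f x))\<^sup>2 + 2 * (cmod (g x))\<^sup>2"
        using sum_squares_bound[of "cmod (f x)" "cmod (g x)"] by (simp add: power2_sum)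
      finally show "norm ((cmod (f x + g x))\<^sup>2) \<le> norm (2 * (cmod (f x))\<^sup>2 + 2 * (cmod (g x))\<^sup>2)"
        by simp
    qed
  qed auto
  then show ?thesis by (simp add: l2_space_def)
qed

lemma l2_space_diff [intro]:
  assumes "f \<in> l2_space N" "g \<in> l2_space N"
  shows "(\<lambda>x. f x - g x) \<in> l2_space N"
  using l2_space_add[OF assms(1) l2_space_scale[OF assms(2), of "-1"]] by simp

lemma l2_space_zero [intro]: "(\<lambda>x. 0) \<in> l2_space N"
  by (simp add: l2_space_def)

lemma integrable_l2_inner [intro]:
  assumes "f \<in> l2_space N" "g \<in> l2_space N"
  shows "integrable N (\<lambda>x. f x * cnj (g x))"
proof -
  have [measurable]: "f \<in> borel_measurable N" "g \<in> borel_measurable N"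
    using assms by (auto simp: l2_space_def)
  have "integrable N (\<lambda>x. (cmod (f x))\<^sup>2 + (cmod (g x))\<^sup>2)"
    using assms by (auto simp: l2_space_def)
  then show ?thesis
  proof (rule Bochner_Integration.integrable_bound)
    have "norm (f x * cnj (g x)) \<le> norm ((cmod (f x))\<^sup>2 + (cmod (g x))\<^sup>2)" for x
    proof -
      have "0 \<le> cmod (f x) * cmod (g x)" by simp
      then have "cmod (f x) * cmod (g x) \<le> (cmod (f x))\<^sup>2 + (cmod (g x))\<^sup>2"
        using sum_squares_bound[of "cmod (f x)" "cmod (g x)"] by linarith
      then show ?thesis by (simp add: norm_mult)
    qed
    then show "AE x in N. norm (f x * cnj (g x)) \<le> norm ((cmod (f x))\<^sup>2 + (cmod (g x))\<^sup>2)"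
      by simp
  qed measurable
qed

lemma l2_inner_add_left:
  assumes "f \<in> l2_space N" "g \<in> l2_space N" "h \<in> l2_space N"
  shows "l2_inner N (\<lambda>x. f x + g x) h = l2_inner N f h + l2_inner N g h"
  unfolding l2_inner_def using assms
  by (simp add: ring_distribs Bochner_Integration.integral_add integrable_l2_inner)

lemma l2_inner_diff_left:
  assumes "f \<in> l2_space N" "g \<in> l2_space N" "h \<in> l2_space N"
  shows "l2_inner N (\<lambda>x. f x - g x) h = l2_inner N f h - l2_inner N g h"
  unfolding l2_inner_def using assms
  by (simp add: ring_distribs Bochner_Integration.integral_diff integrable_l2_inner)

lemma l2_inner_scale_left: "l2_inner N (\<lambda>x. c * f x) h = c * l2_inner N f h"
  unfolding l2_inner_def by (simp add: mult.assoc)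

lemma l2_inner_commute: "l2_inner N f g = cnj (l2_inner N g f)"
  unfolding l2_inner_def
  by (simp add: Bochner_Integration.integral_cnj[symmetric] mult.commute
      del: Bochner_Integration.integral_cnj)

lemma l2_inner_add_right:
  assumes "f \<in> l2_space N" "g \<in> l2_space N" "h \<in> l2_space N"
  shows "l2_inner N h (\<lambda>x. f x + g x) = l2_inner N h f + l2_inner N h g"
  using assms by (simp add: l2_inner_commute[of N h] l2_inner_add_left)

lemma l2_inner_diff_right:
  assumes "f \<in> l2_space N" "g \<in> l2_space N" "h \<in> l2_space N"
  shows "l2_inner N h (\<lambda>x. f x - g x) = l2_inner N h f - l2_inner N h g"
  using assms by (simp add: l2_inner_commute[of N h] l2_inner_diff_left)

lemma l2_inner_scale_right: "l2_inner N h (\<lambda>x. c * f x) = cnj c * l2_inner N h f"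
  by (simp add: l2_inner_commute[of N h] l2_inner_scale_left)

lemmas l2_inner_linear =
  l2_inner_add_left l2_inner_diff_left l2_inner_scale_left
  l2_inner_add_right l2_inner_diff_right l2_inner_scale_right
  l2_space_add l2_space_diff l2_space_scale

lemma l2_norm_nonneg [simp]: "0 \<le> l2_norm N f"
  by (simp add: l2_norm_def)

lemma l2_norm_square: "(l2_norm N f)\<^sup>2 = (LINT x|N. (cmod (f x))\<^sup>2)"
  by (simp add: l2_norm_def)

lemma l2_inner_self: "l2_inner N f f = of_real ((l2_norm N f)\<^sup>2)"
  unfolding l2_norm_square l2_inner_def integral_complex_of_real[symmetric]
  by (simp add: complex_norm_square del: of_real_power)

lemma l2_norm_eq_0_iff:
  assumes "f \<in> l2_space N"
  shows "l2_norm N f = 0 \<longleftrightarrow> (AE x in N. f x = 0)"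
proof -
  have "l2_norm N f = 0 \<longleftrightarrow> (LINT x|N. (cmod (f x))\<^sup>2) = 0"
    by (simp add: l2_norm_def)
  also have "\<dots> \<longleftrightarrow> (AE x in N. (cmod (f x))\<^sup>2 = 0)"
    using assms by (intro integral_nonneg_eq_0_iff_AE) (auto simp: l2_space_def)
  finally show ?thesis by simp
qed

lemma l2_norm_cong_AE:
  assumes "AE x in N. f x = g x" "f \<in> borel_measurable N" "g \<in> borel_measurable N"
  shows "l2_norm N f = l2_norm N g"
  unfolding l2_norm_def using assms by (intro arg_cong[where f=sqrt] integral_cong_AE) auto

lemma l2_inner_cong_AE:
  assumes "AE x in N. f x = f' x" "AE x in N. g x = g' x"
    and "f \<in> borel_measurable N" "g \<in> borel_measurable N"
    and "f' \<in> borel_measurable N" "g' \<in> borel_measurable N"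
  shows "l2_inner N f g = l2_inner N f' g'"
  unfolding l2_inner_def using assms by (intro integral_cong_AE) auto

lemma l2_norm_scale: "l2_norm N (\<lambda>x. c * f x) = cmod c * l2_norm N f"
  by (simp add: l2_norm_def norm_mult power_mult_distrib real_sqrt_mult)

text \<open>
  Stated for forms rather than for the inner product because it is also applied to \<open>\<langle>A f, g\<rangle>\<close> for
  several positive operators \<open>A\<close>. Taking \<open>g = A f\<close> there converts bounds on the form into bounds on
  the norm of \<open>A f\<close>, a job usually done by the square root of \<open>A\<close>.
\<close>

lemma positive_form_Cauchy_Schwarz:
  fixes b :: "('a \<Rightarrow> complex) \<Rightarrow> ('a \<Rightarrow> complex) \<Rightarrow> complex"
  assumes add: "\<And>f g h c. f \<in> l2_space N \<Longrightarrow> g \<in> l2_space N \<Longrightarrow> h \<in> l2_space N \<Longrightarrow>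
      b (\<lambda>x. f x + c * g x) h = b f h + c * b g h"
    and herm: "\<And>f g. f \<in> l2_space N \<Longrightarrow> g \<in> l2_space N \<Longrightarrow> b f g = cnj (b g f)"
    and pos: "\<And>f. f \<in> l2_space N \<Longrightarrow> 0 \<le> Re (b f f)"
    and f: "f \<in> l2_space N" and g: "g \<in> l2_space N"
  shows "(cmod (b f g))\<^sup>2 \<le> Re (b f f) * Re (b g g)"
proof -
  define p where "p = (cmod (b f g))\<^sup>2"
  have key: "0 \<le> Re (b f f) - 2 * t * p + t\<^sup>2 * p * Re (b g g)" for t :: real
  proof -
    define c where "c = - (of_real t * b f g)"
    let ?h = "\<lambda>x. f x + c * g x"
    have h: "?h \<in> l2_space N" using f g by (intro l2_space_add l2_space_scale)
    have real: "Im (b g g) = 0"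
      using arg_cong[OF herm[OF g g], of Im] by simp
    have "b ?h ?h = b f ?h + c * b g ?h" using add f g h by blast
    also have "b f ?h = cnj (b f f + c * b g f)" using herm[OF f h] add[OF f g f] by simp
    also have "b g ?h = cnj (b f g + c * b g g)" using herm[OF g h] add[OF f g g] by simp
    finally have "Re (b ?h ?h) = Re (b f f) + Re (cnj c * cnj (b g f)) + Re (c * cnj (b f g))
        + Re (c * cnj c * cnj (b g g))"
      by (simp add: algebra_simps)
    also have "cnj (b g f) = b f g" using herm[OF f g] by simp
    also have "Re (cnj c * b f g) = - t * p"
      unfolding p_def cmod_power2 by (simp add: c_def algebra_simps power2_eq_square)
    also have "Re (c * cnj (b f g)) = - t * p"
      unfolding p_def cmod_power2 by (simp add: c_def algebra_simps power2_eq_square)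
    also have "c * cnj c = of_real (t\<^sup>2 * p)"
      unfolding complex_norm_square[symmetric]
      by (simp add: c_def p_def norm_mult power_mult_distrib)
    also have "Re (of_real (t\<^sup>2 * p) * cnj (b g g)) = t\<^sup>2 * p * Re (b g g)"
      by simp
    finally show ?thesis using pos[OF h] by (simp add: mult_ac)
  qed
  show ?thesis
  proof (cases "Re (b g g) = 0")
    case True
    have "p = 0"
    proof (rule ccontr)
      assume "p \<noteq> 0"
      then show False
        using key[of "(Re (b f f) + 1) / p"] pos[OF f] True by simp
    qed
    then show ?thesis using True by (simp add: p_def)
  next
    case False
    then have "0 < Re (b g g)" using pos[OF g] by simp
    with key[of "1 / Re (b g g)"] show ?thesis
      by (simp add: p_def field_simps power2_eq_square)
  qed
qed

lemma l2_Cauchy_Schwarz: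
  assumes "f \<in> l2_space N" "g \<in> l2_space N"
  shows "cmod (l2_inner N f g) \<le> l2_norm N f * l2_norm N g"
proof -
  have "(cmod (l2_inner N f g))\<^sup>2 \<le> Re (l2_inner N f f) * Re (l2_inner N g g)"
    using assms
    by (intro positive_form_Cauchy_Schwarz[of N "l2_inner N"])
       (auto simp: l2_inner_linear l2_inner_self intro: l2_inner_commute)
  then have "(cmod (l2_inner N f g))\<^sup>2 \<le> (l2_norm N f * l2_norm N g)\<^sup>2"
    by (simp add: l2_inner_self power_mult_distrib)
  then show ?thesis by (rule power2_le_imp_le) simp
qed

lemma l2_norm_add_square:
  assumes "f \<in> l2_space N" "g \<in> l2_space N"
  shows "(l2_norm N (\<lambda>x. f x + g x))\<^sup>2 =
    (l2_norm N f)\<^sup>2 + 2 * Re (l2_inner N f g) + (l2_norm N g)\<^sup>2"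
proof -
  have "complex_of_real ((l2_norm N (\<lambda>x. f x + g x))\<^sup>2) = 
    l2_inner N f f + l2_inner N f g + cnj (l2_inner N f g) + l2_inner N g g"
    unfolding l2_inner_self[symmetric]
    using assms l2_inner_commute[of N g f] by (simp add: l2_inner_linear)
  from arg_cong[OF this, of Re] show ?thesis by (simp add: l2_inner_self)
qed

lemma l2_norm_triangle:
  assumes "f \<in> l2_space N" "g \<in> l2_space N"
  shows "l2_norm N (\<lambda>x. f x + g x) \<le> l2_norm N f + l2_norm N g"
proof (rule power2_le_imp_le)
  have "Re (l2_inner N f g) \<le> l2_norm N f * l2_norm N g"
    using l2_Cauchy_Schwarz[OF assms] complex_Re_le_cmod order_trans by blast
  then show "(l2_norm N (\<lambda>x. f x + g x))\<^sup>2 \<le> (l2_norm N f + l2_norm N g)\<^sup>2"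
    using l2_norm_add_square[OF assms] by (simp add: power2_sum)
qed simp

lemma l2_norm_diff_commute: "l2_norm N (\<lambda>x. f x - g x) = l2_norm N (\<lambda>x. g x - f x)"
  by (simp add: l2_norm_def norm_minus_commute)

lemma l2_norm_diff_triangle:
  assumes "f \<in> l2_space N" "g \<in> l2_space N" "h \<in> l2_space N"
  shows "l2_norm N (\<lambda>x. f x - h x) \<le> l2_norm N (\<lambda>x. f x - g x) + l2_norm N (\<lambda>x. g x - h x)"
  using l2_norm_triangle[OF l2_space_diff[OF assms(1,2)] l2_space_diff[OF assms(2,3)]] by simp

lemma l2_eqI:
  assumes "f \<in> l2_space N" "g \<in> l2_space N"
    and eq: "\<And>h. h \<in> l2_space N \<Longrightarrow> l2_inner N f h = l2_inner N g h"
  shows "AE x in N. f x = g x"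
proof -
  let ?d = "\<lambda>x. f x - g x"
  have d: "?d \<in> l2_space N" using assms(1,2) by (intro l2_space_diff)
  have "l2_inner N ?d ?d = 0"
    using eq[OF d] assms(1,2) d by (simp add: l2_inner_linear)
  then have "l2_norm N ?d = 0" by (simp add: l2_inner_self)
  then show ?thesis by (simp add: l2_norm_eq_0_iff[OF d])
qed

lemma l2_AE_eq_iff:
  assumes "f \<in> l2_space N" "g \<in> l2_space N"
  shows "(AE x in N. f x = g x) \<longleftrightarrow> l2_norm N (\<lambda>x. f x - g x) = 0"
  using l2_norm_eq_0_iff[OF l2_space_diff[OF assms]] by simp

lemma l2_orthogonal_decomposition:
  assumes e: "e \<in> l2_space N" "l2_norm N e \<noteq> 0" and f: "f \<in> l2_space N"
  obtains f0 c where "f0 \<in> l2_space N" "l2_inner N f0 e = 0" "f = (\<lambda>x. f0 x + c * e x)"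
    "l2_inner N f e = c * of_real ((l2_norm N e)\<^sup>2)"
proof -
  define c where "c = l2_inner N f e / of_real ((l2_norm N e)\<^sup>2)"
  have c: "l2_inner N f e = c * of_real ((l2_norm N e)\<^sup>2)"
    using e(2) by (simp add: c_def)
  show ?thesis
  proof (rule that[of "\<lambda>x. f x - c * e x" c])
    show "l2_inner N (\<lambda>x. f x - c * e x) e = 0"
      using e f c by (simp add: l2_inner_linear l2_inner_self)
  qed (use e f c in \<open>auto intro!: l2_space_diff l2_space_scale\<close>)
qed

lemma integrable_bounded_mult:
  fixes h :: "'a \<Rightarrow> 'c :: {banach, second_countable_topology}"
  assumes h: "integrable N h" and c [measurable]: "c \<in> borel_measurable N"
    and bound: "\<And>x. x \<in> space N \<Longrightarrow> \<bar>c x\<bar> \<le> B"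
  shows "integrable N (\<lambda>x. c x *\<^sub>R h x)"
proof (rule Bochner_Integration.integrable_bound)
  show "integrable N (\<lambda>x. B * norm (h x))" using h by simp
  show "AE x in N. norm (c x *\<^sub>R h x) \<le> norm (B * norm (h x))"
  proof (rule AE_I2)
    fix x assume "x \<in> space N"
    then have "\<bar>c x\<bar> * norm (h x) \<le> \<bar>B\<bar> * norm (h x)"
      using bound[of x] by (intro mult_right_mono) auto
    then show "norm (c x *\<^sub>R h x) \<le> norm (B * norm (h x))" by (simp add: abs_mult)
  qed
qed (use h in measurable)

lemma l2_space_bounded_mult:
  assumes f: "f \<in> l2_space N" and c [measurable]: "c \<in> borel_measurable N"
    and bound: "\<And>x. x \<in> space N \<Longrightarrow> \<bar>c x\<bar> \<le> B"
  shows "(\<lambda>x. complex_of_real (c x) * f x) \<in> l2_space N"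
proof -
  have [measurable]: "f \<in> borel_measurable N" using f by (rule l2_space_measurable)
  have "integrable N (\<lambda>x. (c x)\<^sup>2 *\<^sub>R (cmod (f x))\<^sup>2)"
  proof (rule integrable_bounded_mult[where B = "B\<^sup>2"])
    show "\<bar>(c x)\<^sup>2\<bar> \<le> B\<^sup>2" if "x \<in> space N" for x
      using power_mono[OF bound[OF that], of 2] by simp
  qed (use f in \<open>auto simp: l2_space_def\<close>)
  then show ?thesis by (simp add: l2_space_def norm_mult power_mult_distrib)
qed

lemma l2_space_sum:
  assumes "\<And>i. i \<in> I \<Longrightarrow> f i \<in> l2_space N"
  shows "(\<lambda>x. \<Sum>i\<in>I. f i x) \<in> l2_space N"
  using assms
proof (induction I rule: infinite_finite_induct)
  case (insert i I)
  then show ?case using l2_space_add[of "f i" N "\<lambda>x. \<Sum>i\<in>I. f i x"] by simp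
qed (auto simp: l2_space_zero)

lemma l2_norm_geometric_tail:
  assumes u: "\<And>n. u n \<in> l2_space N"
    and step: "\<And>n. l2_norm N (\<lambda>x. u (Suc n) x - u n x) \<le> C * q ^ n"
    and q: "0 \<le> q" "q < 1"
  shows "l2_norm N (\<lambda>x. u (n + k) x - u n x) \<le> C * q ^ n / (1 - q)"
proof -
  have C: "0 \<le> C" using order_trans[OF l2_norm_nonneg step[of 0]] by simp
  have "l2_norm N (\<lambda>x. u (n + k) x - u n x) \<le> (\<Sum>i<k. C * q ^ (n + i))"
  proof (induction k)
    case 0
    then show ?case by (simp add: l2_norm_def)
  next
    case (Suc k)
    then show ?case
      using l2_norm_diff_triangle[OF u[of "Suc (n + k)"] u[of "n + k"] u[of n]] step[of "n + k"]
      by simp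
  qed
  also have "(\<Sum>i<k. C * q ^ (n + i)) = C * q ^ n * (\<Sum>i<k. q ^ i)"
    by (simp add: power_add sum_distrib_left mult.assoc)
  also have "\<dots> \<le> C * q ^ n * (1 / (1 - q))"
  proof (rule mult_left_mono)
    show "(\<Sum>i<k. q ^ i) \<le> 1 / (1 - q)"
      using q by (simp add: sum_gp_strict divide_right_mono)
  qed (use C q in auto)
  finally show ?thesis by simp
qed

text \<open>
  Completeness of \<open>L\<^sup>2\<close>, for sequences whose steps \<open>d\<^sub>n\<close> decrease geometrically, as they do for the
  iterations of a contraction. Since \<open>\<Sum>\<^sub>n \<parallel>d\<^sub>n\<parallel>\<^sup>2 / q\<^sup>n\<close> is finite, so is \<open>\<Sum>\<^sub>n |d\<^sub>n|\<^sup>2 / q\<^sup>n\<close> almost everywhere.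
  Hence \<open>|d\<^sub>n|\<close> is almost everywhere dominated by a geometric sequence and the sequence converges
  pointwise; Fatou's lemma identifies the pointwise limit as the limit in norm.
\<close>

lemma l2_complete_geometric:
  assumes u: "\<And>n. u n \<in> l2_space N"
    and step: "\<And>n. l2_norm N (\<lambda>x. u (Suc n) x - u n x) \<le> C * q ^ n"
    and q: "0 \<le> q" "q < 1"
  shows "\<exists>v\<in>l2_space N. (\<lambda>n. l2_norm N (\<lambda>x. u n x - v x)) \<longlonglongrightarrow> 0"
proof -
  have [measurable]: "u n \<in> borel_measurable N" for n
    using u by (auto simp: l2_space_def)
  \<comment> \<open>A positive ratio, so that dividing by its powers makes sense also when \<open>q = 0\<close>.\<close>
  define p where "p = max q (1/2)"
  have p: "0 < p" "p < 1" "q \<le> p" using q by (auto simp: p_def)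
  have C: "0 \<le> C" using order_trans[OF l2_norm_nonneg step[of 0]] by simp
  have stepp: "l2_norm N (\<lambda>x. u (Suc n) x - u n x) \<le> C * p ^ n" for n
    using step[of n] power_mono[OF p(3) q(1), of n] C by (meson mult_left_mono order_trans)
  have nn_norm: "(\<integral>\<^sup>+x. ennreal ((cmod (f x))\<^sup>2) \<partial>N) = ennreal ((l2_norm N f)\<^sup>2)"
    if "f \<in> l2_space N" for f
    unfolding l2_norm_square using that
    by (intro nn_integral_eq_integral) (auto simp: l2_space_def)
  have diff: "(\<lambda>x. u m x - u n x) \<in> l2_space N" for m n using u by blast
  have "(\<integral>\<^sup>+x. (\<Sum>n. ennreal ((cmod (u (Suc n) x - u n x))\<^sup>2 / p ^ n)) \<partial>N)
      = (\<Sum>n. \<integral>\<^sup>+x. ennreal ((cmod (u (Suc n) x - u n x))\<^sup>2 / p ^ n) \<partial>N)"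
    by (rule nn_integral_suminf) measurable
  also have "\<dots> \<le> (\<Sum>n. ennreal (C\<^sup>2 * p ^ n))"
  proof (rule suminf_le)
    fix n
    have "(\<integral>\<^sup>+x. ennreal ((cmod (u (Suc n) x - u n x))\<^sup>2 / p ^ n) \<partial>N)
      = (\<integral>\<^sup>+x. ennreal (1 / p ^ n) * ennreal ((cmod (u (Suc n) x - u n x))\<^sup>2) \<partial>N)"
      using p by (intro nn_integral_cong) (simp add: ennreal_mult[symmetric])
    also have "\<dots> = ennreal (1 / p ^ n) * ennreal ((l2_norm N (\<lambda>x. u (Suc n) x - u n x))\<^sup>2)"
      by (subst nn_integral_cmult) (auto simp: nn_norm[OF diff])
    also have "\<dots> = ennreal ((l2_norm N (\<lambda>x. u (Suc n) x - u n x))\<^sup>2 / p ^ n)"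
      using p by (simp add: ennreal_mult[symmetric])
    also have "\<dots> \<le> ennreal (C\<^sup>2 * p ^ n)"
    proof (rule ennreal_leI)
      have "(l2_norm N (\<lambda>x. u (Suc n) x - u n x))\<^sup>2 \<le> (C * p ^ n)\<^sup>2"
        by (intro power_mono stepp) simp
      then show "(l2_norm N (\<lambda>x. u (Suc n) x - u n x))\<^sup>2 / p ^ n \<le> C\<^sup>2 * p ^ n"
        using p by (simp add: divide_le_eq power_mult_distrib power2_eq_square mult_ac)
    qed
    finally show "(\<integral>\<^sup>+x. ennreal ((cmod (u (Suc n) x - u n x))\<^sup>2 / p ^ n) \<partial>N) \<le> ennreal (C\<^sup>2 * p ^ n)" .
  qed auto
  also have "\<dots> < \<infinity>"
    using p by (subst suminf_ennreal2) (auto simp: summable_mult summable_geometric)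
  finally have "AE x in N. (\<Sum>n. ennreal ((cmod (u (Suc n) x - u n x))\<^sup>2 / p ^ n)) \<noteq> \<infinity>"
    by (intro nn_integral_noteq_infinite) (auto simp: less_top)
  then have conv: "AE x in N. convergent (\<lambda>n. u n x)"
  proof (eventually_elim)
    fix x
    assume fin: "(\<Sum>n. ennreal ((cmod (u (Suc n) x - u n x))\<^sup>2 / p ^ n)) \<noteq> \<infinity>"
    define K where "K = enn2real (\<Sum>n. ennreal ((cmod (u (Suc n) x - u n x))\<^sup>2 / p ^ n))"
    have bound: "cmod (u (Suc n) x - u n x) \<le> sqrt K * (sqrt p) ^ n" for n
    proof -
      have "(\<Sum>i\<in>{n}. ennreal ((cmod (u (Suc i) x - u i x))\<^sup>2 / p ^ i)) \<le> ennreal K"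
        unfolding K_def using fin
        by (subst ennreal_enn2real) (auto intro!: sum_le_suminf[OF summableI, of "{n}", simplified] simp: less_top)
      then have "(cmod (u (Suc n) x - u n x))\<^sup>2 / p ^ n \<le> K"
        by (simp add: K_def)
      then have "(cmod (u (Suc n) x - u n x))\<^sup>2 \<le> K * p ^ n" using p by (simp add: divide_le_eq)
      then have "cmod (u (Suc n) x - u n x) \<le> sqrt (K * p ^ n)" by (rule real_le_rsqrt)
      then show ?thesis by (simp add: real_sqrt_mult real_sqrt_power)
    qed
    have "summable (\<lambda>n. sqrt K * (sqrt p) ^ n)"
      using p by (intro summable_mult summable_geometric) auto
    then have "summable (\<lambda>n. u (Suc n) x - u n x)"
      by (rule summable_comparison_test'[where N = 0]) (rule bound)
    then have "convergent (\<lambda>n. u n x - u 0 x)"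
      by (simp add: summable_iff_convergent sum_lessThan_telescope[of "\<lambda>n. u n x"])
    then show "convergent (\<lambda>n. u n x)"
      using convergent_add[of "\<lambda>n. u n x - u 0 x" "\<lambda>_. u 0 x"] by (simp add: convergent_const)
  qed
  define v where "v x = lim (\<lambda>n. u n x)" for x
  have [measurable]: "v \<in> borel_measurable N" unfolding v_def by measurable
  have lim: "AE x in N. (\<lambda>n. u n x) \<longlonglongrightarrow> v x"
    using conv by eventually_elim (simp add: v_def convergent_LIMSEQ_iff)
  define D where "D n = C * p ^ n / (1 - p)" for n
  have D0: "0 \<le> D n" for n using C p by (simp add: D_def)
  have tail: "l2_norm N (\<lambda>x. u (n + k) x - u n x) \<le> D n" for n k
    unfolding D_def using p by (intro l2_norm_geometric_tail u stepp) auto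
  have nn: "(\<integral>\<^sup>+x. ennreal ((cmod (v x - u n x))\<^sup>2) \<partial>N) \<le> ennreal ((D n)\<^sup>2)" for n
  proof -
    have "(\<integral>\<^sup>+x. ennreal ((cmod (v x - u n x))\<^sup>2) \<partial>N)
      = (\<integral>\<^sup>+x. liminf (\<lambda>k. ennreal ((cmod (u (n + k) x - u n x))\<^sup>2)) \<partial>N)"
    proof (rule nn_integral_cong_AE, use lim in eventually_elim)
      fix x assume "(\<lambda>k. u k x) \<longlonglongrightarrow> v x"
      then have "(\<lambda>k. u (n + k) x) \<longlonglongrightarrow> v x"
        using LIMSEQ_ignore_initial_segment[of "\<lambda>k. u k x" "v x" n] by (simp add: add.commute)
      then have "(\<lambda>k. ennreal ((cmod (u (n + k) x - u n x))\<^sup>2)) \<longlonglongrightarrow> ennreal ((cmod (v x - u n x))\<^sup>2)"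
        by (intro tendsto_intros)
      then show "ennreal ((cmod (v x - u n x))\<^sup>2) = liminf (\<lambda>k. ennreal ((cmod (u (n + k) x - u n x))\<^sup>2))"
        by (intro lim_imp_Liminf[symmetric]) auto
    qed
    also have "\<dots> \<le> liminf (\<lambda>k. \<integral>\<^sup>+x. ennreal ((cmod (u (n + k) x - u n x))\<^sup>2) \<partial>N)"
      by (rule nn_integral_liminf) measurable
    also have "\<dots> \<le> liminf (\<lambda>k. ennreal ((D n)\<^sup>2))"
      using tail by (intro Liminf_mono always_eventually)
        (auto simp: nn_norm[OF diff] intro!: ennreal_leI power_mono)
    also have "\<dots> = ennreal ((D n)\<^sup>2)" by (simp add: Liminf_const)
    finally show ?thesis .
  qed
  have vu: "(\<lambda>x. v x - u n x) \<in> l2_space N" for n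
  proof -
    have "integrable N (\<lambda>x. (cmod (v x - u n x))\<^sup>2)"
      using le_less_trans[OF nn[of n]] by (intro integrableI_bounded) auto
    then show ?thesis by (simp add: l2_space_def)
  qed
  have "v \<in> l2_space N" using l2_space_add[OF vu[of 0] u[of 0]] by simp
  moreover have "(\<lambda>n. l2_norm N (\<lambda>x. u n x - v x)) \<longlonglongrightarrow> 0"
  proof (rule tendsto_sandwich[where f = "\<lambda>_. 0" and h = D])
    have "l2_norm N (\<lambda>x. v x - u n x) \<le> D n" for n
    proof (rule power2_le_imp_le)
      show "(l2_norm N (\<lambda>x. v x - u n x))\<^sup>2 \<le> (D n)\<^sup>2"
        using nn[of n] by (simp add: nn_norm[OF vu])
    qed (rule D0)
    then show "\<forall>\<^sub>F n in sequentially. l2_norm N (\<lambda>x. u n x - v x) \<le> D n"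
      by (simp add: l2_norm_diff_commute[of _ _ v])
    have "(\<lambda>n. C * p ^ n / (1 - p)) \<longlonglongrightarrow> C * 0 / (1 - p)"
      using p by (intro tendsto_intros LIMSEQ_realpow_zero) auto
    then show "D \<longlonglongrightarrow> 0" by (simp add: D_def[abs_def])
  qed auto
  ultimately show ?thesis by blast
qed

section \<open>Positive operators with zero as an isolated simple eigenvalue\<close>

text \<open>
  Only symmetry and bounds on the quadratic form are assumed: they already force \<open>T\<close> to be linear up
  to null sets and bounded in norm by \<open>K\<close>. For a Laplacian the bounds on the form are what the
  Dirichlet form gives directly.
\<close>

locale l2_positive_operator =
  fixes N :: "'a measure" and T :: "('a \<Rightarrow> complex) \<Rightarrow> 'a \<Rightarrow> complex" and K :: real
  assumes T_space: "f \<in> l2_space N \<Longrightarrow> T f \<in> l2_space N"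
    and symmetric: "f \<in> l2_space N \<Longrightarrow> g \<in> l2_space N \<Longrightarrow>
      l2_inner N (T f) g = l2_inner N f (T g)"
    and nonneg: "f \<in> l2_space N \<Longrightarrow> 0 \<le> Re (l2_inner N (T f) f)"
    and upper: "f \<in> l2_space N \<Longrightarrow> Re (l2_inner N (T f) f) \<le> K * (l2_norm N f)\<^sup>2"
    and K_pos: "0 < K"
begin

text \<open>Symmetry moves \<open>T\<close> to the other side of the inner product, where linearity is plain.\<close>

lemma T_add_scale:
  assumes "f \<in> l2_space N" "g \<in> l2_space N"
  shows "AE x in N. T (\<lambda>x. f x + c * g x) x = T f x + c * T g x"
  using assms
  by (intro l2_eqI) (simp_all add: symmetric T_space l2_inner_linear)

lemma T_diff:
  assumes "f \<in> l2_space N" "g \<in> l2_space N"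
  shows "AE x in N. T (\<lambda>x. f x - g x) x = T f x - T g x"
  using T_add_scale[OF assms, of "-1"] by simp

lemma T_scale:
  assumes "f \<in> l2_space N"
  shows "AE x in N. T (\<lambda>x. c * f x) x = c * T f x"
  using assms by (intro l2_eqI) (simp_all add: symmetric T_space l2_inner_linear)

lemma T_add:
  assumes "f \<in> l2_space N" "g \<in> l2_space N"
  shows "AE x in N. T (\<lambda>x. f x + g x) x = T f x + T g x"
  using T_add_scale[OF assms, of 1] by simp

lemma T_cong:
  assumes "f \<in> l2_space N" "g \<in> l2_space N" "AE x in N. f x = g x"
  shows "AE x in N. T f x = T g x"
proof (rule l2_eqI)
  fix h assume h: "h \<in> l2_space N"
  then have "l2_inner N f (T h) = l2_inner N g (T h)"
    using assms by (intro l2_inner_cong_AE) (auto simp: T_space l2_space_measurable)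
  then show "l2_inner N (T f) h = l2_inner N (T g) h"
    using assms h by (simp add: symmetric)
qed (use assms in \<open>simp_all add: T_space\<close>)

text \<open>
  Cauchy--Schwarz for the form \<open>\<langle>T f, g\<rangle>\<close> at \<open>g = T f\<close>.
\<close>

lemma norm_T_power4_le:
  assumes "f \<in> l2_space N"
  shows "((l2_norm N (T f))\<^sup>2)\<^sup>2 \<le> Re (l2_inner N (T f) f) * Re (l2_inner N (T (T f)) (T f))"
proof -
  have "(cmod (l2_inner N (T f) (T f)))\<^sup>2
      \<le> Re (l2_inner N (T f) f) * Re (l2_inner N (T (T f)) (T f))"
  proof (rule positive_form_Cauchy_Schwarz[of N "\<lambda>f g. l2_inner N (T f) g"])
    show "l2_inner N (T f) g = cnj (l2_inner N (T g) f)"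
      if "f \<in> l2_space N" "g \<in> l2_space N" for f g
      using that by (simp add: symmetric l2_inner_commute[of N f])
  qed (use assms nonneg in \<open>simp_all add: symmetric T_space l2_inner_linear\<close>)
  then show ?thesis by (simp add: l2_inner_self norm_power)
qed

lemma norm_T_square_le:
  assumes "f \<in> l2_space N"
  shows "(l2_norm N (T f))\<^sup>2 \<le> K * Re (l2_inner N (T f) f)"
proof (cases "l2_norm N (T f) = 0")
  case True
  then show ?thesis using nonneg[OF assms] K_pos by simp
next
  case False
  have "((l2_norm N (T f))\<^sup>2)\<^sup>2 \<le> Re (l2_inner N (T f) f) * (K * (l2_norm N (T f))\<^sup>2)"
    using norm_T_power4_le[OF assms] nonneg[OF assms] upper[OF T_space[OF assms]]
    by (meson mult_left_mono order_trans)
  then have "(l2_norm N (T f))\<^sup>2 * (l2_norm N (T f))\<^sup>2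
      \<le> K * Re (l2_inner N (T f) f) * (l2_norm N (T f))\<^sup>2"
    by (simp add: power2_eq_square mult_ac)
  then show ?thesis by (rule mult_right_le_imp_le) (use False in simp)
qed

lemma norm_T_le:
  assumes "f \<in> l2_space N"
  shows "l2_norm N (T f) \<le> K * l2_norm N f"
proof (rule power2_le_imp_le)
  have "(l2_norm N (T f))\<^sup>2 \<le> K * (K * (l2_norm N f)\<^sup>2)"
    using norm_T_square_le[OF assms] mult_left_mono[OF upper[OF assms], of K] K_pos by linarith
  then show "(l2_norm N (T f))\<^sup>2 \<le> (K * l2_norm N f)\<^sup>2"
    by (simp add: power_mult_distrib power2_eq_square mult_ac)
qed (use K_pos in simp)

lemma norm_T_diff_le:
  assumes "f \<in> l2_space N" "g \<in> l2_space N"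
  shows "l2_norm N (\<lambda>x. T f x - T g x) \<le> K * l2_norm N (\<lambda>x. f x - g x)"
proof -
  have "l2_norm N (\<lambda>x. T f x - T g x) = l2_norm N (T (\<lambda>x. f x - g x))"
    using T_diff[OF assms] assms
    by (intro l2_norm_cong_AE) (auto intro!: l2_space_measurable l2_space_diff T_space)
  then show ?thesis using norm_T_le[OF l2_space_diff[OF assms]] by simp
qed

text \<open>
  Subtracting \<open>T/K\<close> from the identity leaves a positive operator, because \<open>T \<le> K\<close>. Iterating it
  serves two purposes: it solves equations on the orthogonal complement of the kernel, and it
  approximates the projection onto the kernel.
\<close>

definition relax :: "('a \<Rightarrow> complex) \<Rightarrow> 'a \<Rightarrow> complex" where
  "relax f = (\<lambda>x. f x - of_real (1 / K) * T f x)"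

lemma relax_space: "f \<in> l2_space N \<Longrightarrow> relax f \<in> l2_space N"
  unfolding relax_def by (intro l2_space_diff l2_space_scale T_space)

text \<open>
  A lower bound \<open>a\<close> for the form of \<open>T\<close> is an upper bound \<open>1 - a/K\<close> for the form of \<open>relax\<close>. By
  Cauchy--Schwarz for the latter form it suffices to have this bound at the two vectors \<open>f\<close> and
  \<open>relax f\<close> to get a bound for the norm. The maximum with \<open>0\<close> covers \<open>a > K\<close>, which is possible
  only if both vectors vanish almost everywhere.
\<close>

lemma norm_relax_le:
  assumes f: "f \<in> l2_space N"
    and low: "a * (l2_norm N f)\<^sup>2 \<le> Re (l2_inner N (T f) f)"
      "a * (l2_norm N (relax f))\<^sup>2 \<le> Re (l2_inner N (T (relax f)) (relax f))"
  shows "l2_norm N (relax f) \<le> max 0 (1 - a / K) * l2_norm N f"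
proof (cases "l2_norm N (relax f) = 0")
  case True
  then show ?thesis by (simp add: mult_nonneg_nonneg)
next
  case False
  define q where "q = max 0 (1 - a / K)"
  have relax_inner: "l2_inner N (relax f) g = l2_inner N f g - of_real (1 / K) * l2_inner N (T f) g"
    if "f \<in> l2_space N" "g \<in> l2_space N" for f g
    using l2_inner_diff_left[OF that(1) l2_space_scale[OF T_space[OF that(1)]] that(2)]
    by (simp only: relax_def l2_inner_scale_left)
  have form: "Re (l2_inner N (relax f) f) = (l2_norm N f)\<^sup>2 - Re (l2_inner N (T f) f) / K"
    if "f \<in> l2_space N" for f
    using that relax_inner[OF that that] by (simp add: l2_inner_self del: of_real_power)
  have form_le: "Re (l2_inner N (relax f) f) \<le> q * (l2_norm N f)\<^sup>2"
    if "f \<in> l2_space N" "a * (l2_norm N f)\<^sup>2 \<le> Re (l2_inner N (T f) f)" for f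
  proof -
    have "a * (l2_norm N f)\<^sup>2 / K \<le> Re (l2_inner N (T f) f) / K"
      using that(2) K_pos by (simp add: divide_right_mono)
    then have "Re (l2_inner N (relax f) f) \<le> (1 - a / K) * (l2_norm N f)\<^sup>2"
      by (simp add: form[OF that(1)] algebra_simps)
    also have "\<dots> \<le> q * (l2_norm N f)\<^sup>2" by (intro mult_right_mono) (auto simp: q_def)
    finally show ?thesis .
  qed
  have form_nonneg: "0 \<le> Re (l2_inner N (relax f) f)" if "f \<in> l2_space N" for f
    using upper[OF that] K_pos by (simp add: form[OF that] divide_le_eq mult.commute)
  have "(cmod (l2_inner N (relax f) (relax f)))\<^sup>2
      \<le> Re (l2_inner N (relax f) f) * Re (l2_inner N (relax (relax f)) (relax f))"
  proof (rule positive_form_Cauchy_Schwarz[of N "\<lambda>f g. l2_inner N (relax f) g"])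
    show "l2_inner N (relax f) g = cnj (l2_inner N (relax g) f)"
      if "f \<in> l2_space N" "g \<in> l2_space N" for f g
      using that by (simp add: relax_inner symmetric l2_inner_commute[of N f])
    show "l2_inner N (relax (\<lambda>x. f x + c * g x)) h = l2_inner N (relax f) h + c * l2_inner N (relax g) h"
      if "f \<in> l2_space N" "g \<in> l2_space N" "h \<in> l2_space N" for f g h c
      using that by (simp add: relax_inner symmetric l2_inner_linear T_space algebra_simps)
  qed (use f form_nonneg in \<open>auto simp: relax_space\<close>)
  also have "\<dots> \<le> (q * (l2_norm N f)\<^sup>2) * (q * (l2_norm N (relax f))\<^sup>2)"
    using form_le[OF f low(1)] form_le[OF relax_space[OF f] low(2)]
      form_nonneg[OF f] form_nonneg[OF relax_space[OF f]]
    by (intro mult_mono) (auto simp: q_def)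
  finally have "(l2_norm N (relax f))\<^sup>2 * (l2_norm N (relax f))\<^sup>2
      \<le> (q * l2_norm N f)\<^sup>2 * (l2_norm N (relax f))\<^sup>2"
    by (simp add: l2_inner_self norm_mult power2_eq_square mult_ac)
  then have "(l2_norm N (relax f))\<^sup>2 \<le> (q * l2_norm N f)\<^sup>2"
    by (rule mult_right_le_imp_le) (use False in simp)
  then show ?thesis unfolding q_def[symmetric]
    by (rule power2_le_imp_le) (simp add: q_def)
qed

lemma bounded_below_of_not_in_spectrum:
  assumes "z \<notin> l2_spectrum N T"
  obtains \<delta> where "0 < \<delta>"
    "\<And>f. f \<in> l2_space N \<Longrightarrow> \<delta> * l2_norm N f \<le> l2_norm N (\<lambda>x. z * f x - T f x)"
proof -
  obtain R where R: "l2_bounded_operator N R"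
    and inv: "\<And>f. f \<in> l2_space N \<Longrightarrow> AE x in N. R (\<lambda>y. z * f y - T f y) x = f x"
    using assms unfolding l2_spectrum_def by blast
  obtain C where C: "\<And>f. f \<in> l2_space N \<Longrightarrow> l2_norm N (R f) \<le> C * l2_norm N f"
    and R_space: "\<And>f. f \<in> l2_space N \<Longrightarrow> R f \<in> l2_space N"
    using R unfolding l2_bounded_operator_def by blast
  show ?thesis
  proof (rule that[of "1 / max C 1"])
    fix f assume f: "f \<in> l2_space N"
    let ?g = "\<lambda>x. z * f x - T f x"
    have g: "?g \<in> l2_space N" using f by (intro l2_space_diff l2_space_scale T_space)
    have "l2_norm N f = l2_norm N (R ?g)"
      using inv[OF f] f g by (intro l2_norm_cong_AE) (auto intro!: l2_space_measurable R_space)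
    also have "\<dots> \<le> max C 1 * l2_norm N ?g"
      using C[OF g] by (rule order_trans) (intro mult_right_mono, auto)
    finally show "1 / max C 1 * l2_norm N f \<le> l2_norm N ?g"
      by (simp add: divide_le_eq mult.commute max_def split: if_splits)
  qed simp
qed

text \<open>
  An inverse can be defined by choosing solutions: the lower bound makes solutions unique up to null
  sets, so the chosen map is automatically linear and well defined on classes, and it is bounded.
\<close>

lemma not_in_spectrumI:
  assumes below: "0 < \<delta>" "\<And>f. f \<in> l2_space N \<Longrightarrow> \<delta> * l2_norm N f \<le> l2_norm N (\<lambda>x. z * f x - T f x)"
    and onto: "\<And>f. f \<in> l2_space N \<Longrightarrow> \<exists>u\<in>l2_space N. AE x in N. z * u x - T u x = f x"
  shows "z \<notin> l2_spectrum N T"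
proof -
  have "\<exists>u. u \<in> l2_space N \<and> (AE x in N. z * u x - T u x = f x)" if "f \<in> l2_space N" for f
    using onto[OF that] by blast
  then obtain R where R: "\<And>f. f \<in> l2_space N \<Longrightarrow> R f \<in> l2_space N"
    and RI: "\<And>f. f \<in> l2_space N \<Longrightarrow> AE x in N. z * R f x - T (R f) x = f x"
    by metis
  have unique: "AE x in N. u x = v x"
    if u: "u \<in> l2_space N" and v: "v \<in> l2_space N"
      and eq: "AE x in N. z * u x - T u x = f x" "AE x in N. z * v x - T v x = f x" for u v f
  proof -
    let ?d = "\<lambda>x. u x - v x"
    have d: "?d \<in> l2_space N" using u v by (intro l2_space_diff)
    have "AE x in N. z * ?d x - T ?d x = 0"
      using eq T_diff[OF u v] by eventually_elim (simp add: algebra_simps)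
    then have "l2_norm N (\<lambda>x. z * ?d x - T ?d x) = 0"
      using d by (subst l2_norm_eq_0_iff) (auto intro!: l2_space_diff l2_space_scale T_space)
    with below(2)[OF d] have "\<delta> * l2_norm N ?d \<le> 0" by simp
    then have "l2_norm N ?d = 0" using below(1) l2_norm_nonneg[of N ?d]
      by (simp add: mult_le_0_iff)
    then show ?thesis using l2_AE_eq_iff[OF u v] by simp
  qed
  have "l2_bounded_operator N R"
    unfolding l2_bounded_operator_def
  proof (intro conjI ballI allI impI)
    fix f assume f: "f \<in> l2_space N"
    then show "R f \<in> l2_space N" by (rule R)
    show "AE x in N. R (\<lambda>y. c * f y) x = c * R f x" for c
    proof (rule unique)
      show "AE x in N. z * (c * R f x) - T (\<lambda>x. c * R f x) x = c * f x"
        using RI[OF f] T_scale[OF R[OF f], of c]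
        by eventually_elim (simp add: algebra_simps)
    qed (use f in \<open>auto intro!: R RI l2_space_scale\<close>)
    fix g assume g: "g \<in> l2_space N"
    show "AE x in N. R (\<lambda>y. f y + g y) x = R f x + R g x"
    proof (rule unique)
      show "AE x in N. z * (R f x + R g x) - T (\<lambda>x. R f x + R g x) x = f x + g x"
        using RI[OF f] RI[OF g] T_add[OF R[OF f] R[OF g]]
        by eventually_elim (simp add: algebra_simps)
    qed (use f g in \<open>auto intro!: R RI l2_space_add\<close>)
    show "AE x in N. R f x = R g x" if "AE x in N. f x = g x"
    proof (rule unique)
      show "AE x in N. z * R g x - T (R g) x = f x"
        using RI[OF g] that by eventually_elim simp
    qed (use f g in \<open>auto intro!: R RI\<close>)
  next
    have "l2_norm N (R f) \<le> 1 / \<delta> * l2_norm N f" if f: "f \<in> l2_space N" for f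
    proof -
      have "l2_norm N (\<lambda>x. z * R f x - T (R f) x) = l2_norm N f"
        using RI[OF f] f
        by (intro l2_norm_cong_AE) (auto intro!: l2_space_measurable l2_space_diff l2_space_scale T_space R)
      then show ?thesis using below(2)[OF R[OF f]] below(1) by (simp add: field_simps)
    qed
    then show "\<exists>K. \<forall>f\<in>l2_space N. l2_norm N (R f) \<le> K * l2_norm N f" by blast
  qed
  moreover have "AE x in N. R (\<lambda>y. z * f y - T f y) x = f x" if f: "f \<in> l2_space N" for f
    by (rule unique[where f = "\<lambda>y. z * f y - T f y"])
       (use f in \<open>auto intro!: R RI l2_space_diff l2_space_scale T_space\<close>)
  ultimately show ?thesis using RI unfolding l2_spectrum_def by blast
qed

subsection \<open>From a spectral gap to isolation\<close>

text \<open>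
  The solution is the fixed point of \<open>u \<mapsto> u - (T u - z u + f)/K\<close>. This map preserves the orthogonal
  complement of the kernel vector \<open>e\<close>, where it contracts by \<open>1 - \<kappa>/K + |z|/K < 1\<close>.
\<close>

lemma gap_solve:
  assumes e: "e \<in> l2_space N" "AE x in N. T e x = 0"
    and gap: "\<And>f. f \<in> l2_space N \<Longrightarrow> l2_inner N f e = 0 \<Longrightarrow>
      \<kappa> * (l2_norm N f)\<^sup>2 \<le> Re (l2_inner N (T f) f)"
    and z: "cmod z < \<kappa>"
    and f: "f \<in> l2_space N" "l2_inner N f e = 0"
  shows "\<exists>u\<in>l2_space N. AE x in N. z * u x - T u x = f x"
proof -
  define c :: complex where "c = of_real (1 / K)"
  have c: "cmod c = 1 / K" "c * of_real K = 1" "c \<noteq> 0" using K_pos by (auto simp: c_def norm_divide)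
  define \<Phi> where "\<Phi> u = (\<lambda>x. relax u x + (c * z * u x - c * f x))" for u
  define u where "u n = (\<Phi> ^^ n) (\<lambda>_. 0)" for n
  have u_Suc: "u (Suc n) = \<Phi> (u n)" for n by (simp add: u_def)
  have \<Phi>_space: "\<Phi> v \<in> l2_space N" if "v \<in> l2_space N" for v
    unfolding \<Phi>_def using that f
    by (intro l2_space_add l2_space_diff l2_space_scale relax_space)
  have u: "u n \<in> l2_space N" for n
    by (induction n) (auto simp: u_Suc \<Phi>_space, simp add: u_def l2_space_zero)
  have Te: "l2_inner N (T v) e = 0" if "v \<in> l2_space N" for v
  proof -
    have "l2_inner N (T v) e = l2_inner N v (T e)" using that e by (simp add: symmetric)
    also have "\<dots> = l2_inner N v (\<lambda>_. 0)"
      using that e by (intro l2_inner_cong_AE) (auto intro!: l2_space_measurable T_space)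
    finally show ?thesis by (simp add: l2_inner_def)
  qed
  have relax_perp: "l2_inner N (relax v) e = l2_inner N v e" if "v \<in> l2_space N" for v
    using that e by (simp only: relax_def l2_inner_linear T_space Te mult_zero_right diff_zero)
  have perp: "l2_inner N (u n) e = 0" for n
  proof (induction n)
    case 0
    then show ?case by (simp add: u_def l2_inner_def)
  next
    case (Suc n)
    have "l2_inner N (\<Phi> (u n)) e = 0"
      using u[of n] e f Suc relax_perp[OF u[of n]] unfolding \<Phi>_def
      by (simp add: l2_inner_linear relax_space mult.assoc)
    then show ?case by (simp add: u_Suc)
  qed
  define q where "q = max 0 (1 - \<kappa> / K) + cmod z / K"
  define p where "p = (if \<kappa> \<le> K then q else 0)"
  have d: "(\<lambda>x. u (Suc n) x - u n x) \<in> l2_space N" for n using u by (intro l2_space_diff)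
  have d_perp: "l2_inner N (\<lambda>x. u (Suc n) x - u n x) e = 0" for n
    using u e perp by (simp add: l2_inner_linear)
  have contract: "l2_norm N (\<lambda>x. u (Suc (Suc n)) x - u (Suc n) x)
      \<le> p * l2_norm N (\<lambda>x. u (Suc n) x - u n x)" for n
  proof -
    let ?d = "\<lambda>x. u (Suc n) x - u n x"
    have "AE x in N. u (Suc (Suc n)) x - u (Suc n) x = relax ?d x + c * z * ?d x"
      using T_diff[OF u[of "Suc n"] u[of n]]
    proof eventually_elim
      case (elim x)
      have "u (Suc (Suc n)) x - u (Suc n) x = \<Phi> (u (Suc n)) x - \<Phi> (u n) x"
        by (simp add: u_Suc)
      also have "\<dots> = relax ?d x + c * z * ?d x"
        unfolding \<Phi>_def relax_def c_def[symmetric] elim by (simp add: algebra_simps)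
      finally show ?case .
    qed
    then have "l2_norm N (\<lambda>x. u (Suc (Suc n)) x - u (Suc n) x)
        = l2_norm N (\<lambda>x. relax ?d x + c * z * ?d x)"
      by (rule l2_norm_cong_AE)
         (rule l2_space_measurable[OF d]
           l2_space_measurable[OF l2_space_add[OF relax_space[OF d] l2_space_scale[OF d]]])+
    also have "\<dots> \<le> l2_norm N (relax ?d) + l2_norm N (\<lambda>x. c * z * ?d x)"
      by (intro l2_norm_triangle relax_space d l2_space_scale)
    also have "l2_norm N (\<lambda>x. c * z * ?d x) = cmod z / K * l2_norm N ?d"
      by (simp add: l2_norm_scale norm_mult c)
    also have "l2_norm N (relax ?d) \<le> max 0 (1 - \<kappa> / K) * l2_norm N ?d"
      using d_perp[of n] relax_perp[OF d[of n]] d[of n]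
      by (intro norm_relax_le gap relax_space) auto
    finally have q: "l2_norm N (\<lambda>x. u (Suc (Suc n)) x - u (Suc n) x) \<le> q * l2_norm N ?d"
      by (simp add: q_def algebra_simps)
    show ?thesis
    proof (cases "\<kappa> \<le> K")
      case True
      then show ?thesis using q by (simp add: p_def)
    next
      case False
      \<comment> \<open>A gap larger than the upper bound of the form leaves only null vectors orthogonal to \<open>e\<close>,
        so that the ratio may be taken to be \<open>0\<close>.\<close>
      have "\<kappa> * (l2_norm N ?d)\<^sup>2 \<le> K * (l2_norm N ?d)\<^sup>2"
        using gap[OF d d_perp, of n] upper[OF d, of n] by linarith
      then have "l2_norm N ?d = 0"
        using False by (metis mult_right_le_imp_le not_less zero_less_power2 not_le)
      then show ?thesis using q by (simp add: p_def)
    qed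
  qed
  have p: "0 \<le> p" "p < 1"
    using z K_pos norm_ge_zero[of z]
    by (auto simp: p_def q_def max_def field_simps not_le simp del: norm_ge_zero)
  have step: "l2_norm N (\<lambda>x. u (Suc n) x - u n x) \<le> l2_norm N (\<lambda>x. u 1 x - u 0 x) * p ^ n" for n
  proof (induction n)
    case (Suc n)
    show ?case using contract[of n] mult_left_mono[OF Suc p(1)] by (simp add: mult_ac)
  qed simp
  obtain v where v: "v \<in> l2_space N" and lim: "(\<lambda>n. l2_norm N (\<lambda>x. u n x - v x)) \<longlonglongrightarrow> 0"
    using l2_complete_geometric[OF u step p] by blast
  let ?r = "\<lambda>w x. z * w x - T w x - f x"
  have r: "?r w \<in> l2_space N" if "w \<in> l2_space N" for w
    using that f by (intro l2_space_diff l2_space_scale T_space)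
  have r_u: "l2_norm N (?r (u n)) = K * l2_norm N (\<lambda>x. u (Suc n) x - u n x)" for n
  proof -
    have "u (Suc n) x - u n x = c * ?r (u n) x" for x
      by (simp only: u_Suc \<Phi>_def relax_def c_def[symmetric]) (simp add: algebra_simps)
    then show ?thesis using K_pos by (simp add: l2_norm_scale c)
  qed
  have "l2_norm N (?r v) \<le> (cmod z + K) * l2_norm N (\<lambda>x. u n x - v x)
      + K * (l2_norm N (\<lambda>x. u 1 x - u 0 x) * p ^ n)" for n
  proof -
    have "l2_norm N (?r v) = l2_norm N (\<lambda>x. (?r v x - ?r (u n) x) + ?r (u n) x)"
      by (simp only: diff_add_cancel)
    also have "\<dots> \<le> l2_norm N (\<lambda>x. ?r v x - ?r (u n) x) + l2_norm N (?r (u n))"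
      by (rule l2_norm_triangle[OF l2_space_diff[OF r[OF v] r[OF u]] r[OF u]])
    also have "(\<lambda>x. ?r v x - ?r (u n) x) = (\<lambda>x. z * (v x - u n x) + (T (u n) x - T v x))"
      by (simp add: algebra_simps)
    also have "l2_norm N \<dots> \<le> l2_norm N (\<lambda>x. z * (v x - u n x)) + l2_norm N (\<lambda>x. T (u n) x - T v x)"
      using u v by (intro l2_norm_triangle l2_space_diff l2_space_scale T_space)
    also have "l2_norm N (\<lambda>x. T (u n) x - T v x) \<le> K * l2_norm N (\<lambda>x. u n x - v x)"
      using u v by (intro norm_T_diff_le)
    also have "l2_norm N (?r (u n)) \<le> K * (l2_norm N (\<lambda>x. u 1 x - u 0 x) * p ^ n)"
      unfolding r_u using step K_pos by (intro mult_left_mono) auto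
    finally show ?thesis
      unfolding l2_norm_scale by (simp add: l2_norm_diff_commute[of N v] algebra_simps)
  qed
  moreover have "(\<lambda>n. (cmod z + K) * l2_norm N (\<lambda>x. u n x - v x)
      + K * (l2_norm N (\<lambda>x. u 1 x - u 0 x) * p ^ n))
      \<longlonglongrightarrow> (cmod z + K) * 0 + K * (l2_norm N (\<lambda>x. u 1 x - u 0 x) * 0)"
    using p by (intro tendsto_intros lim LIMSEQ_realpow_zero)
  ultimately have "l2_norm N (?r v) \<le> 0"
    by (intro LIMSEQ_le_const[where X = "\<lambda>n. (cmod z + K) * l2_norm N (\<lambda>x. u n x - v x)
      + K * (l2_norm N (\<lambda>x. u 1 x - u 0 x) * p ^ n)"]) auto
  then have "l2_norm N (?r v) = 0" by (simp add: antisym)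
  then have "AE x in N. ?r v x = 0" using l2_norm_eq_0_iff[OF r[OF v]] by simp
  then show ?thesis using v by (intro bexI[of _ v]) auto
qed

lemma zero_in_spectrum:
  assumes e: "e \<in> l2_space N" "AE x in N. T e x = 0" "l2_norm N e \<noteq> 0"
  shows "0 \<in> l2_spectrum N T"
proof (rule ccontr)
  assume "0 \<notin> l2_spectrum N T"
  then obtain \<delta> where \<delta>: "0 < \<delta>"
    "\<And>f. f \<in> l2_space N \<Longrightarrow> \<delta> * l2_norm N f \<le> l2_norm N (\<lambda>x. 0 * f x - T f x)"
    using bounded_below_of_not_in_spectrum by blast
  have "(\<lambda>x. 0 * e x - T e x) \<in> l2_space N"
    using e by (intro l2_space_diff l2_space_scale T_space)
  then have "l2_norm N (\<lambda>x. 0 * e x - T e x) = 0"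
    by (subst l2_norm_eq_0_iff) (use e in auto)
  then have "\<delta> * l2_norm N e \<le> 0" using \<delta>(2)[OF e(1)] by simp
  then show False using \<delta>(1) e(3) l2_norm_nonneg[of N e] by (simp add: mult_le_0_iff)
qed

text \<open>
  On multiples of \<open>e\<close> the operator \<open>z - T\<close> is multiplication by \<open>z\<close>, and on vectors orthogonal to \<open>e\<close>
  its form is at least \<open>\<kappa> - |z|\<close> in absolute value. Testing \<open>z f - T f\<close> against \<open>e\<close> and against the
  orthogonal part of \<open>f\<close> bounds both components of \<open>f\<close>.
\<close>

lemma gap_resolvent:
  assumes e: "e \<in> l2_space N" "AE x in N. T e x = 0" "l2_norm N e \<noteq> 0"
    and gap: "\<And>f. f \<in> l2_space N \<Longrightarrow> l2_inner N f e = 0 \<Longrightarrow>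
      \<kappa> * (l2_norm N f)\<^sup>2 \<le> Re (l2_inner N (T f) f)"
    and z: "z \<noteq> 0" "cmod z < \<kappa>"
  shows "z \<notin> l2_spectrum N T"
proof (rule not_in_spectrumI)
  let ?m = "1 / (\<kappa> - cmod z) + 1 / cmod z"
  have m: "0 < ?m" using z by (intro add_pos_pos) auto
  then show "0 < 1 / ?m" by simp
  have Te: "l2_inner N (T v) e = 0" "l2_inner N (T e) v = 0" if "v \<in> l2_space N" for v
  proof -
    have "l2_inner N (T e) v = l2_inner N (\<lambda>_. 0) v"
      using that e by (intro l2_inner_cong_AE) (auto intro!: l2_space_measurable T_space)
    then show 1: "l2_inner N (T e) v = 0" by (simp add: l2_inner_def)
    have "l2_inner N (T v) e = l2_inner N v (T e)" using that e by (simp add: symmetric)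
    then show "l2_inner N (T v) e = 0" using 1 l2_inner_commute[of N v "T e"] by simp
  qed
  fix f assume f: "f \<in> l2_space N"
  then obtain f0 c where f0: "f0 \<in> l2_space N" "l2_inner N f0 e = 0"
    and f_eq: "f = (\<lambda>x. f0 x + c * e x)"
    and ce: "l2_inner N f e = c * of_real ((l2_norm N e)\<^sup>2)"
    using l2_orthogonal_decomposition[OF e(1,3)] by blast
  show "\<exists>u\<in>l2_space N. AE x in N. z * u x - T u x = f x"
  proof -
    obtain u where u: "u \<in> l2_space N" "AE x in N. z * u x - T u x = f0 x"
      using gap_solve[OF e(1,2) gap z(2) f0] by blast
    have "AE x in N. z * (u x + c / z * e x) - T (\<lambda>x. u x + c / z * e x) x = f x"
      using T_add_scale[OF u(1) e(1), of "c / z"] u(2) e(2)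
      by eventually_elim (use z f_eq in \<open>simp add: algebra_simps\<close>)
    moreover have "(\<lambda>x. u x + c / z * e x) \<in> l2_space N"
      using u e by (intro l2_space_add l2_space_scale)
    ultimately show ?thesis by (intro bexI[of _ "\<lambda>x. u x + c / z * e x"])
  qed
  let ?g = "\<lambda>x. z * f x - T f x"
  have g: "?g \<in> l2_space N" using f by (intro l2_space_diff l2_space_scale T_space)
  have "l2_inner N ?g e = z * l2_inner N f e"
    using f e Te by (simp add: l2_inner_linear T_space)
  then have "cmod (z * (c * of_real ((l2_norm N e)\<^sup>2))) \<le> l2_norm N ?g * l2_norm N e"
    using l2_Cauchy_Schwarz[OF g e(1)] by (simp add: ce)
  then have "(cmod z * cmod c * l2_norm N e) * l2_norm N e \<le> l2_norm N ?g * l2_norm N e"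
    by (simp add: norm_mult norm_power power2_eq_square mult_ac)
  then have "cmod z * cmod c * l2_norm N e \<le> l2_norm N ?g"
    by (rule mult_right_le_imp_le) (use e(3) l2_norm_nonneg[of N e] in linarith)
  then have c_le: "cmod c * l2_norm N e \<le> 1 / cmod z * l2_norm N ?g"
    using z by (simp add: field_simps)
  have "(\<kappa> - cmod z) * l2_norm N f0 \<le> l2_norm N ?g"
  proof (cases "l2_norm N f0 = 0")
    case False
    have e0: "l2_inner N e f0 = 0" using f0(2) l2_inner_commute[of N e f0] by simp
    have "l2_inner N (T f) f0 = l2_inner N (T f0) f0"
    proof -
      have "l2_inner N (T f) f0 = l2_inner N f (T f0)" using f f0 by (simp add: symmetric)
      also have "\<dots> = l2_inner N f0 (T f0) + c * l2_inner N e (T f0)"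
        unfolding f_eq using f0 e by (simp add: l2_inner_linear T_space)
      also have "l2_inner N e (T f0) = 0" using Te(2)[OF f0(1)] symmetric[OF e(1) f0(1)] by simp
      finally show ?thesis using f0 by (simp add: symmetric)
    qed
    moreover have "l2_inner N f f0 = l2_inner N f0 f0"
      unfolding f_eq using f0 e e0 by (simp add: l2_inner_linear)
    ultimately have "l2_inner N ?g f0 = z * of_real ((l2_norm N f0)\<^sup>2) - l2_inner N (T f0) f0"
      using f f0 by (simp add: l2_inner_linear T_space l2_inner_self)
    then have "Re (l2_inner N (T f0) f0) = Re (z * of_real ((l2_norm N f0)\<^sup>2) - l2_inner N ?g f0)"
      by simp
    also have "\<dots> \<le> cmod (z * of_real ((l2_norm N f0)\<^sup>2) - l2_inner N ?g f0)"
      by (rule complex_Re_le_cmod)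
    also have "\<dots> \<le> cmod z * (l2_norm N f0)\<^sup>2 + l2_norm N ?g * l2_norm N f0"
      using norm_triangle_ineq4[of "z * of_real ((l2_norm N f0)\<^sup>2)" "l2_inner N ?g f0"]
        l2_Cauchy_Schwarz[OF g f0(1)] by (simp add: norm_mult norm_power)
    finally have "((\<kappa> - cmod z) * l2_norm N f0) * l2_norm N f0 \<le> l2_norm N ?g * l2_norm N f0"
      using gap[OF f0] by (simp add: algebra_simps power2_eq_square)
    then show ?thesis
      by (rule mult_right_le_imp_le) (use False l2_norm_nonneg[of N f0] in linarith)
  qed simp
  then have "l2_norm N f0 \<le> 1 / (\<kappa> - cmod z) * l2_norm N ?g"
    using z by (simp add: field_simps)
  moreover have "l2_norm N f \<le> l2_norm N f0 + cmod c * l2_norm N e"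
    unfolding f_eq using l2_norm_triangle[OF f0(1) l2_space_scale[OF e(1), of c]]
    by (simp add: l2_norm_scale)
  ultimately have "l2_norm N f \<le> ?m * l2_norm N ?g"
    using c_le by (simp only: distrib_right)
  then show "1 / ?m * l2_norm N f \<le> l2_norm N ?g"
    using m by (simp add: pos_divide_le_eq mult.commute del: inverse_eq_divide)
qed

subsection \<open>From isolation to a spectral gap\<close>

text \<open>
  The conclusion says \<open>T (T - a) \<ge> 0\<close>, which the spectral theorem gives if the spectrum avoids the
  interval from \<open>0\<close> to \<open>a\<close>. Here is a direct reason. Put \<open>b = a/2\<close>; the claim is
  \<open>(T - b)\<^sup>2 \<ge> b\<^sup>2\<close>. Otherwise the infimum \<open>\<mu>\<close> of the form of \<open>(T - b)\<^sup>2\<close> on unit vectors is less than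
  \<open>b\<^sup>2\<close>, and \<open>(T - b)\<^sup>2 - \<mu> = (T - (b - \<surd>\<mu>)) (T - (b + \<surd>\<mu>))\<close> is bounded below in norm, because both
  \<open>b - \<surd>\<mu>\<close> and \<open>b + \<surd>\<mu>\<close> lie in the interval. As \<open>(T - b)\<^sup>2 - \<mu>\<close> is a positive operator, its
  form is then bounded below as well, contradicting the choice of \<open>\<mu>\<close>.
\<close>

lemma interval_gap_form:
  assumes a: "0 < a" and res: "\<And>t. 0 < t \<Longrightarrow> t < a \<Longrightarrow> complex_of_real t \<notin> l2_spectrum N T"
    and f: "f \<in> l2_space N"
  shows "a * Re (l2_inner N (T f) f) \<le> (l2_norm N (T f))\<^sup>2"
proof (rule ccontr)
  assume contr: "\<not> ?thesis"
  define b where "b = a / 2"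
  define S where "S g = (\<lambda>x. T g x - of_real b * g x)" for g
  have S_space: "S g \<in> l2_space N" if "g \<in> l2_space N" for g
    unfolding S_def using that by (intro l2_space_diff l2_space_scale T_space)
  have S_inner: "l2_inner N (S g) (S h) = l2_inner N (T g) (T h) - of_real (2 * b) * l2_inner N (T g) h
      + of_real (b\<^sup>2) * l2_inner N g h"
    if "g \<in> l2_space N" "h \<in> l2_space N" for g h
    unfolding S_def using that
    by (simp add: l2_inner_linear T_space symmetric[of g h, symmetric] algebra_simps power2_eq_square)
  have S_norm: "(l2_norm N (S g))\<^sup>2 = (l2_norm N (T g))\<^sup>2 - a * Re (l2_inner N (T g) g)
      + b\<^sup>2 * (l2_norm N g)\<^sup>2" if "g \<in> l2_space N" for g
    using arg_cong[OF S_inner[OF that that], of Re]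
    by (simp add: l2_inner_self b_def del: of_real_power)
  have S_le: "l2_norm N (S g) \<le> (K + b) * l2_norm N g" if "g \<in> l2_space N" for g
  proof -
    have "l2_norm N (S g) \<le> l2_norm N (T g) + l2_norm N (\<lambda>x. of_real (- b) * g x)"
      unfolding S_def
      using l2_norm_triangle[OF T_space[OF that] l2_space_scale[OF that, of "of_real (- b)"]] by simp
    then show ?thesis
      using norm_T_le[OF that] a unfolding l2_norm_scale by (simp add: b_def algebra_simps)
  qed
  define V where "V = {g \<in> l2_space N. l2_norm N g \<noteq> 0}"
  define Q where "Q g = (l2_norm N (S g))\<^sup>2 / (l2_norm N g)\<^sup>2" for g
  define \<mu> where "\<mu> = (INF g\<in>V. Q g)"
  have Sf: "(l2_norm N (S f))\<^sup>2 < b\<^sup>2 * (l2_norm N f)\<^sup>2"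
    using contr S_norm[OF f] by simp
  then have fV: "f \<in> V" using f not_less by (fastforce simp: V_def)
  have bdd: "bdd_below (Q ` V)" by (rule bdd_belowI2[of _ 0]) (simp add: Q_def)
  have \<mu>0: "0 \<le> \<mu>" unfolding \<mu>_def using fV by (intro cINF_greatest) (auto simp: Q_def)
  have "\<mu> \<le> Q f" unfolding \<mu>_def by (rule cINF_lower[OF bdd fV])
  also have "Q f < b\<^sup>2" using Sf fV by (simp add: Q_def V_def divide_less_eq)
  finally have \<mu>b: "sqrt \<mu> < b" using a by (intro real_less_lsqrt) (auto simp: b_def \<mu>0)
  have Q_le: "\<mu> * (l2_norm N g)\<^sup>2 \<le> (l2_norm N (S g))\<^sup>2" if "g \<in> l2_space N" for g
  proof (cases "g \<in> V")
    case True
    then have "\<mu> \<le> Q g" unfolding \<mu>_def by (rule cINF_lower[OF bdd])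
    then show ?thesis using True by (simp add: Q_def V_def le_divide_eq)
  next
    case False
    then show ?thesis using that by (simp add: V_def)
  qed
  define s where "s = b - sqrt \<mu>"
  define t where "t = b + sqrt \<mu>"
  have st: "0 < s" "s < a" "0 < t" "t < a" "s + t = 2 * b" "s * t = b\<^sup>2 - \<mu>"
    using \<mu>b \<mu>0 a by (auto simp: s_def t_def b_def field_simps power2_eq_square intro: add_pos_nonneg)
  obtain \<delta> where \<delta>: "0 < \<delta>"
    "\<And>g. g \<in> l2_space N \<Longrightarrow> \<delta> * l2_norm N g \<le> l2_norm N (\<lambda>x. of_real s * g x - T g x)"
    using bounded_below_of_not_in_spectrum[OF res[OF st(1,2)]] by blast
  obtain \<epsilon> where \<epsilon>: "0 < \<epsilon>"
    "\<And>g. g \<in> l2_space N \<Longrightarrow> \<epsilon> * l2_norm N g \<le> l2_norm N (\<lambda>x. of_real t * g x - T g x)"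
    using bounded_below_of_not_in_spectrum[OF res[OF st(3,4)]] by blast
  define A where "A g = (\<lambda>x. of_real t * (of_real s * g x - T g x) - T (\<lambda>x. of_real s * g x - T g x) x)" for g
  have A_space: "A g \<in> l2_space N" if "g \<in> l2_space N" for g
    unfolding A_def using that by (intro l2_space_diff l2_space_scale T_space)
  have A_below: "\<epsilon> * \<delta> * l2_norm N g \<le> l2_norm N (A g)" if "g \<in> l2_space N" for g
  proof -
    have "\<epsilon> * (\<delta> * l2_norm N g) \<le> \<epsilon> * l2_norm N (\<lambda>x. of_real s * g x - T g x)"
      using \<delta>(2)[OF that] \<epsilon>(1) by (intro mult_left_mono) auto
    also have "\<dots> \<le> l2_norm N (A g)"
      unfolding A_def using that by (intro \<epsilon>(2) l2_space_diff l2_space_scale T_space)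
    finally show ?thesis by (simp add: mult.assoc)
  qed
  have A_inner: "l2_inner N (A g) h = l2_inner N (S g) (S h) - of_real \<mu> * l2_inner N g h"
    if g: "g \<in> l2_space N" and h: "h \<in> l2_space N" for g h
  proof -
    have gs: "(\<lambda>x. of_real s * g x - T g x) \<in> l2_space N"
      using g by (intro l2_space_diff l2_space_scale T_space)
    have "l2_inner N (A g) h = of_real t * (of_real s * l2_inner N g h - l2_inner N (T g) h)
        - (of_real s * l2_inner N g (T h) - l2_inner N (T g) (T h))"
      unfolding A_def using g h gs by (simp add: l2_inner_linear T_space symmetric[OF gs h])
    also have "l2_inner N g (T h) = l2_inner N (T g) h" using g h by (simp add: symmetric)
    also have "of_real t * (of_real s * l2_inner N g h - l2_inner N (T g) h)
        - (of_real s * l2_inner N (T g) h - l2_inner N (T g) (T h))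
      = l2_inner N (T g) (T h) - of_real (s + t) * l2_inner N (T g) h + of_real (s * t) * l2_inner N g h"
      by (simp add: algebra_simps)
    finally show ?thesis unfolding st S_inner[OF g h] by (simp add: algebra_simps)
  qed
  have A_self: "Re (l2_inner N (A g) g) = (l2_norm N (S g))\<^sup>2 - \<mu> * (l2_norm N g)\<^sup>2"
    if "g \<in> l2_space N" for g
    using A_inner[OF that that] by (simp add: l2_inner_self del: of_real_power)
  have improve: "\<mu> + (\<epsilon> * \<delta> / (K + b))\<^sup>2 \<le> Q g" if g: "g \<in> V" for g
  proof -
    have gH: "g \<in> l2_space N" and g0: "0 < (l2_norm N g)\<^sup>2" using g by (auto simp: V_def)
    have "(cmod (l2_inner N (A g) (A g)))\<^sup>2 \<le> Re (l2_inner N (A g) g) * Re (l2_inner N (A (A g)) (A g))"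
    proof (rule positive_form_Cauchy_Schwarz[of N "\<lambda>g h. l2_inner N (A g) h"])
      show "l2_inner N (A g) h = cnj (l2_inner N (A h) g)"
        if "g \<in> l2_space N" "h \<in> l2_space N" for g h
        using that by (simp add: A_inner l2_inner_commute[of N g] l2_inner_commute[of N "S g"])
      show "l2_inner N (A (\<lambda>x. g x + c * h x)) k = l2_inner N (A g) k + c * l2_inner N (A h) k"
        if "g \<in> l2_space N" "h \<in> l2_space N" "k \<in> l2_space N" for g h k c
        using that
        by (simp add: A_inner S_inner l2_inner_linear T_space symmetric algebra_simps)
      show "0 \<le> Re (l2_inner N (A g) g)" if "g \<in> l2_space N" for g
        using Q_le[OF that] by (simp add: A_self[OF that])
    qed (use gH A_space in auto)
    also have "\<dots> \<le> Re (l2_inner N (A g) g) * ((K + b) * l2_norm N (A g))\<^sup>2"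
    proof (rule mult_left_mono)
      have "Re (l2_inner N (A (A g)) (A g)) \<le> (l2_norm N (S (A g)))\<^sup>2"
        using A_self[OF A_space[OF gH]] \<mu>0 by simp
      also have "\<dots> \<le> ((K + b) * l2_norm N (A g))\<^sup>2"
        by (intro power_mono S_le A_space gH) simp
      finally show "Re (l2_inner N (A (A g)) (A g)) \<le> ((K + b) * l2_norm N (A g))\<^sup>2" .
      show "0 \<le> Re (l2_inner N (A g) g)" using Q_le[OF gH] by (simp add: A_self[OF gH])
    qed
    finally have "(l2_norm N (A g))\<^sup>2 * (l2_norm N (A g))\<^sup>2
        \<le> (Re (l2_inner N (A g) g) * (K + b)\<^sup>2) * (l2_norm N (A g))\<^sup>2"
      by (simp add: l2_inner_self norm_mult power2_eq_square mult_ac)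
    moreover have low: "0 < l2_norm N (A g)"
      using A_below[OF gH] g0 \<epsilon>(1) \<delta>(1) l2_norm_nonneg[of N g]
      by (smt (verit) mult_pos_pos zero_eq_power2)
    ultimately have "(l2_norm N (A g))\<^sup>2 \<le> Re (l2_inner N (A g) g) * (K + b)\<^sup>2"
      by (meson mult_right_le_imp_le zero_less_power)
    moreover have "(\<epsilon> * \<delta> * l2_norm N g)\<^sup>2 \<le> (l2_norm N (A g))\<^sup>2"
      using A_below[OF gH] \<epsilon>(1) \<delta>(1) by (intro power_mono) auto
    ultimately have "(\<epsilon> * \<delta>)\<^sup>2 * (l2_norm N g)\<^sup>2
        \<le> ((l2_norm N (S g))\<^sup>2 - \<mu> * (l2_norm N g)\<^sup>2) * (K + b)\<^sup>2"
      unfolding A_self[OF gH] by (simp add: power_mult_distrib)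
    moreover have "0 < (K + b)\<^sup>2" using K_pos a by (simp add: b_def)
    ultimately have "(\<epsilon> * \<delta>)\<^sup>2 / (K + b)\<^sup>2 * (l2_norm N g)\<^sup>2
        \<le> (l2_norm N (S g))\<^sup>2 - \<mu> * (l2_norm N g)\<^sup>2"
      by (simp add: pos_divide_le_eq mult.commute)
    then show ?thesis using g0
      by (simp add: Q_def pos_le_divide_eq power_divide algebra_simps)
  qed
  have "\<mu> + (\<epsilon> * \<delta> / (K + b))\<^sup>2 \<le> (INF g\<in>V. Q g)"
    using fV improve by (intro cINF_greatest) auto
  moreover have "0 < \<epsilon> * \<delta> / (K + b)" using \<epsilon>(1) \<delta>(1) K_pos a by (simp add: b_def)
  ultimately show False unfolding \<mu>_def by (smt (verit) zero_less_power)
qed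

text \<open>
  The preceding lemma gives the form bound \<open>T \<ge> a\<close> on the range of \<open>T\<close>, so the vectors
  \<open>T f\<^sub>n\<close> with \<open>f\<^sub>n = (1 - T/K)\<^sup>n f\<close> decrease geometrically. Hence \<open>f\<^sub>n\<close> converges to a vector of the
  kernel, and for \<open>f\<close> orthogonal to the kernel the limit is \<open>0\<close>. The norm of \<open>f\<close> is therefore at most
  the sum of the norms of the steps \<open>f\<^sub>n\<^sub>+\<^sub>1 - f\<^sub>n = - T f\<^sub>n / K\<close>, a geometric series starting with
  \<open>\<parallel>T f\<parallel> / K\<close>. Its ratio is \<open>1 - a/K\<close>, or \<open>0\<close> if \<open>a > K\<close>, whence the minimum in the constant.
\<close>

lemma interval_gap_bounded_below:
  assumes a: "0 < a" and res: "\<And>t. 0 < t \<Longrightarrow> t < a \<Longrightarrow> complex_of_real t \<notin> l2_spectrum N T"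
    and f: "f \<in> l2_space N"
    and perp: "\<And>h. h \<in> l2_space N \<Longrightarrow> AE x in N. T h x = 0 \<Longrightarrow> l2_inner N f h = 0"
  shows "min a K * l2_norm N f \<le> l2_norm N (T f)"
proof -
  have range: "a * (l2_norm N (T g))\<^sup>2 \<le> Re (l2_inner N (T (T g)) (T g))"
    if g: "g \<in> l2_space N" for g
  proof (cases "l2_norm N (T g) = 0")
    case True
    then show ?thesis using nonneg[OF T_space[OF g]] by simp
  next
    case False
    have "a * ((l2_norm N (T g))\<^sup>2)\<^sup>2
        \<le> a * (Re (l2_inner N (T g) g) * Re (l2_inner N (T (T g)) (T g)))"
      using norm_T_power4_le[OF g] a by (intro mult_left_mono) auto
    also have "\<dots> = (a * Re (l2_inner N (T g) g)) * Re (l2_inner N (T (T g)) (T g))" by simp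
    also have "\<dots> \<le> (l2_norm N (T g))\<^sup>2 * Re (l2_inner N (T (T g)) (T g))"
      using interval_gap_form[OF a res g] nonneg[OF T_space[OF g]] by (intro mult_right_mono) auto
    finally have "a * (l2_norm N (T g))\<^sup>2 * (l2_norm N (T g))\<^sup>2
        \<le> Re (l2_inner N (T (T g)) (T g)) * (l2_norm N (T g))\<^sup>2"
      by (simp add: power2_eq_square mult_ac)
    then show ?thesis by (rule mult_right_le_imp_le) (use False in simp)
  qed
  define q where "q = max 0 (1 - a / K)"
  have q: "0 \<le> q" "q < 1" using a K_pos by (auto simp: q_def)
  define u where "u n = (relax ^^ n) f" for n
  have u_Suc: "u (Suc n) = relax (u n)" for n by (simp add: u_def)
  have u: "u n \<in> l2_space N" for n
    by (induction n) (auto simp: u_Suc relax_space, simp add: u_def f)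
  have T_u_Suc: "AE x in N. T (u (Suc n)) x = relax (T (u n)) x" for n
    using T_add_scale[OF u[of n] T_space[OF u[of n]], of "- of_real (1 / K)"]
    by (simp add: u_Suc relax_def)
  have T_u_contract: "l2_norm N (T (u (Suc n))) \<le> q * l2_norm N (T (u n))" for n
  proof -
    let ?g = "relax (T (u n))"
    have sp: "T (u n) \<in> l2_space N" "?g \<in> l2_space N" "T (u (Suc n)) \<in> l2_space N"
      using u by (auto intro: T_space relax_space)
    have eq: "l2_norm N (T (u (Suc n))) = l2_norm N ?g"
      using T_u_Suc sp by (intro l2_norm_cong_AE) (auto intro: l2_space_measurable)
    have "l2_inner N (T (T (u (Suc n)))) (T (u (Suc n))) = l2_inner N (T ?g) ?g"
      using T_u_Suc[of n] T_cong[OF sp(3,2) T_u_Suc] sp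
      by (intro l2_inner_cong_AE) (auto intro!: l2_space_measurable T_space)
    with range[OF u[of "Suc n"]] have "a * (l2_norm N ?g)\<^sup>2 \<le> Re (l2_inner N (T ?g) ?g)"
      by (simp add: eq)
    from norm_relax_le[OF sp(1) range[OF u] this] show ?thesis by (simp add: eq q_def)
  qed
  have T_u: "l2_norm N (T (u n)) \<le> l2_norm N (T f) * q ^ n" for n
  proof (induction n)
    case (Suc n)
    show ?case using T_u_contract[of n] mult_left_mono[OF Suc q(1)] by (simp add: mult_ac)
  qed (simp add: u_def)
  have step: "l2_norm N (\<lambda>x. u (Suc n) x - u n x) \<le> l2_norm N (T f) / K * q ^ n" for n
  proof -
    have "l2_norm N (\<lambda>x. u (Suc n) x - u n x) = l2_norm N (\<lambda>x. - of_real (1 / K) * T (u n) x)"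
      by (simp add: u_Suc relax_def)
    also have "\<dots> = l2_norm N (T (u n)) / K"
      unfolding l2_norm_scale using K_pos by (simp add: norm_divide)
    finally show ?thesis using divide_right_mono[OF T_u[of n], of K] K_pos by simp
  qed
  obtain v where v: "v \<in> l2_space N" and lim: "(\<lambda>n. l2_norm N (\<lambda>x. u n x - v x)) \<longlonglongrightarrow> 0"
    using l2_complete_geometric[OF u step q] by blast
  have "l2_norm N (T v) \<le> K * l2_norm N (\<lambda>x. u n x - v x) + l2_norm N (T f) * q ^ n" for n
    using l2_norm_triangle[OF l2_space_diff[OF T_space[OF v] T_space[OF u[of n]]] T_space[OF u[of n]]]
      norm_T_diff_le[OF v u[of n]] T_u[of n] by (simp add: l2_norm_diff_commute[of N v])
  moreover have "(\<lambda>n. K * l2_norm N (\<lambda>x. u n x - v x) + l2_norm N (T f) * q ^ n)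
      \<longlonglongrightarrow> K * 0 + l2_norm N (T f) * 0"
    using q by (intro tendsto_intros lim LIMSEQ_realpow_zero)
  ultimately have "l2_norm N (T v) \<le> 0"
    by (intro LIMSEQ_le_const[where X = "\<lambda>n. K * l2_norm N (\<lambda>x. u n x - v x) + l2_norm N (T f) * q ^ n"]) auto
  then have "l2_norm N (T v) = 0" by (simp add: antisym)
  then have Tv: "AE x in N. T v x = 0" using l2_norm_eq_0_iff[OF T_space[OF v]] by simp
  have u_v: "l2_inner N (u n) v = 0" for n
  proof (induction n)
    case 0
    then show ?case using perp[OF v Tv] by (simp add: u_def)
  next
    case (Suc n)
    have "l2_inner N (T (u n)) v = l2_inner N (u n) (T v)" using u v by (simp add: symmetric)
    also have "\<dots> = l2_inner N (u n) (\<lambda>_. 0)"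
      using u v Tv by (intro l2_inner_cong_AE) (auto intro!: l2_space_measurable T_space)
    finally have "l2_inner N (T (u n)) v = 0" by (simp add: l2_inner_def)
    then show ?case using Suc u[of n] v
      by (simp only: u_Suc relax_def l2_inner_linear T_space mult_zero_right diff_zero)
  qed
  have v0: "l2_norm N v = 0"
  proof (rule ccontr)
    assume nz: "l2_norm N v \<noteq> 0"
    have "l2_norm N v \<le> l2_norm N (\<lambda>x. u n x - v x)" for n
    proof -
      have "l2_inner N (\<lambda>x. u n x - v x) v = - of_real ((l2_norm N v)\<^sup>2)"
        using u v u_v by (simp add: l2_inner_linear l2_inner_self)
      then have "l2_norm N v * l2_norm N v \<le> l2_norm N (\<lambda>x. u n x - v x) * l2_norm N v"
        using l2_Cauchy_Schwarz[OF l2_space_diff[OF u v] v, of n]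
        by (simp add: norm_power power2_eq_square norm_mult)
      then show ?thesis
        by (rule mult_right_le_imp_le) (use nz l2_norm_nonneg[of N v] in linarith)
    qed
    then have "l2_norm N v \<le> 0" by (intro LIMSEQ_le_const[OF lim]) auto
    then show False using nz by (simp add: antisym)
  qed
  have "l2_norm N f \<le> l2_norm N (T f) / K / (1 - q) + l2_norm N (\<lambda>x. u n x - v x)" for n
  proof -
    have "l2_norm N f \<le> l2_norm N (\<lambda>x. u 0 x - u n x) + l2_norm N (u n)"
      using l2_norm_triangle[OF l2_space_diff[OF u[of 0] u[of n]] u[of n]] by (simp add: u_def)
    moreover have "l2_norm N (\<lambda>x. u 0 x - u n x) \<le> l2_norm N (T f) / K / (1 - q)"
      using l2_norm_geometric_tail[OF u step q, of 0 n] by (simp add: l2_norm_diff_commute[of N "u 0"])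
    moreover have "l2_norm N (u n) \<le> l2_norm N (\<lambda>x. u n x - v x)"
      using l2_norm_triangle[OF l2_space_diff[OF u[of n] v] v] v0 by simp
    ultimately show ?thesis by linarith
  qed
  moreover have "(\<lambda>n. l2_norm N (T f) / K / (1 - q) + l2_norm N (\<lambda>x. u n x - v x))
      \<longlonglongrightarrow> l2_norm N (T f) / K / (1 - q) + 0"
    by (intro tendsto_intros lim)
  ultimately have "l2_norm N f \<le> l2_norm N (T f) / K / (1 - q)"
    by (intro LIMSEQ_le_const[where X = "\<lambda>n. l2_norm N (T f) / K / (1 - q) + l2_norm N (\<lambda>x. u n x - v x)"]) auto
  then have "K * (1 - q) * l2_norm N f \<le> l2_norm N (T f)"
    using K_pos q by (simp add: pos_le_divide_eq mult_ac)
  moreover have "K * (1 - q) = min a K"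
    using K_pos a by (auto simp: q_def max_def min_def field_simps)
  ultimately show ?thesis by simp
qed

text \<open>
  Simplicity identifies the kernel with the multiples of \<open>e\<close>; isolation makes \<open>T\<close> bounded below in
  norm on the orthogonal complement, and \<open>\<parallel>T f\<parallel>\<^sup>2 \<le> K \<langle>T f, f\<rangle>\<close> turns this into a bound for the form.
\<close>

theorem isolated_simple_iff_gap:
  assumes e: "e \<in> l2_space N" "AE x in N. T e x = 0" "l2_norm N e \<noteq> 0"
  shows "0 isolated_in l2_spectrum N T \<and> l2_has_multiplicity N T 0 1 \<longleftrightarrow>
    (\<exists>\<kappa>>0. \<forall>f\<in>l2_space N. l2_inner N f e = 0 \<longrightarrow>
      \<kappa> * (l2_norm N f)\<^sup>2 \<le> Re (l2_inner N (T f) f))"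
proof
  assume L: "0 isolated_in l2_spectrum N T \<and> l2_has_multiplicity N T 0 1"
  obtain a where a: "0 < a" "\<And>z. z \<in> l2_spectrum N T \<Longrightarrow> dist 0 z < a \<Longrightarrow> z = 0"
    using conjunct1[OF L] unfolding isolated_in_dist_Ex_iff by metis
  have res: "complex_of_real t \<notin> l2_spectrum N T" if "0 < t" "t < a" for t
  proof
    assume "complex_of_real t \<in> l2_spectrum N T"
    then have "complex_of_real t = 0" by (rule a(2)) (use that in \<open>simp add: dist_norm\<close>)
    then show False using that by simp
  qed
  obtain E where E: "\<forall>h\<in>l2_eigenspace N T 0.
      \<exists>c :: nat \<Rightarrow> complex. AE x in N. h x = (\<Sum>i<1::nat. c i * E i x)"
    using conjunct2[OF L] unfolding l2_has_multiplicity_def by (elim exE conjE) (rule that)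
  define e' where "e' = E 0"
  have e': "\<exists>c. AE x in N. h x = c * e' x" if "h \<in> l2_eigenspace N T 0" for h
    using bspec[OF E that] by (auto simp: e'_def)
  have eig: "h \<in> l2_eigenspace N T 0" if "h \<in> l2_space N" "AE x in N. T h x = 0" for h
    using that by (simp add: l2_eigenspace_def)
  obtain c where c: "AE x in N. e x = c * e' x" using e'[OF eig[OF e(1,2)]] by blast
  have "c \<noteq> 0"
  proof
    assume "c = 0"
    then have "AE x in N. e x = 0" using c by simp
    then show False using e(3) l2_norm_eq_0_iff[OF e(1)] by simp
  qed
  let ?m = "min a K"
  have "?m\<^sup>2 / K * (l2_norm N f)\<^sup>2 \<le> Re (l2_inner N (T f) f)"
    if f: "f \<in> l2_space N" "l2_inner N f e = 0" for f
  proof -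
    have "?m * l2_norm N f \<le> l2_norm N (T f)"
    proof (rule interval_gap_bounded_below[OF a(1) res f(1)])
      fix h assume h: "h \<in> l2_space N" "AE x in N. T h x = 0"
      obtain d where d: "AE x in N. h x = d * e' x" using e'[OF eig[OF h]] by blast
      have "AE x in N. h x = d / c * e x"
        using c d by eventually_elim (use \<open>c \<noteq> 0\<close> in simp)
      then have "l2_inner N f h = l2_inner N f (\<lambda>x. d / c * e x)"
        using f h e by (intro l2_inner_cong_AE) (auto intro!: l2_space_measurable l2_space_scale)
      then show "l2_inner N f h = 0" by (simp only: l2_inner_scale_right f mult_zero_right)
    qed
    then have "(?m * l2_norm N f)\<^sup>2 \<le> (l2_norm N (T f))\<^sup>2"
      using a K_pos by (intro power_mono) auto
    also have "\<dots> \<le> K * Re (l2_inner N (T f) f)" by (rule norm_T_square_le[OF f(1)])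
    finally show ?thesis using K_pos by (simp add: power_mult_distrib pos_divide_le_eq mult.commute)
  qed
  moreover have "0 < ?m\<^sup>2 / K" using a K_pos by simp
  ultimately show "\<exists>\<kappa>>0. \<forall>f\<in>l2_space N. l2_inner N f e = 0 \<longrightarrow>
      \<kappa> * (l2_norm N f)\<^sup>2 \<le> Re (l2_inner N (T f) f)" by blast
next
  assume "\<exists>\<kappa>>0. \<forall>f\<in>l2_space N. l2_inner N f e = 0 \<longrightarrow>
      \<kappa> * (l2_norm N f)\<^sup>2 \<le> Re (l2_inner N (T f) f)"
  then obtain \<kappa> where \<kappa>: "0 < \<kappa>"
    and gap: "\<And>f. f \<in> l2_space N \<Longrightarrow> l2_inner N f e = 0 \<Longrightarrow>
      \<kappa> * (l2_norm N f)\<^sup>2 \<le> Re (l2_inner N (T f) f)" by blast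
  have "0 isolated_in l2_spectrum N T"
    unfolding isolated_in_dist_Ex_iff
    using zero_in_spectrum[OF e] gap_resolvent[OF e gap] \<kappa> by auto
  moreover have "l2_has_multiplicity N T 0 1"
    unfolding l2_has_multiplicity_def
  proof (intro exI[of _ "\<lambda>_. e"] conjI allI impI ballI)
    show "e \<in> l2_eigenspace N T 0" using e by (simp add: l2_eigenspace_def)
    fix c :: "nat \<Rightarrow> complex" and i :: nat
    assume "AE x in N. (\<Sum>i<1. c i * e x) = 0" and i: "i < 1"
    then have "l2_norm N (\<lambda>x. c 0 * e x) = 0"
      using l2_norm_eq_0_iff[OF l2_space_scale[OF e(1)]] by simp
    then show "c i = 0" using e(3) i by (simp add: l2_norm_scale)
  next
    fix f assume "f \<in> l2_eigenspace N T 0"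
    then have f: "f \<in> l2_space N" "AE x in N. T f x = 0" by (auto simp: l2_eigenspace_def)
    obtain f0 c where f0: "f0 \<in> l2_space N" "l2_inner N f0 e = 0"
      and f_eq: "f = (\<lambda>x. f0 x + c * e x)"
      using l2_orthogonal_decomposition[OF e(1,3) f(1)] by blast
    have "AE x in N. T f0 x = 0"
      using T_add_scale[OF f0(1) e(1), of c] f(2) e(2) unfolding f_eq[symmetric]
      by eventually_elim simp
    then have "l2_inner N (T f0) f0 = l2_inner N (\<lambda>_. 0) f0"
      using f0 by (intro l2_inner_cong_AE) (auto intro!: l2_space_measurable T_space)
    then have "\<kappa> * (l2_norm N f0)\<^sup>2 \<le> 0" using gap[OF f0] by (simp add: l2_inner_def)
    then have "l2_norm N f0 = 0" using \<kappa> by (simp add: mult_le_0_iff)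
    then have "AE x in N. f0 x = 0" using l2_norm_eq_0_iff[OF f0(1)] by simp
    then have "AE x in N. f x = (\<Sum>i<1::nat. c * e x)"
      by eventually_elim (simp add: f_eq)
    then show "\<exists>c. AE x in N. f x = (\<Sum>i<1::nat. c i * e x)" by (intro exI[of _ "\<lambda>_. c"])
  qed
  ultimately show "0 isolated_in l2_spectrum N T \<and> l2_has_multiplicity N T 0 1" ..
qed

end

section \<open>Nonsingular actions with bounded densities\<close>

locale bounded_rn_action = group_action G "space M" \<phi> + prob_space M
  for G :: "('g, 'b) monoid_scheme" (structure)
    and M :: "'x measure" and \<phi> :: "'g \<Rightarrow> 'x \<Rightarrow> 'x" +
  fixes S :: "'g set" and r :: "'g \<Rightarrow> 'x \<Rightarrow> real" and \<Theta> :: real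
  assumes finite_S: "finite S" and S_carrier: "S \<subseteq> carrier G"
    and generate_S: "generate G S = carrier G"
    and inv_S: "s \<in> S \<Longrightarrow> inv s \<in> S" and one_S: "\<one> \<in> S"
    and \<Theta>_ge_1: "1 \<le> \<Theta>"
    and action_measurable: "g \<in> carrier G \<Longrightarrow> \<phi> g \<in> measurable M M"
    and action_null: "g \<in> carrier G \<Longrightarrow> A \<in> null_sets M \<Longrightarrow> \<phi> g ` A \<in> null_sets M"
    and rn: "rn_version G M \<phi> r"
    and r_bounds: "s \<in> S \<Longrightarrow> x \<in> space M \<Longrightarrow> 1 / \<Theta> \<le> r s x \<and> r s x \<le> \<Theta>"
begin

sublocale group G
  using group_hom group_hom.axioms(1) by auto

lemma S_in_carrier [simp]: "s \<in> S \<Longrightarrow> s \<in> carrier G"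
  using S_carrier by auto

lemma action_space [simp]: "g \<in> carrier G \<Longrightarrow> x \<in> space M \<Longrightarrow> \<phi> g x \<in> space M"
  using element_image by blast

lemma action_inv_action [simp]:
  "g \<in> carrier G \<Longrightarrow> x \<in> space M \<Longrightarrow> \<phi> (inv g) (\<phi> g x) = x"
  using orbit_sym_aux by blast

lemma action_action_inv [simp]:
  assumes "g \<in> carrier G" "x \<in> space M"
  shows "\<phi> g (\<phi> (inv g) x) = x"
  using action_inv_action[of "inv g" x] assms by simp

lemma action_image_eq:
  assumes "g \<in> carrier G" "A \<subseteq> space M"
  shows "\<phi> g ` A = \<phi> (inv g) -` A \<inter> space M"
proof (intro equalityI subsetI)
  fix y assume "y \<in> \<phi> (inv g) -` A \<inter> space M"
  then show "y \<in> \<phi> g ` A"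
    using action_action_inv[OF assms(1), of y] by (metis IntD1 IntD2 imageI vimageD)
qed (use assms in auto)

lemma action_image_sets [measurable]:
  assumes "g \<in> carrier G" "A \<in> sets M"
  shows "\<phi> g ` A \<in> sets M"
  using action_image_eq[OF assms(1) sets.sets_into_space[OF assms(2)]]
    measurable_sets[OF action_measurable[of "inv g"] assms(2)] assms by simp

lemma r_measurable: "g \<in> carrier G \<Longrightarrow> r g \<in> borel_measurable M"
  and r_nonneg: "g \<in> carrier G \<Longrightarrow> x \<in> space M \<Longrightarrow> 0 \<le> r g x"
  using rn by (auto simp: rn_version_def)

lemma density_r:
  assumes g: "g \<in> carrier G"
  shows "density M (\<lambda>x. ennreal (r g x)) = distr M M (\<phi> (inv g))"
proof -
  have [measurable]: "\<phi> (inv g) \<in> measurable M M" "r g \<in> borel_measurable M"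
    using g by (auto intro: action_measurable r_measurable)
  have "absolutely_continuous M (distr M M (\<phi> (inv g)))"
    unfolding absolutely_continuous_def
  proof
    fix A assume A: "A \<in> null_sets M"
    then have "\<phi> (inv g) -` A \<inter> space M \<in> null_sets M"
      using action_null[OF g A] action_image_eq[OF g sets.sets_into_space[OF null_setsD2[OF A]]] by simp
    then show "A \<in> null_sets (distr M M (\<phi> (inv g)))"
      using A by (intro null_setsI) (auto simp: emeasure_distr null_setsD1 null_setsD2)
  qed
  then have "density M (RN_deriv M (distr M M (\<phi> (inv g)))) = distr M M (\<phi> (inv g))"
    by (rule density_RN_deriv) simp
  moreover have "density M (\<lambda>x. ennreal (r g x)) = density M (RN_deriv M (distr M M (\<phi> (inv g))))"
    using rn g by (intro density_cong) (auto simp: rn_version_def)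
  ultimately show ?thesis by simp
qed

lemma nn_integral_action:
  assumes g: "g \<in> carrier G" and F [measurable]: "F \<in> borel_measurable M"
  shows "(\<integral>\<^sup>+x. ennreal (r g x) * F (\<phi> g x) \<partial>M) = (\<integral>\<^sup>+x. F x \<partial>M)"
proof -
  have [measurable]: "\<phi> g \<in> measurable M M" "\<phi> (inv g) \<in> measurable M M" "r g \<in> borel_measurable M"
    using g by (auto intro: action_measurable r_measurable)
  have "(\<integral>\<^sup>+x. ennreal (r g x) * F (\<phi> g x) \<partial>M)
      = (\<integral>\<^sup>+x. F (\<phi> g x) \<partial>density M (\<lambda>x. ennreal (r g x)))"
    by (subst nn_integral_density) auto
  also have "\<dots> = (\<integral>\<^sup>+x. F (\<phi> g (\<phi> (inv g) x)) \<partial>M)"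
    unfolding density_r[OF g] by (subst nn_integral_distr) auto
  also have "\<dots> = (\<integral>\<^sup>+x. F x \<partial>M)"
    using g by (intro nn_integral_cong) simp
  finally show ?thesis .
qed

text \<open>
  The chain rule for the composite of \<open>g\<close> and its inverse, proved by changing variables twice. Because
  of it the operators \<open>f \<mapsto> (\<lambda>x. sqrt (r g x) * f (\<phi> g x))\<close> are unitary on \<open>L\<^sup>2(M)\<close>, with the
  operator of the inverse of \<open>g\<close> as adjoint.
\<close>

lemma rn_cocycle:
  assumes g: "g \<in> carrier G"
  shows "AE x in M. r (inv g) (\<phi> g x) * r g x = 1"
proof -
  have [measurable]: "\<phi> g \<in> measurable M M" "\<phi> (inv g) \<in> measurable M M"
      "r g \<in> borel_measurable M" "r (inv g) \<in> borel_measurable M"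
    using g by (auto intro: action_measurable r_measurable)
  have "density M (\<lambda>x. ennreal (r (inv g) (\<phi> g x) * r g x)) = density M (\<lambda>_. 1)"
  proof (rule measure_eqI)
    fix A assume "A \<in> sets (density M (\<lambda>x. ennreal (r (inv g) (\<phi> g x) * r g x)))"
    then have [measurable]: "A \<in> sets M" by simp
    define F where "F y = ennreal (r (inv g) y) * indicator A (\<phi> (inv g) y)" for y
    have [measurable]: "F \<in> borel_measurable M" unfolding F_def by measurable
    have "emeasure (density M (\<lambda>x. ennreal (r (inv g) (\<phi> g x) * r g x))) A
        = (\<integral>\<^sup>+x. ennreal (r g x) * F (\<phi> g x) \<partial>M)"
      using g unfolding F_def
      by (subst emeasure_density)
         (auto intro!: nn_integral_cong simp: ennreal_mult r_nonneg mult_ac)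
    also have "\<dots> = (\<integral>\<^sup>+x. F x \<partial>M)" using g by (intro nn_integral_action) auto
    also have "\<dots> = (\<integral>\<^sup>+x. indicator A x \<partial>M)"
      unfolding F_def using g by (intro nn_integral_action) auto
    finally show "emeasure (density M (\<lambda>x. ennreal (r (inv g) (\<phi> g x) * r g x))) A
        = emeasure (density M (\<lambda>_. 1)) A"
      by (simp add: emeasure_density)
  qed simp
  then have "AE x in M. ennreal (r (inv g) (\<phi> g x) * r g x) = 1"
    by (intro density_unique) auto
  then show ?thesis by eventually_elim (simp add: ennreal_eq_1)
qed

text \<open>
  The square root of the density is the weight for which exchanging a point and its image under \<open>g\<close>
  costs nothing. This is the reversibility of the Markov kernel.
\<close>

lemma integral_sqrt_r_swap:
  fixes k :: "'x \<Rightarrow> 'c :: {banach, second_countable_topology}"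
  assumes g: "g \<in> carrier G" and k [measurable]: "k \<in> borel_measurable M"
  shows "(LINT x|M. sqrt (r g x) *\<^sub>R k x) = (LINT x|M. sqrt (r (inv g) x) *\<^sub>R k (\<phi> (inv g) x))"
proof -
  have [measurable]: "\<phi> g \<in> measurable M M" "\<phi> (inv g) \<in> measurable M M"
      "r g \<in> borel_measurable M" "r (inv g) \<in> borel_measurable M"
    using g by (auto intro: action_measurable r_measurable)
  let ?F = "\<lambda>y. sqrt (r (inv g) y) *\<^sub>R k (\<phi> (inv g) y)"
  have "(LINT y|M. ?F y) = (LINT y|M. ?F (\<phi> g (\<phi> (inv g) y)))"
    using g by (intro Bochner_Integration.integral_cong) auto
  also have "\<dots> = (LINT x|distr M M (\<phi> (inv g)). ?F (\<phi> g x))"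
    by (subst integral_distr) auto
  also have "\<dots> = (LINT x|M. r g x *\<^sub>R ?F (\<phi> g x))"
    unfolding density_r[OF g, symmetric]
    by (subst integral_density) (use g in \<open>auto simp: r_nonneg\<close>)
  also have "\<dots> = (LINT x|M. sqrt (r g x) *\<^sub>R k x)"
  proof (rule integral_cong_AE)
    show "AE x in M. r g x *\<^sub>R ?F (\<phi> g x) = sqrt (r g x) *\<^sub>R k x"
      using rn_cocycle[OF g] AE_space
    proof eventually_elim
      case (elim x)
      have "r g x * sqrt (r (inv g) (\<phi> g x)) = sqrt (r g x) * (sqrt (r g x) * sqrt (r (inv g) (\<phi> g x)))"
        using r_nonneg[OF g elim(2)] by (simp add: mult.assoc[symmetric])
      also have "\<dots> = sqrt (r g x)"
        using elim(1) by (simp add: real_sqrt_mult[symmetric] mult.commute)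
      finally show ?case using g elim(2) by simp
    qed
  qed measurable
  finally show ?thesis ..
qed

subsection \<open>Comparison of measures\<close>

lemma nn_integral_action_le:
  assumes s: "s \<in> S" and F [measurable]: "F \<in> borel_measurable M"
  shows "(\<integral>\<^sup>+x. F (\<phi> s x) \<partial>M) \<le> ennreal \<Theta> * (\<integral>\<^sup>+x. F x \<partial>M)"
proof -
  have [measurable]: "\<phi> s \<in> measurable M M" "r s \<in> borel_measurable M"
    using s by (auto intro: action_measurable r_measurable)
  have "(\<integral>\<^sup>+x. F (\<phi> s x) \<partial>M) \<le> (\<integral>\<^sup>+x. ennreal \<Theta> * (ennreal (r s x) * F (\<phi> s x)) \<partial>M)"
  proof (rule nn_integral_mono)
    fix x assume x: "x \<in> space M"
    have "1 \<le> \<Theta> * r s x" using r_bounds[OF s x] \<Theta>_ge_1 by (simp add: divide_le_eq mult.commute)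
    then have "1 \<le> ennreal \<Theta> * ennreal (r s x)"
      using r_nonneg[of s x] s x \<Theta>_ge_1 by (simp add: ennreal_mult[symmetric])
    then show "F (\<phi> s x) \<le> ennreal \<Theta> * (ennreal (r s x) * F (\<phi> s x))"
      using mult_right_mono[of 1 "ennreal \<Theta> * ennreal (r s x)" "F (\<phi> s x)"] by (simp add: mult.assoc)
  qed
  also have "\<dots> = ennreal \<Theta> * (\<integral>\<^sup>+x. F x \<partial>M)"
    using s by (subst nn_integral_cmult) (auto simp: nn_integral_action)
  finally show ?thesis .
qed

lemma integrable_action:
  fixes h :: "'x \<Rightarrow> 'c :: {banach, second_countable_topology}"
  assumes s: "s \<in> S" and h: "integrable M h"
  shows "integrable M (\<lambda>x. h (\<phi> s x))"
proof (rule integrableI_bounded)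
  have [measurable]: "\<phi> s \<in> measurable M M" "h \<in> borel_measurable M"
    using s h by (auto intro: action_measurable)
  show "(\<lambda>x. h (\<phi> s x)) \<in> borel_measurable M" by measurable
  have "(\<integral>\<^sup>+x. ennreal (norm (h (\<phi> s x))) \<partial>M) \<le> ennreal \<Theta> * (\<integral>\<^sup>+x. ennreal (norm (h x)) \<partial>M)"
    using nn_integral_action_le[OF s, of "\<lambda>x. ennreal (norm (h x))"] by simp
  also have "\<dots> < \<infinity>"
    using h by (simp add: integrable_iff_bounded ennreal_mult_less_top)
  finally show "(\<integral>\<^sup>+x. ennreal (norm (h (\<phi> s x))) \<partial>M) < \<infinity>" .
qed

lemma integral_action_le:
  fixes h :: "'x \<Rightarrow> real"
  assumes s: "s \<in> S" and h: "integrable M h" and nn: "\<And>x. x \<in> space M \<Longrightarrow> 0 \<le> h x"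
  shows "(LINT x|M. h (\<phi> s x)) \<le> \<Theta> * (LINT x|M. h x)"
proof -
  have "ennreal (LINT x|M. h (\<phi> s x)) = (\<integral>\<^sup>+x. ennreal (h (\<phi> s x)) \<partial>M)"
    using s by (intro nn_integral_eq_integral[symmetric] integrable_action h) (auto intro!: AE_I2 nn)
  also have "\<dots> \<le> ennreal \<Theta> * (\<integral>\<^sup>+x. ennreal (h x) \<partial>M)"
    using nn_integral_action_le[OF s, of "\<lambda>x. ennreal (h x)"] h by simp
  also have "(\<integral>\<^sup>+x. ennreal (h x) \<partial>M) = ennreal (LINT x|M. h x)"
    using h nn by (intro nn_integral_eq_integral) (auto intro!: AE_I2)
  also have "ennreal \<Theta> * \<dots> = ennreal (\<Theta> * (LINT x|M. h x))"
    using \<Theta>_ge_1 nn by (intro ennreal_mult[symmetric] Bochner_Integration.integral_nonneg) auto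
  finally show ?thesis
    using \<Theta>_ge_1 nn by (subst (asm) ennreal_le_iff) (auto intro!: mult_nonneg_nonneg Bochner_Integration.integral_nonneg)
qed

lemma measure_action_image_le:
  assumes s: "s \<in> S" and A: "A \<in> sets M"
  shows "measure M (\<phi> s ` A) \<le> \<Theta> * measure M A"
proof -
  have s': "inv s \<in> S" using s by (rule inv_S)
  have "measure M (\<phi> s ` A) = (LINT x|M. indicator (\<phi> s ` A) x)"
    using action_image_sets[OF S_in_carrier[OF s] A] by simp
  also have "\<dots> = (LINT x|M. indicator A (\<phi> (inv s) x))"
    using action_image_eq[OF S_in_carrier[OF s] sets.sets_into_space[OF A]]
    by (intro Bochner_Integration.integral_cong) (auto simp: indicator_def)
  also have "\<dots> \<le> \<Theta> * (LINT x|M. indicator A x)"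
    using A by (intro integral_action_le s') (auto simp: less_top[symmetric])
  finally show ?thesis using A by simp
qed

abbreviation "weighted \<equiv> weighted_measure M S r"

definition weight :: "'x \<Rightarrow> real" where
  "weight x = (\<Sum>s\<in>S. sqrt (r s x))"

lemma weighted_eq: "weighted = density M (\<lambda>x. ennreal (weight x))"
  by (simp add: weighted_measure_def weight_def[abs_def])

lemma sets_weighted [simp, measurable_cong]: "sets weighted = sets M"
  by (simp add: weighted_measure_def)

lemma space_weighted [simp]: "space weighted = space M"
  by (simp add: weighted_measure_def)

lemma borel_measurable_weighted [simp]: "borel_measurable weighted = borel_measurable M"
  by (rule measurable_cong_sets) auto

lemma weight_measurable [measurable]: "weight \<in> borel_measurable M"
proof -
  have [measurable]: "r s \<in> borel_measurable M" if "s \<in> S" for s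
    using that by (simp add: r_measurable)
  show ?thesis unfolding weight_def[abs_def] by measurable
qed

lemma sqrt_r_bounds:
  assumes "s \<in> S" "x \<in> space M"
  shows "1 / sqrt \<Theta> \<le> sqrt (r s x)" "sqrt (r s x) \<le> sqrt \<Theta>" "0 \<le> sqrt (r s x)"
proof -
  have "sqrt (1 / \<Theta>) \<le> sqrt (r s x)" using r_bounds[OF assms] by (intro real_sqrt_le_mono) simp
  then show "1 / sqrt \<Theta> \<le> sqrt (r s x)" by (simp add: real_sqrt_divide)
qed (use r_bounds[OF assms] r_nonneg[of s x] assms in auto)

lemma weight_bounds:
  assumes x: "x \<in> space M"
  shows "1 / sqrt \<Theta> \<le> weight x" "weight x \<le> card S * sqrt \<Theta>" "0 < weight x"
proof -
  have "sqrt (r \<one> x) \<le> weight x"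
    unfolding weight_def using x finite_S one_S sqrt_r_bounds(3)
    by (intro member_le_sum) auto
  with sqrt_r_bounds(1)[OF one_S x] show 1: "1 / sqrt \<Theta> \<le> weight x" by simp
  show "weight x \<le> card S * sqrt \<Theta>"
    unfolding weight_def using sqrt_r_bounds(2)[OF _ x] by (rule sum_bounded_above)
  have "0 < 1 / sqrt \<Theta>" using \<Theta>_ge_1 by simp
  then show "0 < weight x" using 1 by linarith
qed

lemma AE_weight_nonneg: "AE x in M. 0 \<le> weight x"
  by (rule AE_I2) (rule less_imp_le[OF weight_bounds(3)])

lemma abs_weight_le: "x \<in> space M \<Longrightarrow> \<bar>weight x\<bar> \<le> card S * sqrt \<Theta>"
  using weight_bounds(2,3)[of x] by (simp add: abs_of_pos)

lemma AE_weighted: "(AE x in weighted. P x) \<longleftrightarrow> (AE x in M. P x)"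
proof -
  have "(AE x in weighted. P x) \<longleftrightarrow> (AE x in M. 0 < ennreal (weight x) \<longrightarrow> P x)"
    unfolding weighted_eq by (rule AE_density) simp
  also have "\<dots> \<longleftrightarrow> (AE x in M. P x)"
    by (rule AE_cong) (simp add: weight_bounds(3))
  finally show ?thesis .
qed

lemma integral_weighted:
  fixes h :: "'x \<Rightarrow> 'c :: {banach, second_countable_topology}"
  assumes "h \<in> borel_measurable M"
  shows "integral\<^sup>L weighted h = (LINT x|M. weight x *\<^sub>R h x)"
  unfolding weighted_eq by (rule integral_density[OF assms weight_measurable AE_weight_nonneg])

lemma integrable_weighted:
  fixes h :: "'x \<Rightarrow> 'c :: {banach, second_countable_topology}"
  assumes h [measurable]: "h \<in> borel_measurable M"
  shows "integrable weighted h \<longleftrightarrow> integrable M h"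
proof -
  have "integrable weighted h \<longleftrightarrow> integrable M (\<lambda>x. weight x *\<^sub>R h x)"
    unfolding weighted_eq by (rule integrable_density[OF h weight_measurable AE_weight_nonneg])
  also have "\<dots> \<longleftrightarrow> integrable M h"
  proof
    assume "integrable M h"
    then show "integrable M (\<lambda>x. weight x *\<^sub>R h x)"
      by (rule integrable_bounded_mult[OF _ weight_measurable abs_weight_le])
  next
    assume *: "integrable M (\<lambda>x. weight x *\<^sub>R h x)"
    have "integrable M (\<lambda>x. (1 / weight x) *\<^sub>R (weight x *\<^sub>R h x))"
    proof (rule integrable_bounded_mult[OF *, where B = "sqrt \<Theta>"])
      fix x assume x: "x \<in> space M"
      show "\<bar>1 / weight x\<bar> \<le> sqrt \<Theta>"
        using weight_bounds[OF x] \<Theta>_ge_1 by (simp add: field_simps)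
    qed measurable
    also have "?this \<longleftrightarrow> integrable M h"
    proof (rule Bochner_Integration.integrable_cong[OF refl])
      fix x assume "x \<in> space M"
      from weight_bounds(3)[OF this] show "(1 / weight x) *\<^sub>R (weight x *\<^sub>R h x) = h x" by simp
    qed
    finally show "integrable M h" .
  qed
  finally show ?thesis .
qed

lemma l2_space_weighted: "l2_space weighted = l2_space M"
proof -
  have "integrable weighted (\<lambda>x. (cmod (f x))\<^sup>2) \<longleftrightarrow> integrable M (\<lambda>x. (cmod (f x))\<^sup>2)"
    if "f \<in> borel_measurable M" for f :: "'x \<Rightarrow> complex"
    using that by (intro integrable_weighted) measurable
  then show ?thesis by (auto simp: l2_space_def)
qed

lemma integral_weighted_bounds:
  fixes h :: "'x \<Rightarrow> real"
  assumes h: "integrable M h" and nn: "\<And>x. x \<in> space M \<Longrightarrow> 0 \<le> h x"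
  shows "(LINT x|M. h x) / sqrt \<Theta> \<le> integral\<^sup>L weighted h"
    and "integral\<^sup>L weighted h \<le> card S * sqrt \<Theta> * (LINT x|M. h x)"
proof -
  have w: "integrable M (\<lambda>x. weight x *\<^sub>R h x)"
    by (rule integrable_bounded_mult[OF h weight_measurable abs_weight_le])
  have eq: "integral\<^sup>L weighted h = (LINT x|M. weight x *\<^sub>R h x)"
    using h by (intro integral_weighted) auto
  have "(LINT x|M. 1 / sqrt \<Theta> * h x) \<le> (LINT x|M. weight x *\<^sub>R h x)"
  proof (rule integral_mono[OF _ w])
    show "integrable M (\<lambda>x. 1 / sqrt \<Theta> * h x)" using h by (rule integrable_mult_right)
    fix x assume x: "x \<in> space M"
    show "1 / sqrt \<Theta> * h x \<le> weight x *\<^sub>R h x"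
      unfolding real_scaleR_def by (rule mult_right_mono[OF weight_bounds(1)[OF x] nn[OF x]])
  qed
  then show "(LINT x|M. h x) / sqrt \<Theta> \<le> integral\<^sup>L weighted h" by (simp add: eq)
  have "(LINT x|M. weight x *\<^sub>R h x) \<le> (LINT x|M. card S * sqrt \<Theta> * h x)"
  proof (rule integral_mono[OF w])
    show "integrable M (\<lambda>x. card S * sqrt \<Theta> * h x)" using h by (rule integrable_mult_right)
    fix x assume x: "x \<in> space M"
    show "weight x *\<^sub>R h x \<le> card S * sqrt \<Theta> * h x"
      unfolding real_scaleR_def by (rule mult_right_mono[OF weight_bounds(2)[OF x] nn[OF x]])
  qed
  then show "integral\<^sup>L weighted h \<le> card S * sqrt \<Theta> * (LINT x|M. h x)" by (simp add: eq)
qed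

section \<open>The Dirichlet form of the Laplacian\<close>

lemma l2_space_action:
  assumes s: "s \<in> S" and f: "f \<in> l2_space M"
  shows "(\<lambda>x. f (\<phi> s x)) \<in> l2_space M"
proof -
  have [measurable]: "\<phi> s \<in> measurable M M" "f \<in> borel_measurable M"
    using s f by (auto intro: action_measurable simp: l2_space_def)
  have "integrable M (\<lambda>x. (cmod (f x))\<^sup>2)" using f by (simp add: l2_space_def)
  from integrable_action[OF s this] show ?thesis by (simp add: l2_space_def)
qed

abbreviation \<Delta> :: "('x \<Rightarrow> complex) \<Rightarrow> 'x \<Rightarrow> complex" where
  "\<Delta> \<equiv> laplacian M \<phi> S r"

lemma laplacian_eq:
  assumes f: "f \<in> borel_measurable M" and x: "x \<in> space M"
  shows "of_real (weight x) * \<Delta> f x = (\<Sum>s\<in>S. of_real (sqrt (r s x)) * (f x - f (\<phi> s x)))"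
proof -
  have "markov_operator M \<phi> S r f x
      = (\<Sum>s\<in>S. of_real (sqrt (r s x)) * f (\<phi> s x)) / of_real (weight x)"
    unfolding weight_def using finite_S f x by (intro markov_operator_eq) (auto simp: r_nonneg)
  then have "of_real (weight x) * markov_operator M \<phi> S r f x
      = (\<Sum>s\<in>S. of_real (sqrt (r s x)) * f (\<phi> s x))"
    using weight_bounds(3)[OF x] by simp
  then show ?thesis
    by (simp add: laplacian_def right_diff_distrib sum_subtractf weight_def sum_distrib_right)
qed

lemma sqrt_r_measurable [measurable]: "s \<in> S \<Longrightarrow> (\<lambda>x. sqrt (r s x)) \<in> borel_measurable M"
  using r_measurable[of s] by simp

lemma laplacian_space:
  assumes f: "f \<in> l2_space M"
  shows "\<Delta> f \<in> l2_space M"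
proof -
  define c where "c s x = sqrt (r s x) / weight x" for s x
  have fm: "f \<in> borel_measurable M" using f by (rule l2_space_measurable)
  let ?h = "\<lambda>x. \<Sum>s\<in>S. complex_of_real (c s x) * (f x - f (\<phi> s x))"
  have "?h \<in> l2_space M"
  proof (intro l2_space_sum l2_space_bounded_mult l2_space_diff f l2_space_action)
    fix s assume s: "s \<in> S"
    then show "c s \<in> borel_measurable M" unfolding c_def by measurable
    fix x assume x: "x \<in> space M"
    have "\<bar>c s x\<bar> = sqrt (r s x) / weight x"
      using sqrt_r_bounds(3)[OF s x] weight_bounds(3)[OF x] by (simp add: c_def)
    also have "\<dots> \<le> sqrt \<Theta> / (1 / sqrt \<Theta>)"
      using sqrt_r_bounds(2,3)[OF s x] weight_bounds(1)[OF x] \<Theta>_ge_1 by (intro frac_le) auto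
    finally show "\<bar>c s x\<bar> \<le> sqrt \<Theta> / (1 / sqrt \<Theta>)" .
  qed
  moreover have "\<Delta> f x = ?h x" if x: "x \<in> space M" for x
  proof -
    have "of_real (weight x) * ?h x = of_real (weight x) * \<Delta> f x"
      unfolding laplacian_eq[OF fm x] sum_distrib_left
      using weight_bounds(3)[OF x] by (intro sum.cong) (auto simp: c_def)
    then show ?thesis using weight_bounds(3)[OF x] by simp
  qed
  ultimately show ?thesis
    by (simp add: l2_space_def cong: measurable_cong Bochner_Integration.integrable_cong)
qed

lemma integrable_form_term:
  assumes s: "s \<in> S" and f: "f \<in> l2_space M" and g: "g \<in> l2_space M"
  shows "integrable M (\<lambda>x. of_real (sqrt (r s x)) * ((f x - f (\<phi> s x)) * cnj (g x)))"
proof -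
  have "(\<lambda>x. complex_of_real (sqrt (r s x)) * (f x - f (\<phi> s x))) \<in> l2_space M"
    using s f sqrt_r_bounds[OF s]
    by (intro l2_space_bounded_mult[where B = "sqrt \<Theta>"] l2_space_diff l2_space_action) auto
  from integrable_l2_inner[OF this g] show ?thesis by (simp add: mult.assoc)
qed

text \<open>
  The weight cancels the normalisation of the kernel. What remains is a sum over \<open>S\<close> that pairs
  differences of \<open>f\<close> with values of \<open>g\<close>; averaging it with its image under the exchange of \<open>x\<close> and
  \<open>s x\<close>, which permutes the summands because \<open>S\<close> is symmetric, produces differences of \<open>g\<close> as well.
  The resulting expression is visibly Hermitian and positive.
\<close>

lemma laplacian_inner:
  assumes f: "f \<in> l2_space M" and g: "g \<in> l2_space M"
  shows "l2_inner weighted (\<Delta> f) g = (1/2) *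
    (\<Sum>s\<in>S. LINT x|M. of_real (sqrt (r s x)) * ((f x - f (\<phi> s x)) * cnj (g x - g (\<phi> s x))))"
proof -
  have fm: "f \<in> borel_measurable M" and [measurable]: "f \<in> borel_measurable M" "g \<in> borel_measurable M"
    using f g by (auto simp: l2_space_def)
  have [measurable]: "\<Delta> f \<in> borel_measurable M" using laplacian_space[OF f] by (simp add: l2_space_def)
  define A where "A s = (LINT x|M. of_real (sqrt (r s x)) * ((f x - f (\<phi> s x)) * cnj (g x)))" for s
  define B where "B s = (LINT x|M. of_real (sqrt (r s x)) * ((f (\<phi> s x) - f x) * cnj (g (\<phi> s x))))" for s
  have "l2_inner weighted (\<Delta> f) g = (LINT x|M. weight x *\<^sub>R (\<Delta> f x * cnj (g x)))"
    unfolding l2_inner_def by (rule integral_weighted) measurable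
  also have "\<dots> = (LINT x|M. (\<Sum>s\<in>S. of_real (sqrt (r s x)) * ((f x - f (\<phi> s x)) * cnj (g x))))"
  proof (rule Bochner_Integration.integral_cong[OF refl])
    fix x assume x: "x \<in> space M"
    show "weight x *\<^sub>R (\<Delta> f x * cnj (g x))
        = (\<Sum>s\<in>S. of_real (sqrt (r s x)) * ((f x - f (\<phi> s x)) * cnj (g x)))"
      using laplacian_eq[OF fm x]
      by (simp add: scaleR_conv_of_real mult.assoc[symmetric] sum_distrib_right)
  qed
  also have "\<dots> = (\<Sum>s\<in>S. A s)"
    unfolding A_def using f g by (intro Bochner_Integration.integral_sum integrable_form_term)
  finally have A: "l2_inner weighted (\<Delta> f) g = (\<Sum>s\<in>S. A s)" .
  have AB: "A s = B (inv s)" if s: "s \<in> S" for s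
  proof -
    have [measurable]: "\<phi> s \<in> measurable M M" using s by (auto intro: action_measurable)
    have "A s = (LINT x|M. sqrt (r s x) *\<^sub>R ((f x - f (\<phi> s x)) * cnj (g x)))"
      by (simp add: A_def scaleR_conv_of_real)
    also have "\<dots> = (LINT x|M. sqrt (r (inv s) x) *\<^sub>R
        ((f (\<phi> (inv s) x) - f (\<phi> s (\<phi> (inv s) x))) * cnj (g (\<phi> (inv s) x))))"
      using s by (intro integral_sqrt_r_swap) auto
    also have "\<dots> = B (inv s)"
      unfolding B_def using s by (intro Bochner_Integration.integral_cong) (auto simp: scaleR_conv_of_real)
    finally show ?thesis .
  qed
  have "bij_betw (\<lambda>s. inv s) S S"
    by (rule bij_betwI[where g = "\<lambda>s. inv s"]) (auto simp: inv_S)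
  then have "(\<Sum>s\<in>S. B (inv s)) = (\<Sum>s\<in>S. B s)"
    by (rule sum.reindex_bij_betw)
  then have "(\<Sum>s\<in>S. A s) = (\<Sum>s\<in>S. B s)" using AB by simp
  then have "l2_inner weighted (\<Delta> f) g = (1/2) * (\<Sum>s\<in>S. A s + B s)"
    by (simp add: A sum.distrib)
  moreover have "A s + B s
      = (LINT x|M. of_real (sqrt (r s x)) * ((f x - f (\<phi> s x)) * cnj (g x - g (\<phi> s x))))"
    if s: "s \<in> S" for s
  proof -
    have "integrable M (\<lambda>x. - (of_real (sqrt (r s x)) * ((f x - f (\<phi> s x)) * cnj (g (\<phi> s x)))))"
    proof -
      have "(\<lambda>x. complex_of_real (sqrt (r s x)) * (f x - f (\<phi> s x))) \<in> l2_space M"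
        using s f sqrt_r_bounds[OF s]
        by (intro l2_space_bounded_mult[where B = "sqrt \<Theta>"] l2_space_diff l2_space_action) auto
      from integrable_l2_inner[OF this l2_space_action[OF s g]] show ?thesis by (simp add: mult.assoc)
    qed
    then have "integrable M (\<lambda>x. of_real (sqrt (r s x)) * ((f (\<phi> s x) - f x) * cnj (g (\<phi> s x))))"
      by (simp add: algebra_simps)
    then show ?thesis
      unfolding A_def B_def using integrable_form_term[OF s f g]
      by (subst Bochner_Integration.integral_add[symmetric]) (auto simp: algebra_simps intro!: Bochner_Integration.integral_cong)
  qed
  ultimately show ?thesis by simp
qed

text \<open>
  The Dirichlet form without its weights. The densities are bounded, so up to constants it carries the
  same information, and it is what the two Cheeger-type estimates use.
\<close>

definition variation :: "('x \<Rightarrow> complex) \<Rightarrow> real" where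
  "variation f = (\<Sum>s\<in>S. LINT x|M. (cmod (f x - f (\<phi> s x)))\<^sup>2)"

lemma laplacian_form:
  assumes f: "f \<in> l2_space M"
  shows "Re (l2_inner weighted (\<Delta> f) f)
    = (1/2) * (\<Sum>s\<in>S. LINT x|M. sqrt (r s x) * (cmod (f x - f (\<phi> s x)))\<^sup>2)"
proof -
  have "l2_inner weighted (\<Delta> f) f
      = (1/2) * (\<Sum>s\<in>S. LINT x|M. complex_of_real (sqrt (r s x) * (cmod (f x - f (\<phi> s x)))\<^sup>2))"
    unfolding laplacian_inner[OF f f] complex_norm_square[symmetric] by simp
  also have "\<dots> = of_real ((1/2) * (\<Sum>s\<in>S. LINT x|M. sqrt (r s x) * (cmod (f x - f (\<phi> s x)))\<^sup>2))"
    unfolding integral_complex_of_real by simp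
  finally show ?thesis by (simp only: Re_complex_of_real)
qed

lemma integrable_difference:
  assumes "s \<in> S" "f \<in> l2_space M"
  shows "integrable M (\<lambda>x. (cmod (f x - f (\<phi> s x)))\<^sup>2)"
  using l2_space_diff[OF assms(2) l2_space_action[OF assms]] by (simp add: l2_space_def)

lemma laplacian_form_bounds:
  assumes f: "f \<in> l2_space M"
  shows "variation f \<le> 2 * sqrt \<Theta> * Re (l2_inner weighted (\<Delta> f) f)"
    and "2 * Re (l2_inner weighted (\<Delta> f) f) \<le> sqrt \<Theta> * variation f"
proof -
  have int: "integrable M (\<lambda>x. sqrt (r s x) * (cmod (f x - f (\<phi> s x)))\<^sup>2)" if s: "s \<in> S" for s
    using integrable_bounded_mult[OF integrable_difference[OF s f] sqrt_r_measurable[OF s], of "sqrt \<Theta>"]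
      sqrt_r_bounds[OF s] by simp
  have "(LINT x|M. (cmod (f x - f (\<phi> s x)))\<^sup>2)
      \<le> sqrt \<Theta> * (LINT x|M. sqrt (r s x) * (cmod (f x - f (\<phi> s x)))\<^sup>2)" if s: "s \<in> S" for s
    unfolding integral_mult_right_zero[symmetric]
  proof (intro integral_mono integrable_difference f s integrable_mult_right int)
    fix x assume x: "x \<in> space M"
    have "1 \<le> sqrt \<Theta> * sqrt (r s x)"
      using sqrt_r_bounds(1)[OF s x] \<Theta>_ge_1 by (simp add: divide_le_eq mult.commute)
    then show "(cmod (f x - f (\<phi> s x)))\<^sup>2 \<le> sqrt \<Theta> * (sqrt (r s x) * (cmod (f x - f (\<phi> s x)))\<^sup>2)"
      using mult_right_mono[of 1 "sqrt \<Theta> * sqrt (r s x)" "(cmod (f x - f (\<phi> s x)))\<^sup>2"]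
      by (simp add: mult.assoc)
  qed
  then have "variation f \<le> (\<Sum>s\<in>S. sqrt \<Theta> * (LINT x|M. sqrt (r s x) * (cmod (f x - f (\<phi> s x)))\<^sup>2))"
    unfolding variation_def by (rule sum_mono)
  then show "variation f \<le> 2 * sqrt \<Theta> * Re (l2_inner weighted (\<Delta> f) f)"
    unfolding laplacian_form[OF f] by (simp add: sum_distrib_left)
  have "(LINT x|M. sqrt (r s x) * (cmod (f x - f (\<phi> s x)))\<^sup>2)
      \<le> sqrt \<Theta> * (LINT x|M. (cmod (f x - f (\<phi> s x)))\<^sup>2)" if s: "s \<in> S" for s
    unfolding integral_mult_right_zero[symmetric]
    by (intro integral_mono integrable_difference f s integrable_mult_right int mult_right_mono
        sqrt_r_bounds(2)) auto
  then have "(\<Sum>s\<in>S. LINT x|M. sqrt (r s x) * (cmod (f x - f (\<phi> s x)))\<^sup>2)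
      \<le> (\<Sum>s\<in>S. sqrt \<Theta> * (LINT x|M. (cmod (f x - f (\<phi> s x)))\<^sup>2))"
    by (rule sum_mono)
  then show "2 * Re (l2_inner weighted (\<Delta> f) f) \<le> sqrt \<Theta> * variation f"
    unfolding laplacian_form[OF f] variation_def by (simp add: sum_distrib_left)
qed

lemma card_S_pos: "0 < card S"
  using finite_S one_S card_gt_0_iff by blast

lemma variation_le:
  assumes f: "f \<in> l2_space M"
  shows "variation f \<le> card S * (2 * (1 + \<Theta>)) * (LINT x|M. (cmod (f x))\<^sup>2)"
proof -
  have int: "integrable M (\<lambda>x. (cmod (f x))\<^sup>2)" using f by (simp add: l2_space_def)
  have "(LINT x|M. (cmod (f x - f (\<phi> s x)))\<^sup>2) \<le> 2 * (1 + \<Theta>) * (LINT x|M. (cmod (f x))\<^sup>2)"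
    if s: "s \<in> S" for s
  proof -
    have int': "integrable M (\<lambda>x. (cmod (f (\<phi> s x)))\<^sup>2)" by (rule integrable_action[OF s int])
    have "(LINT x|M. (cmod (f x - f (\<phi> s x)))\<^sup>2)
        \<le> (LINT x|M. 2 * (cmod (f x))\<^sup>2 + 2 * (cmod (f (\<phi> s x)))\<^sup>2)"
    proof (rule integral_mono[OF integrable_difference[OF s f]])
      show "integrable M (\<lambda>x. 2 * (cmod (f x))\<^sup>2 + 2 * (cmod (f (\<phi> s x)))\<^sup>2)"
        using int int' by simp
      fix x
      have "(cmod (f x - f (\<phi> s x)))\<^sup>2 \<le> (cmod (f x) + cmod (f (\<phi> s x)))\<^sup>2"
        by (intro power_mono norm_triangle_ineq4) auto
      then show "(cmod (f x - f (\<phi> s x)))\<^sup>2 \<le> 2 * (cmod (f x))\<^sup>2 + 2 * (cmod (f (\<phi> s x)))\<^sup>2"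
        using sum_squares_bound[of "cmod (f x)" "cmod (f (\<phi> s x))"] by (simp add: power2_sum)
    qed
    also have "\<dots> = 2 * (LINT x|M. (cmod (f x))\<^sup>2) + 2 * (LINT x|M. (cmod (f (\<phi> s x)))\<^sup>2)"
      using int int' by simp
    also have "\<dots> \<le> 2 * (LINT x|M. (cmod (f x))\<^sup>2) + 2 * (\<Theta> * (LINT x|M. (cmod (f x))\<^sup>2))"
      using integral_action_le[OF s int] by simp
    finally show ?thesis by (simp add: algebra_simps)
  qed
  then have "variation f \<le> (\<Sum>s\<in>S. 2 * (1 + \<Theta>) * (LINT x|M. (cmod (f x))\<^sup>2))"
    unfolding variation_def by (rule sum_mono)
  then show ?thesis by simp
qed

lemma l2_norm_weighted_bounds:
  assumes f: "f \<in> l2_space M"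
  shows "(LINT x|M. (cmod (f x))\<^sup>2) / sqrt \<Theta> \<le> (l2_norm weighted f)\<^sup>2"
    and "(l2_norm weighted f)\<^sup>2 \<le> card S * sqrt \<Theta> * (LINT x|M. (cmod (f x))\<^sup>2)"
  unfolding l2_norm_square using f
  by (intro integral_weighted_bounds; simp add: l2_space_def)+

sublocale laplacian: l2_positive_operator weighted \<Delta> "card S * (1 + \<Theta>) * \<Theta>"
proof
  fix f g assume "f \<in> l2_space weighted" "g \<in> l2_space weighted"
  then have f: "f \<in> l2_space M" and g: "g \<in> l2_space M" by (auto simp: l2_space_weighted)
  show "\<Delta> f \<in> l2_space weighted" using laplacian_space[OF f] by (simp add: l2_space_weighted)
  have "l2_inner weighted (\<Delta> f) g = cnj (l2_inner weighted (\<Delta> g) f)"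
    unfolding laplacian_inner[OF f g] laplacian_inner[OF g f]
    by (simp add: Bochner_Integration.integral_cnj[symmetric] mult.commute
        del: Bochner_Integration.integral_cnj)
  then show "l2_inner weighted (\<Delta> f) g = l2_inner weighted f (\<Delta> g)"
    by (simp add: l2_inner_commute[of weighted f])
  show "0 \<le> Re (l2_inner weighted (\<Delta> f) f)"
    unfolding laplacian_form[OF f]
    by (intro mult_nonneg_nonneg sum_nonneg Bochner_Integration.integral_nonneg sqrt_r_bounds(3)) auto
  have I: "0 \<le> (LINT x|M. (cmod (f x))\<^sup>2)" by simp
  have "2 * Re (l2_inner weighted (\<Delta> f) f) \<le> sqrt \<Theta> * variation f"
    by (rule laplacian_form_bounds(2)[OF f])
  also have "\<dots> \<le> sqrt \<Theta> * (card S * (2 * (1 + \<Theta>)) * (LINT x|M. (cmod (f x))\<^sup>2))"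
    using variation_le[OF f] \<Theta>_ge_1 by (intro mult_left_mono) auto
  also have "\<dots> = card S * (2 * (1 + \<Theta>)) * (sqrt \<Theta> * (LINT x|M. (cmod (f x))\<^sup>2))"
    by simp
  also have "\<dots> \<le> card S * (2 * (1 + \<Theta>)) * (\<Theta> * (l2_norm weighted f)\<^sup>2)"
  proof (rule mult_left_mono)
    have "sqrt \<Theta> * (LINT x|M. (cmod (f x))\<^sup>2) = \<Theta> * ((LINT x|M. (cmod (f x))\<^sup>2) / sqrt \<Theta>)"
      using \<Theta>_ge_1 real_div_sqrt[of \<Theta>] by (simp add: field_simps)
    also have "\<dots> \<le> \<Theta> * (l2_norm weighted f)\<^sup>2"
      using l2_norm_weighted_bounds(1)[OF f] \<Theta>_ge_1 by (intro mult_left_mono) auto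
    finally show "sqrt \<Theta> * (LINT x|M. (cmod (f x))\<^sup>2) \<le> \<Theta> * (l2_norm weighted f)\<^sup>2" .
  qed (use \<Theta>_ge_1 in auto)
  finally show "Re (l2_inner weighted (\<Delta> f) f)
      \<le> card S * (1 + \<Theta>) * \<Theta> * (l2_norm weighted f)\<^sup>2"
    by (simp add: algebra_simps)
qed (use \<Theta>_ge_1 card_S_pos in auto)

lemma laplacian_one: "x \<in> space M \<Longrightarrow> \<Delta> (\<lambda>_. 1) x = 0"
  using laplacian_eq[of "\<lambda>_. 1" x] weight_bounds(3)[of x] by simp

lemma const_l2_space: "(\<lambda>_. c) \<in> l2_space M"
  by (simp add: l2_space_def)

lemma l2_norm_one_pos: "0 < l2_norm weighted (\<lambda>_. 1)"
proof -
  have "0 < 1 / sqrt \<Theta>" using \<Theta>_ge_1 by simp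
  also have "\<dots> \<le> (l2_norm weighted (\<lambda>_. 1))\<^sup>2"
    using l2_norm_weighted_bounds(1)[OF const_l2_space, of 1] by (simp add: prob_space)
  finally show ?thesis by (metis l2_norm_nonneg less_le power_zero_numeral less_irrefl)
qed

theorem spectrum_iff_gap:
  "0 isolated_in l2_spectrum weighted \<Delta> \<and> l2_has_multiplicity weighted \<Delta> 0 1 \<longleftrightarrow>
    (\<exists>\<kappa>>0. \<forall>f\<in>l2_space M. integral\<^sup>L weighted f = 0 \<longrightarrow>
      \<kappa> * (l2_norm weighted f)\<^sup>2 \<le> Re (l2_inner weighted (\<Delta> f) f))"
proof -
  have "AE x in weighted. \<Delta> (\<lambda>_. 1) x = 0"
    using laplacian_one by (simp add: AE_weighted)
  from laplacian.isolated_simple_iff_gap[OF _ this] show ?thesis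
    using l2_norm_one_pos const_l2_space by (simp add: l2_space_weighted l2_inner_def)
qed

section \<open>Expansion by the generating set\<close>

definition outer_boundary :: "'x set \<Rightarrow> 'x set" where
  "outer_boundary A = (\<Union>s\<in>S. \<phi> s ` A) - A"

lemma outer_boundary_sets [measurable]: "A \<in> sets M \<Longrightarrow> outer_boundary A \<in> sets M"
  unfolding outer_boundary_def using finite_S
  by (intro sets.Diff sets.finite_UN action_image_sets) auto

lemma action_compose_image:
  assumes "g \<in> carrier G" "h \<in> carrier G" "A \<subseteq> space M"
  shows "\<phi> (g \<otimes> h) ` A = \<phi> g ` (\<phi> h ` A)"
  using assms composition_rule by (force simp: image_image intro!: image_cong)

text \<open>
  Writing \<open>g h A - A\<close> as a subset of \<open>g (h A - A) \<union> (g A - A)\<close> reduces the displacement by a word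
  in the generators to the displacements by its letters, at the cost of the density bounds. The
  bound on \<open>\<nu>(g A)\<close> has to be carried along in the induction.
\<close>

lemma displacement_le_outer_boundary:
  assumes "g \<in> carrier G"
  shows "\<exists>C\<ge>0. \<forall>A\<in>sets M. measure M (\<phi> g ` A) \<le> C * measure M A \<and>
    measure M (\<phi> g ` A - A) \<le> C * measure M (outer_boundary A)"
proof -
  have letter: "\<exists>C\<ge>0. \<forall>A\<in>sets M. measure M (\<phi> s ` A) \<le> C * measure M A \<and>
      measure M (\<phi> s ` A - A) \<le> C * measure M (outer_boundary A)" if s: "s \<in> S" for s
  proof (intro exI[of _ \<Theta>] conjI ballI)
    fix A assume A: "A \<in> sets M"
    show "measure M (\<phi> s ` A) \<le> \<Theta> * measure M A" by (rule measure_action_image_le[OF s A])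
    have "measure M (\<phi> s ` A - A) \<le> measure M (outer_boundary A)"
      using s A by (intro finite_measure_mono outer_boundary_sets) (auto simp: outer_boundary_def)
    also have "\<dots> \<le> \<Theta> * measure M (outer_boundary A)"
      using mult_right_mono[OF \<Theta>_ge_1 measure_nonneg[of M "outer_boundary A"]] by simp
    finally show "measure M (\<phi> s ` A - A) \<le> \<Theta> * measure M (outer_boundary A)" .
  qed (use \<Theta>_ge_1 in simp)
  from assms have "g \<in> generate G S" by (simp add: generate_S)
  then show ?thesis
  proof induction
    case one
    have "\<phi> \<one> ` A = A" if "A \<in> sets M" for A
    proof -
      have "\<phi> \<one> x = x" if "x \<in> A" for x
        using that sets.sets_into_space[OF \<open>A \<in> sets M\<close>] by (auto simp: id_eq_one[symmetric])
      then show ?thesis by simp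
    qed
    then show ?case by (intro exI[of _ 1]) simp
  next
    case (incl h)
    then show ?case by (rule letter)
  next
    case (inv h)
    then show ?case by (intro letter inv_S)
  next
    case (eng g h)
    have g: "g \<in> carrier G" and h: "h \<in> carrier G" using eng by (auto simp: generate_S)
    obtain C where C: "0 \<le> C" "\<And>A. A \<in> sets M \<Longrightarrow> measure M (\<phi> g ` A) \<le> C * measure M A"
      "\<And>A. A \<in> sets M \<Longrightarrow> measure M (\<phi> g ` A - A) \<le> C * measure M (outer_boundary A)"
      using eng.IH(1) by blast
    obtain D where D: "0 \<le> D" "\<And>A. A \<in> sets M \<Longrightarrow> measure M (\<phi> h ` A) \<le> D * measure M A"
      "\<And>A. A \<in> sets M \<Longrightarrow> measure M (\<phi> h ` A - A) \<le> D * measure M (outer_boundary A)"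
      using eng.IH(2) by blast
    show ?case
    proof (intro exI[of _ "C * D + C"] conjI ballI)
      fix A assume A: "A \<in> sets M"
      have comp: "\<phi> (g \<otimes> h) ` A = \<phi> g ` (\<phi> h ` A)"
        by (rule action_compose_image[OF g h sets.sets_into_space[OF A]])
      have hA: "\<phi> h ` A \<in> sets M" "\<phi> h ` A - A \<in> sets M" "\<phi> g ` A \<in> sets M"
        using A g h by (auto intro: action_image_sets)
      have "measure M (\<phi> g ` (\<phi> h ` A)) \<le> C * (D * measure M A)"
        using C(2)[OF hA(1)] mult_left_mono[OF D(2)[OF A] C(1)] by linarith
      also have "\<dots> \<le> (C * D + C) * measure M A" using C(1) by (simp add: algebra_simps)
      finally show "measure M (\<phi> (g \<otimes> h) ` A) \<le> (C * D + C) * measure M A" by (simp add: comp)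
      have "measure M (\<phi> g ` (\<phi> h ` A) - A)
          \<le> measure M (\<phi> g ` (\<phi> h ` A - A) \<union> (\<phi> g ` A - A))"
        using A g h hA by (intro finite_measure_mono sets.Un sets.Diff action_image_sets) auto
      also have "\<dots> \<le> measure M (\<phi> g ` (\<phi> h ` A - A)) + measure M (\<phi> g ` A - A)"
        using A g h hA by (intro measure_Un_le sets.Diff action_image_sets)
      also have "\<dots> \<le> C * (D * measure M (outer_boundary A)) + C * measure M (outer_boundary A)"
        using C(2)[OF hA(2)] mult_left_mono[OF D(3)[OF A] C(1)] C(3)[OF A] by linarith
      finally show "measure M (\<phi> (g \<otimes> h) ` A - A) \<le> (C * D + C) * measure M (outer_boundary A)"
        by (simp add: comp algebra_simps)
    qed (use C(1) D(1) in simp)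
  qed
qed

lemma expanding_by_generators:
  assumes "expanding_in_measure G M \<phi>"
  obtains c where "0 < c"
    "\<And>A. A \<in> sets M \<Longrightarrow> measure M A \<le> 1 / 2 \<Longrightarrow> c * measure M A \<le> measure M (outer_boundary A)"
proof -
  obtain c S' where c: "0 < c" and S': "finite S'" "S' \<subseteq> carrier G"
    and exp: "\<And>A. A \<in> sets M \<Longrightarrow> 0 < measure M A \<Longrightarrow> measure M A \<le> 1 / 2 \<Longrightarrow>
        c * measure M A < measure M ((\<Union>s\<in>S'. \<phi> s ` A) - A)"
    using assms unfolding expanding_in_measure_def by blast
  have "\<forall>g\<in>S'. \<exists>C\<ge>0. \<forall>A\<in>sets M. measure M (\<phi> g ` A - A) \<le> C * measure M (outer_boundary A)"
    using displacement_le_outer_boundary S'(2) by blast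
  then obtain C where C: "\<And>g. g \<in> S' \<Longrightarrow> 0 \<le> C g"
    "\<And>g A. g \<in> S' \<Longrightarrow> A \<in> sets M \<Longrightarrow> measure M (\<phi> g ` A - A) \<le> C g * measure M (outer_boundary A)"
    by metis
  \<comment> \<open>The summand \<open>1\<close> keeps \<open>D\<close> positive even if all the constants vanish.\<close>
  define D where "D = (\<Sum>g\<in>S'. C g) + 1"
  have D: "0 < D" unfolding D_def using C(1) by (intro add_nonneg_pos sum_nonneg) auto
  show ?thesis
  proof (rule that[of "c / D"])
    show "0 < c / D" using c D by simp
    fix A assume A: "A \<in> sets M" "measure M A \<le> 1 / 2"
    show "c / D * measure M A \<le> measure M (outer_boundary A)"
    proof (cases "measure M A = 0")
      case False
      then have "c * measure M A \<le> measure M ((\<Union>s\<in>S'. \<phi> s ` A) - A)"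
        using exp[OF A(1)] A(2) by (simp add: less_le)
      also have "(\<Union>s\<in>S'. \<phi> s ` A) - A = (\<Union>s\<in>S'. \<phi> s ` A - A)" by blast
      also have "measure M \<dots> \<le> (\<Sum>s\<in>S'. measure M (\<phi> s ` A - A))"
        using S' A by (intro measure_UNION_le) (auto intro!: action_image_sets)
      also have "\<dots> \<le> (\<Sum>s\<in>S'. C s * measure M (outer_boundary A))"
        using C(2) A by (intro sum_mono) auto
      also have "\<dots> \<le> D * measure M (outer_boundary A)"
        by (simp add: D_def sum_distrib_right[symmetric] algebra_simps)
      finally show ?thesis using D by (simp add: pos_divide_le_eq mult.commute)
    qed simp
  qed
qed

section \<open>A spectral gap implies expansion\<close>

text \<open>
  The gap is applied to the indicator function of \<open>A\<close> minus its mean \<open>p\<close>. Its variation lives where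
  \<open>x\<close> or \<open>s x\<close> lies in the outer boundary. Its \<open>L\<^sup>2\<close> norm is comparable to the measure of \<open>A\<close>: for every
  real \<open>p\<close>, a set of measure at most \<open>1/2\<close> satisfies
  \<open>\<integral> (1\<^sub>A - p)\<^sup>2 \<ge> \<nu>(A) ((1 - p)\<^sup>2 + p\<^sup>2) \<ge> \<nu>(A)/2\<close>.
\<close>

lemma expanding_of_gap:
  assumes \<kappa>: "0 < \<kappa>"
    and gap: "\<And>f. f \<in> l2_space M \<Longrightarrow> integral\<^sup>L weighted f = 0 \<Longrightarrow>
      \<kappa> * (l2_norm weighted f)\<^sup>2 \<le> Re (l2_inner weighted (\<Delta> f) f)"
  shows "expanding_in_measure G M \<phi>"
proof -
  let ?n = "measure weighted (space M)"
  interpret weighted: finite_measure weighted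
  proof
    have "integrable weighted (\<lambda>_. 1 :: real)" by (subst integrable_weighted) auto
    then show "emeasure weighted (space weighted) \<noteq> \<infinity>" by (simp add: integrable_iff_bounded less_top)
  qed
  have n: "0 < ?n"
    using l2_norm_one_pos zero_less_power[of "l2_norm weighted (\<lambda>_. 1)" 2] by (simp add: l2_norm_square)
  define b where "b = sqrt \<Theta> * card S * (1 + \<Theta>)"
  have b: "0 < b" using \<Theta>_ge_1 card_S_pos by (simp add: b_def)
  have main: "\<kappa> / sqrt \<Theta> * measure M A \<le> b * measure M (outer_boundary A)"
    if A: "A \<in> sets M" "measure M A \<le> 1 / 2" for A
  proof -
    note [measurable] = A(1)
    define p where "p = measure weighted A / ?n"
    define f where "f x = complex_of_real (indicator A x - p)" for x
    have f_bound: "cmod (f x) \<le> 1 + \<bar>p\<bar>" for x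
      unfolding f_def norm_of_real by (auto simp: indicator_def)
    have fm [measurable]: "f \<in> borel_measurable M" unfolding f_def by measurable
    have f: "f \<in> l2_space M"
    proof -
      have "integrable M (\<lambda>x. (cmod (f x))\<^sup>2)"
        using power_mono[OF f_bound norm_ge_zero, of _ 2]
        by (intro integrable_const_bound[where B = "(1 + \<bar>p\<bar>)\<^sup>2"]) auto
      then show ?thesis by (simp add: l2_space_def)
    qed
    have "integral\<^sup>L weighted f = of_real (LINT x|weighted. indicator A x - p)"
      unfolding f_def by (rule integral_complex_of_real)
    also have "(LINT x|weighted. indicator A x - p) = measure weighted A - p * ?n"
      by (subst Bochner_Integration.integral_diff) (auto simp: weighted.emeasure_eq_measure)
    also have "\<dots> = 0" using n by (simp add: p_def)
    finally have mean: "integral\<^sup>L weighted f = 0" by simp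
    have "(LINT x|M. (cmod (f x))\<^sup>2) = (LINT x|M. (1 - 2 * p) * indicator A x + p\<^sup>2)"
      unfolding f_def norm_of_real
      by (intro Bochner_Integration.integral_cong)
         (auto simp: indicator_def power2_eq_square algebra_simps)
    also have "\<dots> = (1 - 2 * p) * measure M A + p\<^sup>2"
      by (subst Bochner_Integration.integral_add) (auto simp: prob_space emeasure_eq_measure)
    also have "\<dots> \<ge> measure M A / 2"
    proof -
      have "2 * p\<^sup>2 * measure M A \<le> p\<^sup>2"
        using mult_left_mono[OF A(2), of "2 * p\<^sup>2"] by simp
      moreover have "measure M A * (1 / 2) \<le> measure M A * (1 - 2 * p + 2 * p\<^sup>2)"
      proof (rule mult_left_mono)
        have "0 \<le> (2 * p - 1)\<^sup>2" by simp
        then show "1 / 2 \<le> 1 - 2 * p + 2 * p\<^sup>2" by (simp add: power2_eq_square algebra_simps)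
      qed simp
      ultimately show ?thesis by (simp add: algebra_simps)
    qed
    finally have low: "measure M A / 2 \<le> (LINT x|M. (cmod (f x))\<^sup>2)" .
    have "(LINT x|M. (cmod (f x - f (\<phi> s x)))\<^sup>2) \<le> (1 + \<Theta>) * measure M (outer_boundary A)"
      if s: "s \<in> S" for s
    proof -
      have ob [measurable]: "outer_boundary A \<in> sets M" using A by measurable
      have int: "integrable M (\<lambda>x. indicator (outer_boundary A) x :: real)"
        by (auto simp: emeasure_eq_measure)
      note int' = integrable_action[OF s int]
      have "(LINT x|M. (cmod (f x - f (\<phi> s x)))\<^sup>2)
          \<le> (LINT x|M. indicator (outer_boundary A) x + indicator (outer_boundary A) (\<phi> s x))"
      proof (rule integral_mono[OF integrable_difference[OF s f] Bochner_Integration.integrable_add[OF int int']])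
        fix x assume x: "x \<in> space M"
        have "(cmod (f x - f (\<phi> s x)))\<^sup>2 = (indicator A x - indicator A (\<phi> s x))\<^sup>2"
          unfolding f_def of_real_diff[symmetric] norm_of_real by simp
        moreover have "x \<in> outer_boundary A" if "x \<notin> A" "\<phi> s x \<in> A"
        proof -
          have "x = \<phi> (inv s) (\<phi> s x)" using s x by simp
          then show ?thesis using that inv_S[OF s] unfolding outer_boundary_def by blast
        qed
        moreover have "\<phi> s x \<in> outer_boundary A" if "x \<in> A" "\<phi> s x \<notin> A"
          using that s unfolding outer_boundary_def by blast
        ultimately show "(cmod (f x - f (\<phi> s x)))\<^sup>2
            \<le> indicator (outer_boundary A) x + indicator (outer_boundary A) (\<phi> s x)"
          by (cases "x \<in> A"; cases "\<phi> s x \<in> A") auto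
      qed
      also have "\<dots> = (LINT x|M. indicator (outer_boundary A) x)
          + (LINT x|M. indicator (outer_boundary A) (\<phi> s x))"
        by (rule Bochner_Integration.integral_add[OF int int'])
      also have "\<dots> \<le> measure M (outer_boundary A) + \<Theta> * measure M (outer_boundary A)"
        using integral_action_le[OF s int] ob by simp
      finally show ?thesis by (simp add: algebra_simps)
    qed
    then have "variation f \<le> (\<Sum>s\<in>S. (1 + \<Theta>) * measure M (outer_boundary A))"
      unfolding variation_def by (rule sum_mono)
    then have var: "variation f \<le> card S * (1 + \<Theta>) * measure M (outer_boundary A)" by simp
    have "\<kappa> * (measure M A / 2 / sqrt \<Theta>) \<le> \<kappa> * (l2_norm weighted f)\<^sup>2"
      using \<kappa> low \<Theta>_ge_1 l2_norm_weighted_bounds(1)[OF f]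
      by (intro mult_left_mono order_trans[OF divide_right_mono[OF low]]) auto
    also have "\<dots> \<le> Re (l2_inner weighted (\<Delta> f) f)" by (rule gap[OF f mean])
    finally have "\<kappa> * (measure M A / sqrt \<Theta>) \<le> 2 * Re (l2_inner weighted (\<Delta> f) f)" by simp
    also have "\<dots> \<le> sqrt \<Theta> * variation f" by (rule laplacian_form_bounds(2)[OF f])
    also have "\<dots> \<le> b * measure M (outer_boundary A)"
      using mult_left_mono[OF var, of "sqrt \<Theta>"] \<Theta>_ge_1 by (simp add: b_def mult_ac)
    finally show ?thesis by simp
  qed
  \<comment> \<open>Half of the constant just obtained, because expansion asks for a strict inequality.\<close>
  define c where "c = \<kappa> / sqrt \<Theta> / b / 2"
  have c: "0 < c" using \<kappa> \<Theta>_ge_1 b by (simp add: c_def)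
  show ?thesis
    unfolding expanding_in_measure_def
  proof (intro exI[of _ c] exI[of _ S] conjI ballI impI)
    fix A assume A: "A \<in> sets M" and pos: "0 < measure M A \<and> measure M A \<le> 1 / 2"
    have "2 * c * measure M A = \<kappa> / sqrt \<Theta> * measure M A / b" by (simp add: c_def)
    also have "\<dots> \<le> measure M (outer_boundary A)"
      using main[OF A] pos b by (subst pos_divide_le_eq) (auto simp: mult.commute[of b])
    finally have "2 * c * measure M A \<le> measure M (outer_boundary A)" .
    moreover have "0 < c * measure M A" using c pos by simp
    ultimately show "c * measure M A < measure M ((\<Union>s\<in>S. \<phi> s ` A) - A)"
      unfolding outer_boundary_def by linarith
  qed (use c finite_S S_carrier in auto)
qed

end

section \<open>Expansion implies a spectral gap\<close>

lemma (in prob_space) median_exists: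
  assumes f [measurable]: "f \<in> borel_measurable M"
  shows "\<exists>m::real. prob {x\<in>space M. m < f x} \<le> 1 / 2 \<and> prob {x\<in>space M. f x < m} \<le> 1 / 2"
proof -
  let ?D = "distr M borel f"
  interpret D: real_distribution ?D by (rule real_distribution_distr) simp
  define U where "U = {t. 1 / 2 \<le> cdf ?D t}"
  have "\<forall>\<^sub>F t in at_top. 1 / 2 < cdf ?D t"
    using D.cdf_lim_at_top_prob by (rule order_tendstoD) simp
  then obtain t0 where "1 / 2 < cdf ?D t0" by (auto simp: eventually_at_top_linorder)
  then have "t0 \<in> U" by (simp add: U_def)
  then have U_ne: "U \<noteq> {}" by blast
  have "\<forall>\<^sub>F t in at_bot. cdf ?D t < 1 / 2"
    using D.cdf_lim_at_bot by (rule order_tendstoD) simp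
  then obtain t1 where t1: "\<And>t. t \<le> t1 \<Longrightarrow> cdf ?D t < 1 / 2" by (auto simp: eventually_at_bot_linorder)
  have bdd: "bdd_below U"
  proof (rule bdd_belowI)
    fix t assume "t \<in> U"
    then show "t1 \<le> t" using t1[of t] by (cases "t \<le> t1") (auto simp: U_def)
  qed
  define m where "m = Inf U"
  have above: "1 / 2 \<le> cdf ?D t" if lt: "m < t" for t
  proof -
    obtain u where "u \<in> U" "u < t" using cInf_lessD[OF U_ne lt[unfolded m_def]] by blast
    then show ?thesis using D.cdf_nondecreasing[of u t] by (simp add: U_def)
  qed
  have below: "cdf ?D t \<le> 1 / 2" if "t < m" for t
  proof -
    have "t \<notin> U" using cInf_lower[OF _ bdd, of t] that unfolding m_def by auto
    then show ?thesis by (simp add: U_def)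
  qed
  have "((cdf ?D) \<longlongrightarrow> cdf ?D m) (at_right m)"
    using D.cdf_is_right_cont[of m] by (simp add: continuous_within)
  then have "1 / 2 \<le> cdf ?D m"
    by (rule tendsto_lowerbound) (use above in \<open>auto intro!: eventually_at_rightI[of m "m + 1"]\<close>)
  moreover have "cdf ?D m = prob {x\<in>space M. f x \<le> m}"
    by (simp add: cdf_def measure_distr vimage_def Int_def conj_commute)
  moreover have "prob {x\<in>space M. m < f x} = 1 - prob {x\<in>space M. f x \<le> m}"
    by (subst prob_compl[symmetric]) (auto intro!: arg_cong[where f = prob])
  moreover have "prob {x\<in>space M. f x < m} \<le> 1 / 2"
  proof -
    have "((cdf ?D) \<longlongrightarrow> measure ?D {..<m}) (at_left m)" by (rule D.cdf_at_left)
    then have "measure ?D {..<m} \<le> 1 / 2"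
      by (rule tendsto_upperbound) (use below in \<open>auto intro!: eventually_at_leftI[of "m - 1" m]\<close>)
    then show ?thesis by (simp add: measure_distr vimage_def Int_def conj_commute)
  qed
  ultimately show ?thesis by (intro exI[of _ m]) simp
qed

context bounded_rn_action
begin

text \<open>
  Integrating the expansion inequality over all superlevel sets of \<open>g\<close> (the coarea formula)
  turns it into an \<open>L\<^sup>1\<close> inequality for functions.
\<close>

lemma coarea_expansion:
  fixes g :: "'x \<Rightarrow> real"
  assumes c: "0 \<le> c"
    and exp: "\<And>A. A \<in> sets M \<Longrightarrow> measure M A \<le> 1 / 2 \<Longrightarrow> c * measure M A \<le> measure M (outer_boundary A)"
    and g [measurable]: "g \<in> borel_measurable M" and g_nonneg: "\<And>x. 0 \<le> g x"
    and half: "measure M {x\<in>space M. 0 < g x} \<le> 1 / 2"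
  shows "ennreal c * (\<integral>\<^sup>+x. ennreal (g x) \<partial>M) \<le> (\<Sum>s\<in>S. \<integral>\<^sup>+x. ennreal (g (\<phi> s x) - g x) \<partial>M)"
proof -
  interpret P: pair_sigma_finite M lborel ..
  have act [measurable]: "\<phi> s \<in> measurable M M" if "s \<in> S" for s using that by (auto intro: action_measurable)
  have length: "(\<integral>\<^sup>+t. indicator {u..<v} t \<partial>lborel) = ennreal (v - u)" for u v :: real
    by (cases "u \<le> v") (auto simp: ennreal_neg)
  have layer: "(\<integral>\<^sup>+x. ennreal (v x - u x) \<partial>M)
      = (\<integral>\<^sup>+t. emeasure M {x\<in>space M. u x \<le> t \<and> t < v x} \<partial>lborel)"
    if [measurable]: "u \<in> borel_measurable M" "v \<in> borel_measurable M" for u v :: "'x \<Rightarrow> real"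
  proof -
    have "(\<integral>\<^sup>+x. ennreal (v x - u x) \<partial>M) = (\<integral>\<^sup>+x. \<integral>\<^sup>+t. indicator {u x..<v x} t \<partial>lborel \<partial>M)"
      by (simp add: length)
    also have "\<dots> = (\<integral>\<^sup>+t. \<integral>\<^sup>+x. indicator {u x..<v x} t \<partial>M \<partial>lborel)"
      by (rule P.Fubini'[symmetric]) (simp add: indicator_def atLeastLessThan_iff)
    also have "\<dots> = (\<integral>\<^sup>+t. emeasure M {x\<in>space M. u x \<le> t \<and> t < v x} \<partial>lborel)"
    proof (rule nn_integral_cong)
      fix t :: real
      have "(\<integral>\<^sup>+x. indicator {u x..<v x} t \<partial>M)
          = (\<integral>\<^sup>+x. indicator {x\<in>space M. u x \<le> t \<and> t < v x} x \<partial>M)"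
        by (intro nn_integral_cong) (auto simp: indicator_def)
      then show "(\<integral>\<^sup>+x. indicator {u x..<v x} t \<partial>M) = emeasure M {x\<in>space M. u x \<le> t \<and> t < v x}"
        by simp
    qed
    finally show ?thesis .
  qed
  have level_measurable: "(\<lambda>t. emeasure M {x\<in>space M. u x \<le> t \<and> t < v x}) \<in> borel_measurable lborel"
    if [measurable]: "u \<in> borel_measurable M" "v \<in> borel_measurable M" for u v :: "'x \<Rightarrow> real"
    by measurable
  have level: "ennreal c * emeasure M {x\<in>space M. 0 \<le> t \<and> t < g x}
      \<le> (\<Sum>s\<in>S. emeasure M {x\<in>space M. g x \<le> t \<and> t < g (\<phi> s x)})" for t :: real
  proof (cases "0 \<le> t")
    case True
    define A where "A = {x\<in>space M. t < g x}"
    have A [measurable]: "A \<in> sets M" unfolding A_def by measurable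
    have "measure M A \<le> measure M {x\<in>space M. 0 < g x}"
      using True by (intro finite_measure_mono) (auto simp: A_def)
    then have "measure M A \<le> 1 / 2" using half by simp
    from exp[OF A this] have "ennreal (c * measure M A) \<le> ennreal (measure M (outer_boundary A))"
      by (rule ennreal_leI)
    also have "\<dots> = emeasure M (outer_boundary A)" by (simp add: emeasure_eq_measure)
    also have "\<dots> \<le> emeasure M (\<Union>s\<in>S. {x\<in>space M. g x \<le> t \<and> t < g (\<phi> s x)})"
    proof (rule emeasure_mono)
      show "outer_boundary A \<subseteq> (\<Union>s\<in>S. {x\<in>space M. g x \<le> t \<and> t < g (\<phi> s x)})"
      proof
        fix y assume "y \<in> outer_boundary A"
        then obtain s x where s: "s \<in> S" and x: "x \<in> A" "y = \<phi> s x" and y: "y \<notin> A"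
          by (auto simp: outer_boundary_def)
        have "y \<in> space M" "\<phi> (inv s) y = x" using s x by (auto simp: A_def)
        then show "y \<in> (\<Union>s\<in>S. {x\<in>space M. g x \<le> t \<and> t < g (\<phi> s x)})"
          using x y inv_S[OF s] by (force simp: A_def)
      qed
      show "(\<Union>s\<in>S. {x\<in>space M. g x \<le> t \<and> t < g (\<phi> s x)}) \<in> sets M"
        using finite_S by (intro sets.finite_UN) auto
    qed
    also have "\<dots> \<le> (\<Sum>s\<in>S. emeasure M {x\<in>space M. g x \<le> t \<and> t < g (\<phi> s x)})"
      using finite_S by (intro emeasure_subadditive_finite) auto
    finally show ?thesis using True c by (simp add: A_def emeasure_eq_measure ennreal_mult)
  qed simp
  have "ennreal c * (\<integral>\<^sup>+x. ennreal (g x) \<partial>M)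
      = ennreal c * (\<integral>\<^sup>+t. emeasure M {x\<in>space M. 0 \<le> t \<and> t < g x} \<partial>lborel)"
    using layer[of "\<lambda>_. 0" g] by simp
  also have "\<dots> = (\<integral>\<^sup>+t. ennreal c * emeasure M {x\<in>space M. 0 \<le> t \<and> t < g x} \<partial>lborel)"
    using level_measurable[of "\<lambda>_. 0" g] by (subst nn_integral_cmult) auto
  also have "\<dots> \<le> (\<integral>\<^sup>+t. (\<Sum>s\<in>S. emeasure M {x\<in>space M. g x \<le> t \<and> t < g (\<phi> s x)}) \<partial>lborel)"
    by (rule nn_integral_mono) (rule level)
  also have "\<dots> = (\<Sum>s\<in>S. \<integral>\<^sup>+t. emeasure M {x\<in>space M. g x \<le> t \<and> t < g (\<phi> s x)} \<partial>lborel)"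
    by (intro nn_integral_sum level_measurable) auto
  also have "\<dots> = (\<Sum>s\<in>S. \<integral>\<^sup>+x. ennreal (g (\<phi> s x) - g x) \<partial>M)"
    by (intro sum.cong refl layer[symmetric]) auto
  finally show ?thesis .
qed

text \<open>
  Cheeger's argument: apply the \<open>L\<^sup>1\<close> inequality to \<open>h\<^sup>2\<close> and split
  \<open>h(y)\<^sup>2 - h(x)\<^sup>2 = (h(y) - h(x)) (h(y) + h(x))\<close> by the arithmetic--geometric mean inequality, with
  weights such that the part with \<open>h(y) + h(x)\<close> is absorbed by the left-hand side.
\<close>

lemma cheeger_small_support:
  fixes h :: "'x \<Rightarrow> real"
  assumes c: "0 < c"
    and exp: "\<And>A. A \<in> sets M \<Longrightarrow> measure M A \<le> 1 / 2 \<Longrightarrow> c * measure M A \<le> measure M (outer_boundary A)"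
    and h [measurable]: "h \<in> borel_measurable M" and h_nonneg: "\<And>x. 0 \<le> h x"
    and int: "integrable M (\<lambda>x. (h x)\<^sup>2)"
    and half: "measure M {x\<in>space M. 0 < h x} \<le> 1 / 2"
  shows "c\<^sup>2 * (LINT x|M. (h x)\<^sup>2)
    \<le> 2 * card S * (1 + \<Theta>) * (\<Sum>s\<in>S. LINT x|M. (h x - h (\<phi> s x))\<^sup>2)"
proof -
  define \<epsilon> where "\<epsilon> = c / (2 * card S * (1 + \<Theta>))"
  have \<epsilon>: "0 < \<epsilon>" using c card_S_pos \<Theta>_ge_1 by (simp add: \<epsilon>_def)
  let ?I = "LINT x|M. (h x)\<^sup>2"
  let ?D = "\<lambda>s. LINT x|M. (h x - h (\<phi> s x))\<^sup>2"
  have act [measurable]: "\<phi> s \<in> measurable M M" if "s \<in> S" for s using that by (auto intro: action_measurable)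
  have bound: "(\<integral>\<^sup>+x. ennreal ((h (\<phi> s x))\<^sup>2 - (h x)\<^sup>2) \<partial>M)
      \<le> ennreal (1 / (2 * \<epsilon>) * ?D s + \<epsilon> * ((1 + \<Theta>) * ?I))" if s: "s \<in> S" for s
  proof -
    have int_s: "integrable M (\<lambda>x. (h (\<phi> s x))\<^sup>2)" by (rule integrable_action[OF s int])
    have int_d: "integrable M (\<lambda>x. (h x - h (\<phi> s x))\<^sup>2)"
    proof (rule Bochner_Integration.integrable_bound)
      show "integrable M (\<lambda>x. 2 * (h x)\<^sup>2 + 2 * (h (\<phi> s x))\<^sup>2)" using int int_s by simp
      have "(h x - h (\<phi> s x))\<^sup>2 \<le> 2 * (h x)\<^sup>2 + 2 * (h (\<phi> s x))\<^sup>2" for x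
        using zero_le_power2[of "h x + h (\<phi> s x)"] by (simp add: power2_eq_square algebra_simps)
      then show "AE x in M. norm ((h x - h (\<phi> s x))\<^sup>2) \<le> norm (2 * (h x)\<^sup>2 + 2 * (h (\<phi> s x))\<^sup>2)"
        by simp
    qed (use s in measurable)
    let ?b = "\<lambda>x. 1 / (2 * \<epsilon>) * (h x - h (\<phi> s x))\<^sup>2 + \<epsilon> * ((h x)\<^sup>2 + (h (\<phi> s x))\<^sup>2)"
    have "(\<integral>\<^sup>+x. ennreal ((h (\<phi> s x))\<^sup>2 - (h x)\<^sup>2) \<partial>M) \<le> (\<integral>\<^sup>+x. ennreal (?b x) \<partial>M)"
    proof (intro nn_integral_mono ennreal_leI)
      fix x
      define a b where "a = h x" and "b = h (\<phi> s x)"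
      have "2 * (1 / \<epsilon>) * ((b - a) * (b + a)) \<le> (1 / \<epsilon>)\<^sup>2 * (b - a)\<^sup>2 + (b + a)\<^sup>2"
        using sum_squares_bound[of "1 / \<epsilon> * (b - a)" "b + a"]
        by (simp only: power_mult_distrib mult.assoc)
      then have "(\<epsilon> / 2) * (2 * (1 / \<epsilon>) * ((b - a) * (b + a)))
          \<le> (\<epsilon> / 2) * ((1 / \<epsilon>)\<^sup>2 * (b - a)\<^sup>2 + (b + a)\<^sup>2)"
        using \<epsilon> by (intro mult_left_mono) auto
      also have "(\<epsilon> / 2) * (2 * (1 / \<epsilon>) * ((b - a) * (b + a))) = b\<^sup>2 - a\<^sup>2"
        using \<epsilon> by (simp add: power2_eq_square algebra_simps)
      also have "(\<epsilon> / 2) * ((1 / \<epsilon>)\<^sup>2 * (b - a)\<^sup>2 + (b + a)\<^sup>2)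
          = 1 / (2 * \<epsilon>) * (a - b)\<^sup>2 + \<epsilon> * ((b + a)\<^sup>2 / 2)"
        using \<epsilon> by (simp add: power2_eq_square field_simps)
      also have "\<dots> \<le> 1 / (2 * \<epsilon>) * (a - b)\<^sup>2 + \<epsilon> * (a\<^sup>2 + b\<^sup>2)"
      proof -
        have "(b + a)\<^sup>2 / 2 \<le> a\<^sup>2 + b\<^sup>2"
          using zero_le_power2[of "a - b"] by (simp add: power2_eq_square algebra_simps)
        then show ?thesis using \<epsilon> by (simp add: mult_left_mono)
      qed
      finally show "(h (\<phi> s x))\<^sup>2 - (h x)\<^sup>2 \<le> ?b x" by (simp add: a_def b_def)
    qed
    also have "\<dots> = ennreal (LINT x|M. ?b x)"
      using int int_s int_d \<epsilon> by (intro nn_integral_eq_integral) auto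
    also have "(LINT x|M. ?b x) = 1 / (2 * \<epsilon>) * ?D s + \<epsilon> * (?I + (LINT x|M. (h (\<phi> s x))\<^sup>2))"
      using int int_s int_d by simp
    also have "ennreal \<dots> \<le> ennreal (1 / (2 * \<epsilon>) * ?D s + \<epsilon> * ((1 + \<Theta>) * ?I))"
      using integral_action_le[OF s int] \<epsilon> by (intro ennreal_leI) (simp add: algebra_simps)
    finally show ?thesis .
  qed
  have "ennreal (c * ?I) = ennreal c * (\<integral>\<^sup>+x. ennreal ((h x)\<^sup>2) \<partial>M)"
    using c int by (simp add: nn_integral_eq_integral ennreal_mult)
  also have "\<dots> \<le> (\<Sum>s\<in>S. \<integral>\<^sup>+x. ennreal ((h (\<phi> s x))\<^sup>2 - (h x)\<^sup>2) \<partial>M)"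
  proof (rule coarea_expansion[OF less_imp_le[OF c] exp])
    show "measure M {x\<in>space M. 0 < (h x)\<^sup>2} \<le> 1 / 2"
    proof -
      have "{x\<in>space M. 0 < (h x)\<^sup>2} = {x\<in>space M. 0 < h x}" using h_nonneg by (auto simp: less_le)
      then show ?thesis using half by simp
    qed
  qed auto
  also have "\<dots> \<le> (\<Sum>s\<in>S. ennreal (1 / (2 * \<epsilon>) * ?D s + \<epsilon> * ((1 + \<Theta>) * ?I)))"
    by (intro sum_mono bound)
  also have "\<dots> = ennreal (\<Sum>s\<in>S. 1 / (2 * \<epsilon>) * ?D s + \<epsilon> * ((1 + \<Theta>) * ?I))"
    using \<epsilon> \<Theta>_ge_1 by (intro sum_ennreal) (auto intro!: add_nonneg_nonneg mult_nonneg_nonneg)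
  finally have "c * ?I \<le> (\<Sum>s\<in>S. 1 / (2 * \<epsilon>) * ?D s + \<epsilon> * ((1 + \<Theta>) * ?I))"
    using \<epsilon> \<Theta>_ge_1
    by (subst (asm) ennreal_le_iff) (auto intro!: sum_nonneg add_nonneg_nonneg mult_nonneg_nonneg)
  also have "\<dots> = 1 / (2 * \<epsilon>) * (\<Sum>s\<in>S. ?D s) + card S * \<epsilon> * (1 + \<Theta>) * ?I"
    by (simp add: sum.distrib sum_distrib_left)
  also have "card S * \<epsilon> * (1 + \<Theta>) = c / 2"
  proof -
    have cancel: "k * c / (2 * k) = c / 2" if "k \<noteq> 0" for k :: real using that by simp
    have "card S * \<epsilon> * (1 + \<Theta>) = card S * (1 + \<Theta>) * c / (2 * (card S * (1 + \<Theta>)))"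
      by (simp add: \<epsilon>_def mult_ac)
    also have "\<dots> = c / 2" using card_S_pos \<Theta>_ge_1 by (intro cancel) auto
    finally show ?thesis .
  qed
  finally have "c * ?I \<le> 1 / \<epsilon> * (\<Sum>s\<in>S. ?D s)" by simp
  then have "c * (c * ?I) \<le> c * (1 / \<epsilon> * (\<Sum>s\<in>S. ?D s))" using c by (intro mult_left_mono) auto
  also have "\<dots> = 2 * card S * (1 + \<Theta>) * (\<Sum>s\<in>S. ?D s)"
    using c by (simp add: \<epsilon>_def)
  finally show ?thesis by (simp add: power2_eq_square mult.assoc)
qed

text \<open>
  Subtracting a median leaves a positive and a negative part, each supported on a set of measure at
  most \<open>1/2\<close>. Their squared variations add up to at most that of \<open>f\<close>, because
  \<open>u \<mapsto> (max u 0, max (- u) 0)\<close> does not increase distances.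
\<close>

lemma poincare_real:
  fixes f :: "'x \<Rightarrow> real"
  assumes c: "0 < c"
    and exp: "\<And>A. A \<in> sets M \<Longrightarrow> measure M A \<le> 1 / 2 \<Longrightarrow> c * measure M A \<le> measure M (outer_boundary A)"
    and f [measurable]: "f \<in> borel_measurable M" and int: "integrable M (\<lambda>x. (f x)\<^sup>2)"
  shows "\<exists>m. c\<^sup>2 * (LINT x|M. (f x - m)\<^sup>2)
    \<le> 2 * card S * (1 + \<Theta>) * (\<Sum>s\<in>S. LINT x|M. (f x - f (\<phi> s x))\<^sup>2)"
proof -
  obtain m where m: "measure M {x\<in>space M. m < f x} \<le> 1 / 2" "measure M {x\<in>space M. f x < m} \<le> 1 / 2"
    using median_exists[OF f] by blast
  define p where "p x = max (f x - m) 0" for x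
  define n where "n x = max (m - f x) 0" for x
  have [measurable]: "p \<in> borel_measurable M" "n \<in> borel_measurable M"
    unfolding p_def n_def by measurable
  have sq_int: "integrable M (\<lambda>x. (k x)\<^sup>2)"
    if [measurable]: "k \<in> borel_measurable M" and le: "\<And>x. \<bar>k x\<bar> \<le> \<bar>f x\<bar> + \<bar>m\<bar>" for k :: "'x \<Rightarrow> real"
  proof (rule Bochner_Integration.integrable_bound)
    show "integrable M (\<lambda>x. 2 * (f x)\<^sup>2 + 2 * m\<^sup>2)" using int by simp
    have "(k x)\<^sup>2 \<le> 2 * (f x)\<^sup>2 + 2 * m\<^sup>2" for x
    proof -
      have "(k x)\<^sup>2 \<le> (\<bar>f x\<bar> + \<bar>m\<bar>)\<^sup>2" using power_mono[OF le abs_ge_zero, of x 2] by simp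
      also have "\<dots> \<le> 2 * (f x)\<^sup>2 + 2 * m\<^sup>2"
        using sum_squares_bound[of "\<bar>f x\<bar>" "\<bar>m\<bar>"] by (simp add: power2_sum)
      finally show ?thesis .
    qed
    then show "AE x in M. norm ((k x)\<^sup>2) \<le> norm (2 * (f x)\<^sup>2 + 2 * m\<^sup>2)" by simp
  qed measurable
  have int_p: "integrable M (\<lambda>x. (p x)\<^sup>2)" and int_n: "integrable M (\<lambda>x. (n x)\<^sup>2)"
    by (rule sq_int; force simp: p_def n_def)+
  let ?K = "2 * card S * (1 + \<Theta>)"
  have P: "c\<^sup>2 * (LINT x|M. (p x)\<^sup>2) \<le> ?K * (\<Sum>s\<in>S. LINT x|M. (p x - p (\<phi> s x))\<^sup>2)"
    using m by (intro cheeger_small_support c exp int_p) (auto simp: p_def less_max_iff_disj)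
  have N: "c\<^sup>2 * (LINT x|M. (n x)\<^sup>2) \<le> ?K * (\<Sum>s\<in>S. LINT x|M. (n x - n (\<phi> s x))\<^sup>2)"
    using m by (intro cheeger_small_support c exp int_n) (auto simp: n_def less_max_iff_disj)
  have diff_int: "integrable M (\<lambda>x. (k x - k (\<phi> s x))\<^sup>2)"
    if s: "s \<in> S" and [measurable]: "k \<in> borel_measurable M" and k: "integrable M (\<lambda>x. (k x)\<^sup>2)"
    for s and k :: "'x \<Rightarrow> real"
  proof -
    have "(\<lambda>x. complex_of_real (k x)) \<in> l2_space M" using k by (simp add: l2_space_def)
    from integrable_difference[OF s this] show ?thesis
      unfolding of_real_diff[symmetric] norm_of_real power2_abs .
  qed
  have "(LINT x|M. (p x - p (\<phi> s x))\<^sup>2) + (LINT x|M. (n x - n (\<phi> s x))\<^sup>2)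
      \<le> (LINT x|M. (f x - f (\<phi> s x))\<^sup>2)" if s: "s \<in> S" for s
  proof -
    note ints = diff_int[OF s _ int_p] diff_int[OF s _ int_n] diff_int[OF s f int]
    have "(LINT x|M. (p x - p (\<phi> s x))\<^sup>2) + (LINT x|M. (n x - n (\<phi> s x))\<^sup>2)
        = (LINT x|M. (p x - p (\<phi> s x))\<^sup>2 + (n x - n (\<phi> s x))\<^sup>2)"
      using ints by simp
    also have "\<dots> \<le> (LINT x|M. (f x - f (\<phi> s x))\<^sup>2)"
    proof (rule integral_mono)
      fix x
      have *: "(max u 0 - max v 0)\<^sup>2 + (max (- u) 0 - max (- v) 0)\<^sup>2 \<le> (u - v)\<^sup>2" for u v :: real
      proof -
        have "u * v \<le> 0" if "0 \<le> u \<and> v \<le> 0 \<or> u \<le> 0 \<and> 0 \<le> v"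
          using that by (auto simp: mult_le_0_iff)
        then show ?thesis
          by (cases "0 \<le> u"; cases "0 \<le> v") (auto simp: max_def power2_eq_square algebra_simps)
      qed
      show "(p x - p (\<phi> s x))\<^sup>2 + (n x - n (\<phi> s x))\<^sup>2 \<le> (f x - f (\<phi> s x))\<^sup>2"
        using *[of "f x - m" "f (\<phi> s x) - m"] by (simp add: p_def n_def)
    qed (use ints in auto)
    finally show ?thesis .
  qed
  then have "(\<Sum>s\<in>S. (LINT x|M. (p x - p (\<phi> s x))\<^sup>2) + (LINT x|M. (n x - n (\<phi> s x))\<^sup>2))
      \<le> (\<Sum>s\<in>S. LINT x|M. (f x - f (\<phi> s x))\<^sup>2)" by (rule sum_mono)
  then have "?K * ((\<Sum>s\<in>S. LINT x|M. (p x - p (\<phi> s x))\<^sup>2) + (\<Sum>s\<in>S. LINT x|M. (n x - n (\<phi> s x))\<^sup>2))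
      \<le> ?K * (\<Sum>s\<in>S. LINT x|M. (f x - f (\<phi> s x))\<^sup>2)"
    using \<Theta>_ge_1 by (intro mult_left_mono) (auto simp: sum.distrib)
  moreover have "(LINT x|M. (f x - m)\<^sup>2) = (LINT x|M. (p x)\<^sup>2) + (LINT x|M. (n x)\<^sup>2)"
  proof -
    have "(f x - m)\<^sup>2 = (p x)\<^sup>2 + (n x)\<^sup>2" for x
      by (cases "m \<le> f x") (auto simp: p_def n_def max_def power2_commute)
    then show ?thesis using int_p int_n by simp
  qed
  ultimately show ?thesis using P N by (intro exI[of _ m]) (simp add: distrib_left)
qed

lemma poincare:
  assumes c: "0 < c"
    and exp: "\<And>A. A \<in> sets M \<Longrightarrow> measure M A \<le> 1 / 2 \<Longrightarrow> c * measure M A \<le> measure M (outer_boundary A)"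
    and f: "f \<in> l2_space M"
  shows "\<exists>m. c\<^sup>2 * (LINT x|M. (cmod (f x - m))\<^sup>2) \<le> 2 * card S * (1 + \<Theta>) * variation f"
proof -
  have fm [measurable]: "f \<in> borel_measurable M" and int: "integrable M (\<lambda>x. (cmod (f x))\<^sup>2)"
    using f by (auto simp: l2_space_def)
  have re_im_int: "integrable M (\<lambda>x. (Re (g x))\<^sup>2)" "integrable M (\<lambda>x. (Im (g x))\<^sup>2)"
    if g: "g \<in> l2_space M" for g
  proof -
    have [measurable]: "g \<in> borel_measurable M" using g by (rule l2_space_measurable)
    have gi: "integrable M (\<lambda>x. (cmod (g x))\<^sup>2)" using g by (simp add: l2_space_def)
    show "integrable M (\<lambda>x. (Re (g x))\<^sup>2)"
      by (rule Bochner_Integration.integrable_bound[OF gi]) (auto simp: cmod_power2)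
    show "integrable M (\<lambda>x. (Im (g x))\<^sup>2)"
      by (rule Bochner_Integration.integrable_bound[OF gi]) (auto simp: cmod_power2)
  qed
  have split: "(LINT x|M. (cmod (g x))\<^sup>2) = (LINT x|M. (Re (g x))\<^sup>2) + (LINT x|M. (Im (g x))\<^sup>2)"
    if "g \<in> l2_space M" for g
    unfolding cmod_power2 using re_im_int[OF that] by simp
  let ?K = "2 * card S * (1 + \<Theta>)"
  obtain a where a: "c\<^sup>2 * (LINT x|M. (Re (f x) - a)\<^sup>2)
      \<le> ?K * (\<Sum>s\<in>S. LINT x|M. (Re (f x) - Re (f (\<phi> s x)))\<^sup>2)"
    using poincare_real[OF c exp _ re_im_int(1)[OF f]] by auto
  obtain b where b: "c\<^sup>2 * (LINT x|M. (Im (f x) - b)\<^sup>2)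
      \<le> ?K * (\<Sum>s\<in>S. LINT x|M. (Im (f x) - Im (f (\<phi> s x)))\<^sup>2)"
    using poincare_real[OF c exp _ re_im_int(2)[OF f]] by auto
  have "(LINT x|M. (cmod (f x - Complex a b))\<^sup>2)
      = (LINT x|M. (Re (f x) - a)\<^sup>2) + (LINT x|M. (Im (f x) - b)\<^sup>2)"
    using split[OF l2_space_diff[OF f const_l2_space]] by simp
  moreover have "variation f = (\<Sum>s\<in>S. LINT x|M. (Re (f x) - Re (f (\<phi> s x)))\<^sup>2)
      + (\<Sum>s\<in>S. LINT x|M. (Im (f x) - Im (f (\<phi> s x)))\<^sup>2)"
    unfolding variation_def sum.distrib[symmetric]
    using split[OF l2_space_diff[OF f l2_space_action[OF _ f]]] by (intro sum.cong) auto
  ultimately show ?thesis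
    using a b by (intro exI[of _ "Complex a b"]) (simp add: distrib_left)
qed

text \<open>
  A function with weighted mean zero is orthogonal to constants, so subtracting the constant \<open>m\<close> can
  only increase its weighted norm. The Poincare inequality bounds the larger norm.
\<close>

lemma gap_of_expanding:
  assumes "expanding_in_measure G M \<phi>"
  shows "\<exists>\<kappa>>0. \<forall>f\<in>l2_space M. integral\<^sup>L weighted f = 0 \<longrightarrow>
      \<kappa> * (l2_norm weighted f)\<^sup>2 \<le> Re (l2_inner weighted (\<Delta> f) f)"
proof -
  obtain c where c: "0 < c" and exp: "\<And>A. A \<in> sets M \<Longrightarrow> measure M A \<le> 1 / 2 \<Longrightarrow>
      c * measure M A \<le> measure M (outer_boundary A)"
    using expanding_by_generators[OF assms] by blast
  define K where "K = card S * sqrt \<Theta> * (2 * card S * (1 + \<Theta>) * (2 * sqrt \<Theta>))"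
  have K: "0 < K" using \<Theta>_ge_1 card_S_pos by (simp add: K_def)
  have "c\<^sup>2 / K * (l2_norm weighted f)\<^sup>2 \<le> Re (l2_inner weighted (\<Delta> f) f)"
    if f: "f \<in> l2_space M" and mean: "integral\<^sup>L weighted f = 0" for f
  proof -
    obtain m where m: "c\<^sup>2 * (LINT x|M. (cmod (f x - m))\<^sup>2) \<le> 2 * card S * (1 + \<Theta>) * variation f"
      using poincare[OF c exp f] by blast
    let ?m = "\<lambda>x::'x. - m"
    have fw: "f \<in> l2_space weighted" and mw: "?m \<in> l2_space weighted"
      and fmM: "(\<lambda>x. f x - m) \<in> l2_space M"
      using f const_l2_space by (auto simp: l2_space_weighted intro!: l2_space_diff)
    have "l2_inner weighted f ?m = 0" by (simp add: l2_inner_def mean)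
    then have "(l2_norm weighted f)\<^sup>2 \<le> (l2_norm weighted (\<lambda>x. f x - m))\<^sup>2"
      using l2_norm_add_square[OF fw mw] by simp
    also have "\<dots> \<le> card S * sqrt \<Theta> * (LINT x|M. (cmod (f x - m))\<^sup>2)"
      by (rule l2_norm_weighted_bounds(2)[OF fmM])
    finally have "c\<^sup>2 * (l2_norm weighted f)\<^sup>2
        \<le> c\<^sup>2 * (card S * sqrt \<Theta> * (LINT x|M. (cmod (f x - m))\<^sup>2))"
      using c by (intro mult_left_mono) auto
    also have "\<dots> = card S * sqrt \<Theta> * (c\<^sup>2 * (LINT x|M. (cmod (f x - m))\<^sup>2))" by simp
    also have "\<dots> \<le> card S * sqrt \<Theta> * (2 * card S * (1 + \<Theta>) * variation f)"
      using m \<Theta>_ge_1 by (intro mult_left_mono) auto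
    also have "\<dots> \<le> card S * sqrt \<Theta> * (2 * card S * (1 + \<Theta>)
        * (2 * sqrt \<Theta> * Re (l2_inner weighted (\<Delta> f) f)))"
      using laplacian_form_bounds(1)[OF f] \<Theta>_ge_1 by (intro mult_left_mono) auto
    also have "\<dots> = K * Re (l2_inner weighted (\<Delta> f) f)" by (simp add: K_def mult_ac)
    finally show ?thesis using K by (simp add: pos_divide_le_eq mult.commute)
  qed
  moreover have "0 < c\<^sup>2 / K" using c K by simp
  ultimately show ?thesis by blast
qed

theorem expanding_iff_isolated_simple:
  "expanding_in_measure G M \<phi> \<longleftrightarrow>
    0 isolated_in l2_spectrum weighted \<Delta> \<and> l2_has_multiplicity weighted \<Delta> 0 1"
  unfolding spectrum_iff_gap using gap_of_expanding expanding_of_gap by blast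

end

theorem propositionB:
  fixes G :: "('g, 'b) monoid_scheme"
    and S :: "'g set"
    and \<Theta> :: real
    and M :: "'x measure"
    and \<phi> :: "'g \<Rightarrow> 'x \<Rightarrow> 'x"
    and r :: "'g \<Rightarrow> 'x \<Rightarrow> real"
  assumes "group G"
    and "finite S" and "S \<subseteq> carrier G" and "generate G S = carrier G"
    and "\<forall>s\<in>S. inv\<^bsub>G\<^esub> s \<in> S" and "\<one>\<^bsub>G\<^esub> \<in> S"
    and "\<Theta> \<ge> 1"
    and "prob_space M"
    and "measure_class_preserving_action G M \<phi>"
    and "rn_version G M \<phi> r"
    and "\<forall>s\<in>S. \<forall>x\<in>space M. 1 / \<Theta> \<le> r s x \<and> r s x \<le> \<Theta>"
  shows "expanding_in_measure G M \<phi> \<longleftrightarrow>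
    0 isolated_in l2_spectrum (weighted_measure M S r) (laplacian M \<phi> S r) \<and>
    l2_has_multiplicity (weighted_measure M S r) (laplacian M \<phi> S r) 0 1"
proof -
  interpret bounded_rn_action G M \<phi> S r \<Theta>
    using assms unfolding measure_class_preserving_action_def
    by (intro bounded_rn_action.intro bounded_rn_action_axioms.intro) auto
  show ?thesis by (rule expanding_iff_isolated_simple)
qed

end
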